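(* Let $(Y,\ast)$ be a $2$-dimensional systolic complex with a basepoint $\ast\in Y^0$. Then the squaring $(X_Y,\ast)$ of $(Y,\ast)$ has flat intervals, i.e. for every vertex $v\in X_Y^0$ the interval $I(\ast,v)$ in $X_Y$ is a $\mathrm{CAT}(0)$ square complex.
   Context: All graphs are simplicial. Metrics are considered only on the $0$-skeleton of a complex, and are induced by the shortest path metric $d$ of the $1$-skeleton. The girth of a graph is the length of a shortest embedded cycle (infinite if there is none). The link of a vertex $v$ in a $2$-dimensional simplicial complex is the graph whose vertices are the neighbours of $v$, two of them being joined by an edge if they span a triangle together with $v$. A $2$-dimensional systolic complex is a simply connected $2$-dimensional simplicial complex in which the girth of the link of every vertex is at least $6$. Squaring: given a $2$-dimensional systolic complex $Y$ with basepoint $\ast\in Y^0$, let $X_Y^1$ be the subgraph of $Y^1$ with vertex set $Y^0$ whose edges are all the edges of $Y^1$ whose endpoints are not equidistant to $\ast$ (distances in $Y^1$). The squaring of $(Y,\ast)$ is the based square complex $(X_Y,\ast)$ obtained from $X_Y^1$ by attaching a unique square ($2$-cell) along its boundary to each embedded $4$-cycle of $X_Y^1$. A square complex is a $2$-dimensional CW complex with simplicial $1$-skeleton in which the attaching maps of $2$-cells are injective combinatorial maps from $4$-cycles; the closed $2$-cells are called squares, and no two squares are glued to the same $4$-cycle. (Subcomplexes without squares are allowed as degenerate square complexes.) For vertices $u,v$ of a square complex $X$, the interval $I(u,v)$ is the full subcomplex of $X$ induced by the set of vertices lying on geodesics of $X^1$ from $u$ to $v$. A square complex is $\mathrm{CAT}(0)$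 if it is $\mathrm{CAT}(0)$ when each square is metrized as a unit Euclidean square; equivalently, it is simply connected and the link of each vertex (the graph with a vertex for each incident edge and an edge for each corner of a square at the vertex) has no cycle of length less than $4$. *)

theory Defs
  imports "HOL-Analysis.Analysis" "HOL-Library.Extended_Nat"
begin

section \<open>Simplicial graphs\<close>

record 'v graph =
  verts :: "'v set"
  edges :: "'v set set"

definition simplicial_graph :: "('v, 'z) graph_scheme \<Rightarrow> bool" where
  "simplicial_graph G \<longleftrightarrow> (\<forall>e\<in>edges G. e \<subseteq> verts G \<and> card e = 2)"

definition walk :: "('v, 'z) graph_scheme \<Rightarrow> 'v \<Rightarrow> 'v list \<Rightarrow> 'v \<Rightarrow> bool" where
  "walk G u p v \<longleftrightarrow> p \<noteq> [] \<and> hd p = u \<and> last p = v \<and> set p \<subseteq> verts G \<and>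
     (\<forall>i. Suc i < length p \<longrightarrow> {p ! i, p ! Suc i} \<in> edges G)"

text \<open>The shortest path metric. It is \<open>\<infinity>\<close> for vertices in different components.\<close>

definition gdist :: "('v, 'z) graph_scheme \<Rightarrow> 'v \<Rightarrow> 'v \<Rightarrow> enat" where
  "gdist G u v = Inf {enat (length p - 1) | p. walk G u p v}"

definition geodesic :: "('v, 'z) graph_scheme \<Rightarrow> 'v \<Rightarrow> 'v list \<Rightarrow> 'v \<Rightarrow> bool" where
  "geodesic G u p v \<longleftrightarrow> walk G u p v \<and> enat (length p - 1) = gdist G u v"

definition cycle_edges :: "'v list \<Rightarrow> 'v set set" where
  "cycle_edges c = {{c ! i, c ! (Suc i mod length c)} | i. i < length c}"

definition embedded_cycle :: "('v, 'z) graph_scheme \<Rightarrow> 'v list \<Rightarrow> bool" where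
  "embedded_cycle G c \<longleftrightarrow>
     3 \<le> length c \<and> distinct c \<and> set c \<subseteq> verts G \<and> cycle_edges c \<subseteq> edges G"

text \<open>The infimum of the empty set is \<open>\<infinity>\<close>.\<close>

definition girth :: "('v, 'z) graph_scheme \<Rightarrow> enat" where
  "girth G = Inf {enat (length c) | c. embedded_cycle G c}"

section \<open>Simply connected spaces\<close>

text \<open>The library predicate \<^const>\<open>simply_connected\<close>, transferred from subsets of a
  topological type to abstract topologies; path-connectedness is included via constant loops.\<close>

definition simply_connected_space :: "'a topology \<Rightarrow> bool" where
  "simply_connected_space X \<longleftrightarrow>
     (\<forall>p q. pathin X p \<and> p 1 = p 0 \<and> pathin X q \<and> q 1 = q 0 \<longrightarrow>
        homotopic_with (\<lambda>r. r 1 = r 0) (top_of_set {0..1}) X p q)"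

lemma simply_connected_space_top_of_set:
  "simply_connected_space (top_of_set S) \<longleftrightarrow> simply_connected S"
proof -
  have "pathin (top_of_set S) p \<longleftrightarrow> path p \<and> path_image p \<subseteq> S" for p
    by (simp add: pathin_def path_def path_image_def image_subset_iff_funcset)
  then show ?thesis
    unfolding simply_connected_space_def simply_connected_def homotopic_loops_def
      pathstart_def pathfinish_def
    by (simp only: conj_assoc conj_left_commute conj_commute)
qed

section \<open>Simplicial complexes and their geometric realization\<close>

text \<open>An abstract simplicial complex is given by the set of its nonempty simplices. The realization
  consists of the barycentric coordinate functions and carries the weak topology with respect to
  the closed simplices; a closed simplex, being finite dimensional, has its Euclidean topology
  from the product topology on \<^typ>\<open>'v \<Rightarrow> real\<close>.\<close>

definition simplicial_complex :: "'v set set \<Rightarrow> bool" where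
  "simplicial_complex K \<longleftrightarrow>
     (\<forall>\<sigma>\<in>K. finite \<sigma> \<and> \<sigma> \<noteq> {} \<and> (\<forall>\<tau>. \<tau> \<subseteq> \<sigma> \<and> \<tau> \<noteq> {} \<longrightarrow> \<tau> \<in> K))"

definition closed_simplex :: "'v set \<Rightarrow> ('v \<Rightarrow> real) set" where
  "closed_simplex \<sigma> = {x. (\<forall>v. 0 \<le> x v) \<and> (\<forall>v. v \<notin> \<sigma> \<longrightarrow> x v = 0) \<and> (\<Sum>v\<in>\<sigma>. x v) = 1}"

definition realization_points :: "'v set set \<Rightarrow> ('v \<Rightarrow> real) set" where
  "realization_points K = (\<Union>\<sigma>\<in>K. closed_simplex \<sigma>)"

definition realization :: "'v set set \<Rightarrow> ('v \<Rightarrow> real) topology" where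
  "realization K = topology (\<lambda>U. U \<subseteq> realization_points K \<and>
     (\<forall>\<sigma>\<in>K. openin (top_of_set (closed_simplex \<sigma>)) (U \<inter> closed_simplex \<sigma>)))"

lemma openin_realization:
  "openin (realization K) U \<longleftrightarrow> U \<subseteq> realization_points K \<and>
     (\<forall>\<sigma>\<in>K. openin (top_of_set (closed_simplex \<sigma>)) (U \<inter> closed_simplex \<sigma>))"
proof -
  let ?P = "\<lambda>U. U \<subseteq> realization_points K \<and>
     (\<forall>\<sigma>\<in>K. openin (top_of_set (closed_simplex \<sigma>)) (U \<inter> closed_simplex \<sigma>))"
  have "istopology ?P"
    unfolding istopology_def
  proof (rule conjI; intro allI impI)
    fix S T assume S: "?P S" and T: "?P T"
    have "openin (top_of_set (closed_simplex \<sigma>)) (S \<inter> T \<inter> closed_simplex \<sigma>)" if "\<sigma> \<in> K" for \<sigma>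
    proof -
      have "S \<inter> T \<inter> closed_simplex \<sigma> = (S \<inter> closed_simplex \<sigma>) \<inter> (T \<inter> closed_simplex \<sigma>)" by blast
      then show ?thesis using S T that by (metis openin_Int)
    qed
    then show "?P (S \<inter> T)" using S by blast
  next
    fix \<U> assume "\<forall>U\<in>\<U>. ?P U"
    then have U: "\<And>U. U \<in> \<U> \<Longrightarrow> ?P U" by blast
    have "openin (top_of_set (closed_simplex \<sigma>)) (\<Union>\<U> \<inter> closed_simplex \<sigma>)" if "\<sigma> \<in> K" for \<sigma>
    proof -
      have "openin (top_of_set (closed_simplex \<sigma>)) (\<Union>U\<in>\<U>. U \<inter> closed_simplex \<sigma>)"
        using U that by (intro openin_Union) blast
      moreover have "(\<Union>U\<in>\<U>. U \<inter> closed_simplex \<sigma>) = \<Union>\<U> \<inter> closed_simplex \<sigma>" by blast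
      ultimately show ?thesis by simp
    qed
    then show "?P (\<Union>\<U>)" using U by blast
  qed
  then show ?thesis
    unfolding realization_def by (simp only: topology_inverse')
qed

section \<open>Two-dimensional systolic complexes\<close>

definition one_skeleton :: "'v set set \<Rightarrow> 'v graph" where
  "one_skeleton Y = \<lparr>verts = \<Union>Y, edges = {e\<in>Y. card e = 2}\<rparr>"

text \<open>Dimension is understood as dimension at most two.\<close>

definition two_dim_simplicial_complex :: "'v set set \<Rightarrow> bool" where
  "two_dim_simplicial_complex Y \<longleftrightarrow> simplicial_complex Y \<and> (\<forall>\<sigma>\<in>Y. card \<sigma> \<le> 3)"

definition simplicial_link :: "'v set set \<Rightarrow> 'v \<Rightarrow> 'v graph" where
  "simplicial_link Y v =
     \<lparr>verts = {u. {u, v} \<in> edges (one_skeleton Y)},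
      edges = {{a, b} | a b. {a, b, v} \<in> Y \<and> card {a, b, v} = 3}\<rparr>"

definition systolic_2complex :: "'v set set \<Rightarrow> bool" where
  "systolic_2complex Y \<longleftrightarrow> two_dim_simplicial_complex Y \<and>
     simply_connected_space (realization Y) \<and>
     (\<forall>v\<in>verts (one_skeleton Y). girth (simplicial_link Y v) \<ge> 6)"

section \<open>Square complexes\<close>

text \<open>As no two squares are glued to the same 4-cycle, a square is represented by the set of the
  four edges of its boundary.\<close>

record 'v square_complex = "'v graph" +
  squares :: "'v set set set"

definition four_cycles :: "('v, 'z) graph_scheme \<Rightarrow> 'v set set set" where
  "four_cycles G = {cycle_edges c | c. embedded_cycle G c \<and> length c = 4}"

definition square_complex :: "'v square_complex \<Rightarrow> bool" where
  "square_complex X \<longleftrightarrow> simplicial_graph X \<and> squares X \<subseteq> four_cycles X"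

text \<open>The topology of a square complex is modelled by the simplicial complex in which every square
  \<open>C\<close> is divided into four triangles, spanned by its centre \<open>Inr C\<close> and the four boundary edges.\<close>

definition square_subdivision ::
    "'v square_complex \<Rightarrow> ('v + 'v set set) set set" where
  "square_subdivision X =
     {{Inl v} | v. v \<in> verts X} \<union> {Inl ` e | e. e \<in> edges X} \<union>
     {{Inr C} | C. C \<in> squares X} \<union>
     {{Inr C, Inl v} | C v. C \<in> squares X \<and> v \<in> \<Union>C} \<union>
     {insert (Inr C) (Inl ` e) | C e. C \<in> squares X \<and> e \<in> C}"

text \<open>The link of a vertex of a square complex may have multiple edges: two squares sharing two
  consecutive boundary edges give a cycle of length 2. Hence cycles in links are cycles of
  multigraphs, with the vertices and the edges of the cycle required to be distinct. A square has at
  most one corner at a given vertex, so that corners at the vertex are labelled by squares.\<close>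

definition multigraph_cycle ::
    "'n set \<Rightarrow> 'e set \<Rightarrow> ('e \<Rightarrow> 'n set) \<Rightarrow> 'n list \<Rightarrow> 'e list \<Rightarrow> bool" where
  "multigraph_cycle N A ends ns as \<longleftrightarrow>
     ns \<noteq> [] \<and> length as = length ns \<and> distinct ns \<and> distinct as \<and> set ns \<subseteq> N \<and> set as \<subseteq> A \<and>
     (\<forall>i<length ns. ends (as ! i) = {ns ! i, ns ! (Suc i mod length ns)})"

definition square_link_cycle ::
    "'v square_complex \<Rightarrow> 'v \<Rightarrow> 'v set list \<Rightarrow> 'v set set list \<Rightarrow> bool" where
  "square_link_cycle X v =
     multigraph_cycle {e\<in>edges X. v \<in> e} {C\<in>squares X. v \<in> \<Union>C} (\<lambda>C. {e\<in>C. v \<in> e})"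

definition CAT0_square_complex :: "'v square_complex \<Rightarrow> bool" where
  "CAT0_square_complex X \<longleftrightarrow> square_complex X \<and>
     simply_connected_space (realization (square_subdivision X)) \<and>
     (\<forall>v\<in>verts X. \<forall>es Cs. square_link_cycle X v es Cs \<longrightarrow> 4 \<le> length es)"

definition full_subcomplex :: "'v square_complex \<Rightarrow> 'v set \<Rightarrow> 'v square_complex" where
  "full_subcomplex X W =
     \<lparr>verts = verts X \<inter> W, edges = {e\<in>edges X. e \<subseteq> W}, squares = {C\<in>squares X. \<Union>C \<subseteq> W}\<rparr>"

definition interval_complex :: "'v square_complex \<Rightarrow> 'v \<Rightarrow> 'v \<Rightarrow> 'v square_complex" where
  "interval_complex X u v = full_subcomplex X {w. \<exists>p. geodesic X u p v \<and> w \<in> set p}"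

definition flat_intervals :: "'v square_complex \<Rightarrow> 'v \<Rightarrow> bool" where
  "flat_intervals X b \<longleftrightarrow> (\<forall>v\<in>verts X. CAT0_square_complex (interval_complex X b v))"

section \<open>Squaring\<close>

definition squaring_graph :: "'v set set \<Rightarrow> 'v \<Rightarrow> 'v graph" where
  "squaring_graph Y b =
     \<lparr>verts = verts (one_skeleton Y),
      edges = {{x, y} | x y. {x, y} \<in> edges (one_skeleton Y) \<and>
                 gdist (one_skeleton Y) b x \<noteq> gdist (one_skeleton Y) b y}\<rparr>"

definition squaring :: "'v set set \<Rightarrow> 'v \<Rightarrow> 'v square_complex" where
  "squaring Y b =
     \<lparr>verts = verts (squaring_graph Y b), edges = edges (squaring_graph Y b),
      squares = four_cycles (squaring_graph Y b)\<rparr>"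

end

theory Submission
  imports Defs "HOL-Library.FSet"
begin

text \<open>The structure of balls in \<open>Y\<close> is obtained by developing the universal cover level by level.
  A vertex of the cover on level \<open>n + 1\<close> is given by its image in \<open>Y\<close> and its neighbours on level
  \<open>n\<close>; the girth condition ensures that there are at most two of these, that they are adjacent, that
  neighbours on the same level have a common neighbour below, and that the cover is locally
  isomorphic to \<open>Y\<close>. As \<open>Y\<close> is simply connected, the cover is \<open>Y\<close> itself, with levels the distances
  from \<open>b\<close>.

  The vertices of \<open>I(b, v)\<close> are those from which \<open>v\<close> is reached by going up. On each level any two of
  them are joined by a horizontal path that is straight: the triangles below consecutive edges have
  different apices. Their apices form a straight path again, so by descending one sees that straight
  paths do not close up, and that two vertices of the interval do not have the same two lower
  neighbours. Hence all squares of the interval have a top, a bottom and two sides, and a square is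
  determined by its top. The link condition follows from the girth condition, and the interval is
  collapsed to \<open>b\<close> by removing top vertices one by one.\<close>

section \<open>Triangles and links\<close>

text \<open>Simple connectedness of \<open>Y\<close> is used only to see that edge paths connect all
  vertices and that closed edge paths lift to closed paths. Everything about the shape of balls is
  local and comes from excluding cycles of length 3, 4 and 5 in links. The levels are therefore
  built in the cover, where they can be computed recursively without knowing any distance in
  \<open>Y\<close>; the comparison with the graph metric comes last. The main obstacle is global: a
  4-cycle of the squaring may alternate between two upper and two lower vertices. This does happen,
  for instance when one triangle below an edge and two above it share that edge, and no condition on
  links forbids it. Only the common upper vertex \<open>v\<close> rules it out in an interval, which
  is why information has to be carried from \<open>v\<close> down to the level of the
  4-cycle.\<close>

locale systolic =
  fixes Y :: "'v set set" and b :: 'v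
  assumes systolic: "systolic_2complex Y"
    and base: "b \<in> \<Union>Y"
begin

definition A :: "'v \<Rightarrow> 'v \<Rightarrow> bool" where
  "A x y \<longleftrightarrow> x \<noteq> y \<and> {x, y} \<in> Y"

definition T :: "'v \<Rightarrow> 'v \<Rightarrow> 'v \<Rightarrow> bool" where
  "T x y z \<longleftrightarrow> x \<noteq> y \<and> y \<noteq> z \<and> x \<noteq> z \<and> {x, y, z} \<in> Y"

lemma complex: "simplicial_complex Y"
  using systolic by (simp add: systolic_2complex_def two_dim_simplicial_complex_def)

lemma face: "\<sigma> \<in> Y \<Longrightarrow> \<tau> \<subseteq> \<sigma> \<Longrightarrow> \<tau> \<noteq> {} \<Longrightarrow> \<tau> \<in> Y"
  using complex unfolding simplicial_complex_def by blast

lemma A_sym: "A x y \<Longrightarrow> A y x"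
  by (auto simp add: A_def insert_commute)

lemma T_perm:
  assumes "T x y z"
  shows "T x z y" "T y x z" "T y z x" "T z x y" "T z y x"
proof -
  have "{x,z,y} = {x,y,z}" "{y,x,z} = {x,y,z}" "{y,z,x} = {x,y,z}" "{z,x,y} = {x,y,z}" "{z,y,x} = {x,y,z}"
    by auto
  then show "T x z y" "T y x z" "T y z x" "T z x y" "T z y x"
    using assms by (auto simp: T_def)
qed

lemma T_neq: "T x y z \<Longrightarrow> x \<noteq> y \<and> y \<noteq> z \<and> x \<noteq> z"
  by (auto simp: T_def)

lemma T_A:
  assumes "T x y z"
  shows "A x y" "A y z" "A x z"
  using assms face[of "{x,y,z}" "{x,y}"] face[of "{x,y,z}" "{y,z}"] face[of "{x,y,z}" "{x,z}"]
  by (simp_all add: T_def A_def)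

lemma edge_one_skeleton: "{x, y} \<in> edges (one_skeleton Y) \<longleftrightarrow> A x y"
  by (auto simp: one_skeleton_def A_def card_insert_if)

lemma edge_link:
  assumes "T v x y"
  shows "{x, y} \<in> edges (simplicial_link Y v)"
proof -
  have "{x, y, v} \<in> Y" "card {x, y, v} = 3"
    using assms T_perm(3)[OF assms] by (simp_all add: T_def)
  then show ?thesis by (auto simp: simplicial_link_def)
qed

lemma vert_link:
  assumes "T v x y"
  shows "x \<in> verts (simplicial_link Y v)"
  using T_A[OF assms] A_sym by (auto simp: simplicial_link_def edge_one_skeleton)

lemma link_cycle_length:
  assumes c: "embedded_cycle (simplicial_link Y v) c" and v: "v \<in> \<Union>Y"
  shows "6 \<le> length c"
proof -
  have "girth (simplicial_link Y v) \<ge> 6"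
    using systolic v by (auto simp: systolic_2complex_def one_skeleton_def)
  moreover have "girth (simplicial_link Y v) \<le> enat (length c)"
    unfolding girth_def using c by (intro Inf_lower) blast
  ultimately have "(6::enat) \<le> enat (length c)" by (rule order_trans)
  then show ?thesis by (simp add: numeral_eq_enat)
qed

lemma link_cycle:
  assumes "3 \<le> length c" "distinct c" "\<And>i. i < length c \<Longrightarrow> T v (c ! i) (c ! (Suc i mod length c))"
  shows "6 \<le> length c"
proof (rule link_cycle_length)
  have "set c \<subseteq> verts (simplicial_link Y v)"
  proof
    fix x assume "x \<in> set c"
    then obtain i where "i < length c" "x = c ! i" by (auto simp: in_set_conv_nth)
    with assms(3) vert_link show "x \<in> verts (simplicial_link Y v)" by blast
  qed
  moreover have "cycle_edges c \<subseteq> edges (simplicial_link Y v)"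
    using assms(3) edge_link by (auto simp: cycle_edges_def)
  ultimately show "embedded_cycle (simplicial_link Y v) c"
    using assms(1,2) by (simp add: embedded_cycle_def)
  have "0 < length c" using assms(1) by linarith
  from assms(3)[OF this] show "v \<in> \<Union>Y" by (auto simp: T_def)
qed

lemma no_link_3cycle:
  assumes "T v x y" "T v y z" "T v z x"
  shows False
proof -
  have "T v ([x,y,z] ! i) ([x,y,z] ! (Suc i mod 3))" if "i < 3" for i
  proof -
    have "i = 0 \<or> i = 1 \<or> i = 2" using that by linarith
    then show ?thesis using assms by (elim disjE) simp_all
  qed
  then show False
    using link_cycle[of "[x,y,z]" v] T_neq[OF assms(1)] T_neq[OF assms(2)] T_neq[OF assms(3)] by auto
qed

text \<open>Consecutive vertices are distinct by \<open>T\<close>. The diagonals need hypotheses of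
  their own, since a closed walk of length four may run back and forth along a path.\<close>

lemma no_link_4cycle:
  assumes "T v x y" "T v y z" "T v z w" "T v w x" "x \<noteq> z" "y \<noteq> w"
  shows False
proof -
  have "T v ([x,y,z,w] ! i) ([x,y,z,w] ! (Suc i mod 4))" if "i < 4" for i
  proof -
    have "i = 0 \<or> i = 1 \<or> i = 2 \<or> i = 3" using that by linarith
    then show ?thesis using assms by (elim disjE) simp_all
  qed
  then show False
    using link_cycle[of "[x,y,z,w]" v] assms T_neq[OF assms(1)] T_neq[OF assms(2)] T_neq[OF assms(3)]
      T_neq[OF assms(4)] by auto
qed

text \<open>No distinctness is required: a degenerate closed walk of length five contains a triangle.\<close>

lemma no_link_5walk:
  assumes "T v x y" "T v y z" "T v z w" "T v w u" "T v u x"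
  shows False
proof -
  have "x \<noteq> z" using no_link_3cycle[of v z w u] assms by metis
  moreover have "y \<noteq> w" using no_link_3cycle[of v w u x] assms by metis
  moreover have "z \<noteq> u" using no_link_3cycle[of v u x y] assms by metis
  moreover have "w \<noteq> x" using no_link_3cycle[of v x y z] assms by metis
  moreover have "u \<noteq> y" using no_link_3cycle[of v y z w] assms by metis
  moreover have "T v ([x,y,z,w,u] ! i) ([x,y,z,w,u] ! (Suc i mod 5))" if "i < 5" for i
  proof -
    have "i = 0 \<or> i = 1 \<or> i = 2 \<or> i = 3 \<or> i = 4" using that by linarith
    then show ?thesis using assms by (elim disjE) simp_all
  qed
  ultimately show False
    using link_cycle[of "[x,y,z,w,u]" v] T_neq[OF assms(1)] T_neq[OF assms(2)] T_neq[OF assms(3)]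
      T_neq[OF assms(4)] T_neq[OF assms(5)] by auto
qed

end

section \<open>Development of the universal cover\<close>

text \<open>A state is a vertex of the cover: its image in \<open>Y\<close> and its neighbours on the previous level.\<close>

datatype 'v state = State (pt: 'v) (preds: "'v state fset")

lemma state_eqI: "pt s = pt t \<Longrightarrow> fset (preds s) = fset (preds t) \<Longrightarrow> s = t"
  by (metis fset_inject state.expand)

context systolic
begin

text \<open>The relation \<open>hadj\<close> is adjacency on the same level, and \<open>old s\<close> are the images of the neighbours
  of \<open>s\<close> on its own or on the previous level.\<close>

definition hadj :: "'v state \<Rightarrow> 'v state \<Rightarrow> bool" where
  "hadj s t \<longleftrightarrow> (\<exists>d. d |\<in>| preds s \<and> d |\<in>| preds t \<and> T (pt d) (pt s) (pt t))"

definition old :: "'v state \<Rightarrow> 'v \<Rightarrow> bool" where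
  "old s y \<longleftrightarrow> (\<exists>d. d |\<in>| preds s \<and> (pt d = y \<or> T (pt d) (pt s) y))"

text \<open>An edge from \<open>s\<close> to a vertex \<open>y\<close> that is not old leads to a new state, which must also be reached
  from the horizontal neighbours of \<open>s\<close> spanning a triangle with \<open>y\<close>.\<close>

fun Z :: "nat \<Rightarrow> 'v state set" where
  "Z 0 = {State b {||}}"
| "Z (Suc n) = {State y (Abs_fset (insert s {t \<in> Z n. hadj s t \<and> T (pt t) (pt s) y})) | s y.
     s \<in> Z n \<and> A (pt s) y \<and> \<not> old s y}"

text \<open>The set to which \<open>Abs_fset\<close> is applied in \<open>Z\<close>, kept as a plain
  set so that one can reason about it before its finiteness is known.\<close>

definition newpreds :: "nat \<Rightarrow> 'v state \<Rightarrow> 'v \<Rightarrow> 'v state set" where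
  "newpreds n s y = insert s {t \<in> Z n. hadj s t \<and> T (pt t) (pt s) y}"

lemma hadj_sym: "hadj s t \<Longrightarrow> hadj t s"
  unfolding hadj_def using T_perm by blast

text \<open>The invariant of the recursion: each single predecessor \<open>d\<close> would produce
  the same set of predecessors. Thus a state is determined by its image and any one of its
  predecessors.\<close>

definition regular :: "nat \<Rightarrow> 'v state \<Rightarrow> bool" where
  "regular n s \<longleftrightarrow> (\<forall>d. d |\<in>| preds s \<longrightarrow> (\<exists>m. n = Suc m \<and> d \<in> Z m \<and> A (pt d) (pt s) \<and>
     \<not> old d (pt s) \<and> fset (preds s) = newpreds m d (pt s)))"

lemma regular_preds:
  assumes "regular n s" "d |\<in>| preds s" "e |\<in>| preds s" "d \<noteq> e"
  shows "hadj d e" "T (pt e) (pt d) (pt s)"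
  using assms unfolding regular_def newpreds_def by fastforce+

lemma regular_unique:
  assumes "regular n s" "regular n t" "d |\<in>| preds s" "d |\<in>| preds t" "pt s = pt t"
  shows "s = t"
  using assms unfolding regular_def by (intro state_eqI) fastforce+

text \<open>A new vertex \<open>y\<close> has at most one lower neighbour besides \<open>s\<close>:
  two partners, together with the vertices below them, give a closed walk in the link of
  \<open>pt s\<close>, of length four if the vertices below coincide and of length five
  otherwise.\<close>

lemma partner_unique:
  assumes reg: "\<And>s. s \<in> Z n \<Longrightarrow> regular n s"
    and s: "s \<in> Z n" "\<not> old s y"
    and t: "t \<in> Z n" "hadj s t" "T (pt t) (pt s) y"
    and t': "t' \<in> Z n" "hadj s t'" "T (pt t') (pt s) y"
  shows "t = t'"
proof -
  obtain d where d: "d |\<in>| preds s" "d |\<in>| preds t" "T (pt d) (pt s) (pt t)"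
    using t by (auto simp: hadj_def)
  obtain d' where d': "d' |\<in>| preds s" "d' |\<in>| preds t'" "T (pt d') (pt s) (pt t')"
    using t' by (auto simp: hadj_def)
  have y: "pt d \<noteq> y" using s d by (auto simp: old_def)
  show ?thesis
  proof (cases "d = d'")
    case True
    have "pt t = pt t'"
      using no_link_4cycle[of "pt s" "pt d" "pt t" y "pt t'"] d d' t t' y True T_perm by blast
    with True d d' t t' reg show ?thesis by (blast intro: regular_unique)
  next
    case False
    have "T (pt d') (pt d) (pt s)" using regular_preds(2) reg s d d' False by blast
    then show ?thesis
      using no_link_5walk[of "pt s" y "pt t" "pt d" "pt d'" "pt t'"] d d' t t' T_perm by blast
  qed
qed

text \<open>This makes the construction symmetric in \<open>s\<close> and \<open>t\<close>. If
  \<open>y\<close> were old for \<open>t\<close>, then \<open>pt s\<close>, \<open>pt d\<close>,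
  \<open>y\<close> and possibly a further predecessor would form a cycle of length three or four in
  the link of \<open>pt t\<close>.\<close>

lemma partner_not_old:
  assumes reg: "\<And>s. s \<in> Z n \<Longrightarrow> regular n s"
    and s: "s \<in> Z n" "\<not> old s y"
    and t: "t \<in> Z n" "hadj s t" "T (pt t) (pt s) y"
  shows "\<not> old t y"
proof
  assume "old t y"
  then obtain e where e: "e |\<in>| preds t" "pt e = y \<or> T (pt e) (pt t) y"
    by (auto simp: old_def)
  obtain d where d: "d |\<in>| preds s" "d |\<in>| preds t" "T (pt d) (pt s) (pt t)"
    using t by (auto simp: hadj_def)
  have y: "pt d \<noteq> y" "\<not> T (pt d) (pt s) y" using s d by (auto simp: old_def)
  show False
  proof (cases "e = d")
    case True
    then have "T (pt d) (pt t) y" using e y by blast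
    then show False
      using no_link_3cycle[of "pt t" "pt s" "pt d" y] d t T_perm by blast
  next
    case False
    have he: "hadj d e" "T (pt e) (pt d) (pt t)"
      using regular_preds reg t d e False by blast+
    have "\<not> old d (pt s)" using reg[OF s(1)] d by (auto simp: regular_def)
    moreover have "old d (pt e)"
      using he(1) by (auto simp: hadj_def old_def)
    ultimately have ne: "pt s \<noteq> pt e" by auto
    from e(2) show False
    proof
      assume "pt e = y"
      then show False using no_link_3cycle[of "pt t" "pt s" "pt d" y] d t he T_perm by blast
    next
      assume "T (pt e) (pt t) y"
      then show False
        using no_link_4cycle[of "pt t" "pt s" "pt d" "pt e" y] d t he ne y T_perm by blast
    qed
  qed
qed

lemma newpreds_cases:
  assumes reg: "\<And>s. s \<in> Z n \<Longrightarrow> regular n s"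
    and s: "s \<in> Z n" "\<not> old s y"
    and t: "t \<in> newpreds n s y" "t \<noteq> s"
  shows "newpreds n s y = {s, t}"
  using partner_unique[OF reg s] t unfolding newpreds_def by blast

text \<open>The new state over \<open>y\<close> does not depend on which of its lower neighbours it
  is constructed from.\<close>

lemma newpreds_swap:
  assumes reg: "\<And>s. s \<in> Z n \<Longrightarrow> regular n s"
    and s: "s \<in> Z n" "A (pt s) y" "\<not> old s y"
    and t: "t \<in> newpreds n s y"
  shows "t \<in> Z n \<and> A (pt t) y \<and> \<not> old t y \<and> newpreds n t y = newpreds n s y"
proof (cases "t = s")
  case False
  then have t': "t \<in> Z n" "hadj s t" "T (pt t) (pt s) y"
    using t by (auto simp: newpreds_def)
  have not_old: "\<not> old t y" by (rule partner_not_old[OF reg s(1,3) t'])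
  have "s \<in> newpreds n t y"
    using t' s hadj_sym T_perm(2)[OF t'(3)] by (simp add: newpreds_def)
  then have "newpreds n t y = {t, s}"
    using newpreds_cases[OF reg t'(1) not_old] False by simp
  moreover have "newpreds n s y = {s, t}"
    using newpreds_cases[OF reg s(1,3) t False] .
  ultimately show ?thesis using t' not_old T_A(3) by blast
qed (use s in auto)

text \<open>\<open>Abs_fset\<close> is meaningful on finite sets only; by
  \<open>newpreds_cases\<close> there are at most two elements.\<close>

lemma fset_newpreds:
  assumes reg: "\<And>s. s \<in> Z n \<Longrightarrow> regular n s"
    and s: "s \<in> Z n" "\<not> old s y"
  shows "fset (Abs_fset (newpreds n s y)) = newpreds n s y"
proof -
  have "finite (newpreds n s y)"
  proof (cases "\<exists>t. t \<in> newpreds n s y \<and> t \<noteq> s")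
    case True
    then show ?thesis using newpreds_cases[OF reg s] by (metis finite.emptyI finite_insert)
  next
    case False
    then have "newpreds n s y \<subseteq> {s}" by blast
    then show ?thesis using finite_subset by blast
  qed
  then show ?thesis by (simp add: Abs_fset_inverse)
qed

text \<open>The preceding lemmas assume regularity on level \<open>n\<close>, which is the induction
  hypothesis here, and provide it on level \<open>Suc n\<close>.\<close>

lemma Z_regular: "s \<in> Z n \<Longrightarrow> regular n s"
proof (induction n arbitrary: s)
  case 0
  then show ?case by (auto simp: regular_def)
next
  case (Suc n)
  obtain s0 y where s0: "s0 \<in> Z n" "A (pt s0) y" "\<not> old s0 y"
    and s: "s = State y (Abs_fset (newpreds n s0 y))"
    using Suc.prems by (auto simp: newpreds_def)
  have "fset (preds s) = newpreds n s0 y" "pt s = y"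
    using fset_newpreds[OF Suc.IH s0(1,3)] s by simp_all
  then show ?case
    using newpreds_swap[OF Suc.IH s0] unfolding regular_def by auto
qed

lemma Z_pred:
  assumes "s \<in> Z n" "d |\<in>| preds s"
  obtains m where "n = Suc m" "d \<in> Z m" "A (pt d) (pt s)" "\<not> old d (pt s)"
    "fset (preds s) = newpreds m d (pt s)"
  using Z_regular[OF assms(1)] assms(2) unfolding regular_def by blast

lemma Z_preds:
  assumes "s \<in> Z n" "d |\<in>| preds s" "e |\<in>| preds s" "d \<noteq> e"
  shows "hadj d e" "T (pt e) (pt d) (pt s)"
  using regular_preds[OF Z_regular] assms by blast+

lemma Z_new:
  assumes "s \<in> Z n" "A (pt s) y" "\<not> old s y"
  obtains t where "t \<in> Z (Suc n)" "s |\<in>| preds t" "pt t = y"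
proof
  let ?t = "State y (Abs_fset (newpreds n s y))"
  show "?t \<in> Z (Suc n)" using assms by (auto simp: newpreds_def)
  show "s |\<in>| preds ?t"
    using fset_newpreds[OF Z_regular assms(1,3)] by (simp add: newpreds_def)
qed simp

lemma Z_Suc_pred:
  assumes "s \<in> Z (Suc n)"
  obtains d where "d |\<in>| preds s" "d \<in> Z n"
proof -
  obtain s0 y where s0: "s0 \<in> Z n" "\<not> old s0 y"
    and s: "s = State y (Abs_fset (newpreds n s0 y))"
    using assms by (auto simp: newpreds_def)
  then have "s0 |\<in>| preds s"
    using fset_newpreds[OF Z_regular s0] by (simp add: newpreds_def)
  with s0 that show thesis by blast
qed

text \<open>A state carries its whole history in \<open>preds\<close>, so following predecessors
  down to the root determines the level.\<close>

lemma Z_level_unique: "s \<in> Z m \<Longrightarrow> s \<in> Z n \<Longrightarrow> m = n"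
proof (induction m arbitrary: s n)
  case 0
  then have "preds s = {||}" by simp
  then show ?case using 0(2) by (cases n) (auto elim: Z_Suc_pred simp del: Z.simps)
next
  case (Suc m)
  obtain d where d: "d |\<in>| preds s" "d \<in> Z m" using Suc.prems(1) by (rule Z_Suc_pred)
  show ?case using Z_pred[OF Suc.prems(2) d(1)] Suc.IH d(2) by metis
qed

lemma Z_pred_unique:
  assumes "s \<in> Z m" "t \<in> Z n" "d |\<in>| preds s" "d |\<in>| preds t" "pt s = pt t"
  shows "s = t"
proof -
  have "m = n" using Z_pred[OF assms(1,3)] Z_pred[OF assms(2,4)] Z_level_unique by metis
  then show ?thesis using regular_unique Z_regular assms by blast
qed

section \<open>The cover is locally isomorphic to \<open>Y\<close>\<close>

definition states :: "'v state set" where "states = (\<Union>n. Z n)"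

definition nb :: "'v state \<Rightarrow> 'v state \<Rightarrow> bool" where
  "nb s t \<longleftrightarrow> t |\<in>| preds s \<or> s |\<in>| preds t \<or> hadj s t"

lemma nb_sym: "nb s t \<Longrightarrow> nb t s"
  unfolding nb_def using hadj_sym by blast

lemma nb_A:
  assumes "s \<in> states" "t \<in> states" "nb s t"
  shows "A (pt s) (pt t)"
  using assms unfolding nb_def states_def hadj_def
  by (metis UN_E Z_pred A_sym T_A(2))

lemma old_pred_sibling:
  assumes "s \<in> Z n" "d |\<in>| preds s" "e |\<in>| preds s" "d \<noteq> e"
  shows "old d (pt e)"
  using Z_preds(1)[OF assms] by (auto simp: hadj_def old_def)

text \<open>Suppose \<open>y\<close> were old for \<open>d\<close>, through a triangle with some
  \<open>c\<close> below \<open>d\<close>. By induction \<open>y\<close> is new for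
  \<open>c\<close>, so there is a state over \<open>y\<close> above \<open>c\<close>, on the level
  of \<open>d\<close> and adjacent to \<open>d\<close>. It would then be a second predecessor of
  \<open>s\<close>, which the last hypothesis excludes.\<close>

lemma not_old_horizontal:
  assumes "s \<in> Z n" "d |\<in>| preds s" "T (pt d) (pt s) y" "\<And>e. e |\<in>| preds s \<Longrightarrow> pt e \<noteq> y"
  shows "\<not> old d y"
  using assms
proof (induction n arbitrary: s d)
  case 0
  then show ?case by simp
next
  case (Suc n)
  have d: "d \<in> Z n" "A (pt d) (pt s)" "\<not> old d (pt s)" "fset (preds s) = newpreds n d (pt s)"
    using Z_pred[OF Suc.prems(1,2)] by auto
  show ?case
  proof
    assume "old d y"
    then obtain c where c: "c |\<in>| preds d" "pt c = y \<or> T (pt c) (pt d) y" by (auto simp: old_def)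
    have nT: "\<not> T (pt c) (pt d) (pt s)" using c d by (auto simp: old_def)
    have ny: "pt c \<noteq> y" using nT Suc.prems(3) T_perm by blast
    with c have T: "T (pt c) (pt d) y" by simp
    have npred: "pt e \<noteq> y" if "e |\<in>| preds d" for e
      using that d Suc.prems(3) T_perm unfolding old_def by blast
    obtain m where m: "n = Suc m" "c \<in> Z m" using Z_pred[OF d(1) c(1)] by metis
    have "\<not> old c y" using Suc.IH[OF d(1) c(1) T npred] .
    then obtain t where t: "t \<in> Z n" "c |\<in>| preds t" "pt t = y"
      using Z_new[OF m(2)] T_A(3)[OF T] m by metis
    have "hadj d t" using t c T by (auto simp: hadj_def)
    then have "t \<in> newpreds n d (pt s)"
      using t T_perm(4)[OF Suc.prems(3)] by (simp add: newpreds_def)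
    then show False using d(4) Suc.prems(4) t by auto
  qed
qed

text \<open>If \<open>y\<close> is old through a triangle with a predecessor \<open>d\<close>, the
  edge is lifted around that triangle: down to \<open>d\<close> and up again, which
  \<open>not_old_horizontal\<close> permits.\<close>

lemma nb_exists:
  assumes "s \<in> states" "A (pt s) y"
  obtains t where "t \<in> states" "nb s t" "pt t = y"
proof -
  obtain n where s: "s \<in> Z n" using assms by (auto simp: states_def)
  show thesis
  proof (cases "old s y")
    case False
    then obtain t where "t \<in> Z (Suc n)" "s |\<in>| preds t" "pt t = y"
      using Z_new[OF s assms(2)] by metis
    then show thesis by (intro that[of t]) (auto simp: states_def nb_def simp del: Z.simps)
  next
    case True
    show thesis
    proof (cases "\<exists>e. e |\<in>| preds s \<and> pt e = y")
      case True
      then show thesis using that Z_pred[OF s] by (metis UN_I UNIV_I nb_def states_def)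
    next
      case False
      then obtain d where d: "d |\<in>| preds s" "T (pt d) (pt s) y" using True by (auto simp: old_def)
      obtain m where m: "n = Suc m" "d \<in> Z m" using Z_pred[OF s d(1)] by metis
      have "\<not> old d y" using not_old_horizontal[OF s d] False by blast
      then obtain t where t: "t \<in> Z n" "d |\<in>| preds t" "pt t = y"
        using Z_new[OF m(2)] T_A(3)[OF d(2)] m by metis
      then have "hadj s t" using d by (auto simp: hadj_def)
      then show thesis using that t by (auto simp: states_def nb_def)
    qed
  qed
qed

text \<open>Both images are viewed from a common predecessor \<open>d\<close> of \<open>s\<close>
  and \<open>t'\<close>: the other predecessors of \<open>s\<close> are old for \<open>d\<close>,
  whereas \<open>t'\<close> is new for it.\<close>

lemma pred_hadj_neq:
  assumes "s \<in> Z n" "t' \<in> Z m" "t |\<in>| preds s" "hadj s t'"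
  shows "pt t \<noteq> pt t'"
proof -
  obtain d where d: "d |\<in>| preds s" "d |\<in>| preds t'" "T (pt d) (pt s) (pt t')"
    using assms by (auto simp: hadj_def)
  have "\<not> old d (pt t')" using Z_pred[OF assms(2) d(2)] by metis
  then show ?thesis using old_pred_sibling[OF assms(1) d(1) assms(3)] d(3) T_neq by metis
qed

text \<open>If the two triangles have different apices \<open>d\<close> and \<open>d'\<close>, then
  \<open>d\<close>, \<open>d'\<close> and the common image form a triangle in the link of
  \<open>pt s\<close>.\<close>

lemma hadj_unique:
  assumes "s \<in> Z n" "t \<in> Z m" "t' \<in> Z m'" "hadj s t" "hadj s t'" "pt t = pt t'"
  shows "t = t'"
proof -
  obtain d where d: "d |\<in>| preds s" "d |\<in>| preds t" "T (pt d) (pt s) (pt t)"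
    using assms by (auto simp: hadj_def)
  obtain d' where d': "d' |\<in>| preds s" "d' |\<in>| preds t'" "T (pt d') (pt s) (pt t')"
    using assms by (auto simp: hadj_def)
  show ?thesis
  proof (cases "d = d'")
    case True
    then show ?thesis using Z_pred_unique assms d d' by blast
  next
    case False
    have "T (pt d') (pt d) (pt s)" using Z_preds(2)[OF assms(1) d(1) d'(1) False] .
    then show ?thesis using no_link_3cycle[of "pt s" "pt d" "pt d'" "pt t"] d d' assms(6) T_perm
      by metis
  qed
qed

text \<open>Images of upper neighbours are not old for \<open>s\<close> and all other images are, so
  an upper neighbour need only be compared with another upper one.\<close>

lemma nb_unique:
  assumes "s \<in> states" "t \<in> states" "t' \<in> states" "nb s t" "nb s t'" "pt t = pt t'"
  shows "t = t'"
proof -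
  obtain n m m' where Z: "s \<in> Z n" "t \<in> Z m" "t' \<in> Z m'" using assms by (auto simp: states_def)
  have above: "\<not> old s (pt u)" if "u \<in> Z k" "s |\<in>| preds u" for u k
    using Z_pred[OF that] by metis
  have below: "old s (pt u)" if "u |\<in>| preds s \<or> hadj s u" for u
    using that by (auto simp: old_def hadj_def)
  consider "t |\<in>| preds s" "t' |\<in>| preds s" | "t |\<in>| preds s" "hadj s t'" | "hadj s t" "t' |\<in>| preds s"
    | "hadj s t" "hadj s t'" | "s |\<in>| preds t" "s |\<in>| preds t'"
    using assms(4-6) above[OF Z(2)] above[OF Z(3)] below unfolding nb_def by metis
  then show ?thesis
  proof cases
    case 1
    then show ?thesis using Z_preds(2)[OF Z(1)] assms(6) T_neq by metis
  next
    case 2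
    then show ?thesis using pred_hadj_neq Z assms(6) by blast
  next
    case 3
    then show ?thesis using pred_hadj_neq Z assms(6) by metis
  next
    case 4
    then show ?thesis using hadj_unique Z assms(6) by blast
  next
    case 5
    then show ?thesis using Z_pred_unique Z assms(6) by blast
  qed
qed

text \<open>Together with \<open>nb_exists\<close> and \<open>nb_unique\<close> this says that
  \<open>pt\<close> is a covering of 2-complexes. Two horizontal neighbours cannot span a triangle
  with \<open>s\<close>, since the apices below would close it to a cycle of length three or four in
  the link; a lower and an upper neighbour cannot either, since the upper one would be old.\<close>

lemma nb_triangle:
  assumes st: "s \<in> states" "t \<in> states" "t' \<in> states"
    and nb: "nb s t" "nb s t'" and T: "T (pt s) (pt t) (pt t')"
  shows "nb t t'"
proof -
  obtain n m m' where Z: "s \<in> Z n" "t \<in> Z m" "t' \<in> Z m'" using st by (auto simp: states_def)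
  have above: "\<not> old s (pt u)" if "u \<in> Z k" "s |\<in>| preds u" for u k
    using Z_pred[OF that] by metis
  have down_hor: "nb u u'"
    if u: "u \<in> states" "u' \<in> states" "u |\<in>| preds s" "hadj s u'" "T (pt s) (pt u) (pt u')" for u u'
  proof -
    obtain k where k: "u' \<in> Z k" using u by (auto simp: states_def)
    have T': "T (pt u) (pt s) (pt u')" using u(5) T_perm by blast
    have "\<not> old u (pt u')"
      using not_old_horizontal[OF Z(1) u(3) T'] pred_hadj_neq[OF Z(1) k _ u(4)] by blast
    moreover obtain j where "u \<in> Z j" using Z_pred[OF Z(1) u(3)] by metis
    ultimately obtain r where r: "r \<in> states" "u |\<in>| preds r" "pt r = pt u'"
      using Z_new T_A(3)[OF T'] by (metis UN_I UNIV_I states_def)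
    have "hadj s r" using r u T' by (auto simp: hadj_def)
    then have "r = u'" using nb_unique[OF st(1) r(1) u(2)] r(3) u(4) by (auto simp: nb_def)
    then show ?thesis using r by (auto simp: nb_def)
  qed
  have hor_up: "nb u u'"
    if u: "u \<in> states" "u' \<in> states" "hadj s u" "s |\<in>| preds u'" "T (pt s) (pt u) (pt u')" for u u'
  proof -
    obtain k j where k: "u' \<in> Z k" "u \<in> Z j" using u by (auto simp: states_def)
    obtain m where m: "k = Suc m" "s \<in> Z m" "fset (preds u') = newpreds m s (pt u')"
      using Z_pred[OF k(1) u(4)] by metis
    have "u \<in> Z m"
    proof -
      obtain d where "d |\<in>| preds s" "d |\<in>| preds u" using u(3) by (auto simp: hadj_def)
      then have d: "d |\<in>| preds s" "d |\<in>| preds u" by simp_all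
      obtain i where i: "j = Suc i" "d \<in> Z i" using Z_pred[OF k(2) d(2)] by metis
      obtain i' where i': "m = Suc i'" "d \<in> Z i'" using Z_pred[OF m(2) d(1)] by metis
      have "j = m" using i i' Z_level_unique[OF i(2) i'(2)] by simp
      then show ?thesis using k by simp
    qed
    then show ?thesis using m u(3) T_perm(2)[OF u(5)] by (simp add: nb_def newpreds_def)
  qed
  have down_up: False
    if u: "u \<in> Z j" "u' \<in> Z k" "u |\<in>| preds s" "s |\<in>| preds u'" "T (pt s) (pt u) (pt u')" for u u' j k
    using above[OF u(2,4)] u(3) T_perm(2)[OF u(5)] by (auto simp: old_def)
  have sym: "T (pt s) (pt t') (pt t)" using T T_perm by blast
  consider "t |\<in>| preds s" "t' |\<in>| preds s" | "t |\<in>| preds s" "hadj s t'" | "t |\<in>| preds s" "s |\<in>| preds t'"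
    | "hadj s t" "t' |\<in>| preds s" | "hadj s t" "hadj s t'" | "hadj s t" "s |\<in>| preds t'"
    | "s |\<in>| preds t" "t' |\<in>| preds s" | "s |\<in>| preds t" "hadj s t'" | "s |\<in>| preds t" "s |\<in>| preds t'"
    using nb unfolding nb_def by blast
  then show ?thesis
  proof cases
    case 1
    then show ?thesis using Z_preds(1)[OF Z(1)] T_neq[OF T] by (metis nb_def)
  next
    case 5
    obtain d where d: "d |\<in>| preds s" "d |\<in>| preds t" "T (pt d) (pt s) (pt t)"
      using 5 by (auto simp: hadj_def)
    obtain d' where d': "d' |\<in>| preds s" "d' |\<in>| preds t'" "T (pt d') (pt s) (pt t')"
      using 5 by (auto simp: hadj_def)
    have False
    proof (cases "d = d'")
      case True
      then show False
        using no_link_3cycle[of "pt s" "pt t" "pt d" "pt t'"] d d' T T_perm by blast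
    next
      case False
      have dd': "T (pt d') (pt d) (pt s)" using Z_preds(2)[OF Z(1) d(1) d'(1) False] .
      have "pt d' \<noteq> pt t" using pred_hadj_neq[OF Z(1,2) d'(1)] 5 by simp
      moreover have "pt d \<noteq> pt t'" using pred_hadj_neq[OF Z(1,3) d(1)] 5 by simp
      ultimately show False
        using no_link_4cycle[OF T_perm(3)[OF d(3)] T_perm(5)[OF dd'] T_perm(2)[OF d'(3)]
            T_perm(1)[OF T]] by simp
    qed
    then show ?thesis ..
  next
    case 2
    then show ?thesis using down_hor[OF st(2,3)] T by simp
  next
    case 3
    then show ?thesis using down_up[OF Z(2,3)] T by simp
  next
    case 4
    then show ?thesis using down_hor[OF st(3,2)] sym nb_sym by simp
  next
    case 6
    then show ?thesis using hor_up[OF st(2,3)] T by simp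
  next
    case 7
    then show ?thesis using down_up[OF Z(3,2)] sym by simp
  next
    case 8
    then show ?thesis using hor_up[OF st(3,2)] sym nb_sym by simp
  next
    case 9
    then show ?thesis using T by (auto simp: nb_def hadj_def)
  qed
qed

end

section \<open>Monodromy\<close>

lemma continuous_on_coordinate: "continuous_on S (\<lambda>x::'v \<Rightarrow> real. x v)"
  by (rule continuous_on_subset[OF continuous_on_product_coordinates subset_UNIV])

lemma closed_closed_simplex: "closed (closed_simplex \<sigma>)"
proof -
  have "closed_simplex \<sigma> = (\<Inter>v. {x. 0 \<le> x v}) \<inter> (\<Inter>v\<in>-\<sigma>. {x. x v = 0}) \<inter> {x. (\<Sum>v\<in>\<sigma>. x v) = 1}"
    by (auto simp: closed_simplex_def)
  then show ?thesis
    by (auto intro!: closed_Int closed_INT closed_Collect_le closed_Collect_eq continuous_on_sum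
        continuous_on_const continuous_on_coordinate)
qed

text \<open>What has to be removed from a finite subcomplex is a finite union of closed sets, so
  there the weak topology induces the Euclidean one.\<close>

lemma openin_realization_finite_subcomplex:
  assumes U: "openin (realization Y) U" and K: "finite K" "K \<subseteq> Y"
  shows "openin (top_of_set (realization_points K)) (U \<inter> realization_points K)"
proof -
  have "closed (closed_simplex \<sigma> - U)" if "\<sigma> \<in> K" for \<sigma>
  proof -
    have "openin (top_of_set (closed_simplex \<sigma>)) (U \<inter> closed_simplex \<sigma>)"
      using U K that by (auto simp: openin_realization)
    then have "closedin (top_of_set (closed_simplex \<sigma>)) (closed_simplex \<sigma> - U \<inter> closed_simplex \<sigma>)"
      using openin_closedin_eq by (simp add: closedin_def openin_subset Diff_Diff_Int Int_absorb1)
    moreover have "closed_simplex \<sigma> - U \<inter> closed_simplex \<sigma> = closed_simplex \<sigma> - U" by blast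
    ultimately show ?thesis using closedin_closed_trans closed_closed_simplex by metis
  qed
  then have "closed (\<Union>\<sigma>\<in>K. closed_simplex \<sigma> - U)"
    using K by (intro closed_UN) auto
  then have "open (- (\<Union>\<sigma>\<in>K. closed_simplex \<sigma> - U))" by (rule open_Compl)
  then have "openin (top_of_set (realization_points K))
      (realization_points K \<inter> - (\<Union>\<sigma>\<in>K. closed_simplex \<sigma> - U))"
    by (rule openin_open_Int)
  moreover have "realization_points K \<inter> - (\<Union>\<sigma>\<in>K. closed_simplex \<sigma> - U) = U \<inter> realization_points K"
    by (auto simp: realization_points_def)
  ultimately show ?thesis by simp
qed

text \<open>This reduces simple connectedness of a finite complex to the predicate on subsets of a
  function space.\<close>

lemma realization_finite:
  assumes "finite K"
  shows "realization K = top_of_set (realization_points K)"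
proof -
  have "openin (realization K) U \<longleftrightarrow> openin (top_of_set (realization_points K)) U" for U
  proof
    assume U: "openin (realization K) U"
    then have "U \<subseteq> realization_points K" by (simp add: openin_realization)
    then show "openin (top_of_set (realization_points K)) U"
      using openin_realization_finite_subcomplex[OF U assms] by (simp add: Int_absorb2)
  next
    assume U: "openin (top_of_set (realization_points K)) U"
    then obtain V where V: "open V" "U = realization_points K \<inter> V" by (auto simp: openin_open)
    have "openin (top_of_set (closed_simplex \<sigma>)) (U \<inter> closed_simplex \<sigma>)" if "\<sigma> \<in> K" for \<sigma>
    proof -
      have "U \<inter> closed_simplex \<sigma> = closed_simplex \<sigma> \<inter> V"
        using V that by (auto simp: realization_points_def)
      then show ?thesis using V by (simp add: openin_open_Int)
    qed
    then show "openin (realization K) U" using V by (auto simp: openin_realization)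
  qed
  then show ?thesis by (simp add: topology_eq)
qed

lemma topspace_realization: "topspace (realization K) = realization_points K"
proof
  show "topspace (realization K) \<subseteq> realization_points K"
    using openin_realization openin_topspace by blast
  have "realization_points K \<inter> closed_simplex \<sigma> = closed_simplex \<sigma>" if "\<sigma> \<in> K" for \<sigma>
    using that by (auto simp: realization_points_def)
  then have "openin (realization K) (realization_points K)"
    by (simp add: openin_realization)
  then show "realization_points K \<subseteq> topspace (realization K)" by (rule openin_subset)
qed

lemma continuous_map_into_realization:
  assumes f: "continuous_map X (top_of_set (realization_points K)) f" and K: "finite K" "K \<subseteq> Y"
  shows "continuous_map X (realization Y) f"
proof -
  have sub: "f x \<in> realization_points K" if "x \<in> topspace X" for x
    using f that by (auto simp: continuous_map_def Pi_iff)
  have "openin X {x \<in> topspace X. f x \<in> U}" if "openin (realization Y) U" for U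
  proof -
    have "openin X {x \<in> topspace X. f x \<in> U \<inter> realization_points K}"
      using f openin_realization_finite_subcomplex[OF that K] by (auto simp: continuous_map_def)
    moreover have "{x \<in> topspace X. f x \<in> U \<inter> realization_points K} = {x \<in> topspace X. f x \<in> U}"
      using sub by blast
    ultimately show ?thesis by simp
  qed
  moreover have "f x \<in> topspace (realization Y)" if "x \<in> topspace X" for x
    using sub[OF that] K by (auto simp: topspace_realization realization_points_def)
  ultimately show ?thesis by (auto simp: continuous_map_def)
qed

text \<open>The set is the open star of the vertex \<open>v\<close>; open stars are the cover used
  for simplicial approximation.\<close>

lemma openin_star: "openin (realization Y) {x \<in> realization_points Y. 0 < x v}"
proof -
  have "openin (top_of_set (closed_simplex \<sigma>)) ({x \<in> realization_points Y. 0 < x v} \<inter> closed_simplex \<sigma>)"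
    if "\<sigma> \<in> Y" for \<sigma>
  proof -
    have "{x \<in> realization_points Y. 0 < x v} \<inter> closed_simplex \<sigma> = closed_simplex \<sigma> \<inter> {x. 0 < x v}"
      using that by (auto simp: realization_points_def)
    moreover have "open {x::'a \<Rightarrow> real. 0 < x v}"
      by (intro open_Collect_less continuous_on_const continuous_on_coordinate)
    ultimately show ?thesis by (simp add: openin_open_Int)
  qed
  then show ?thesis by (auto simp: openin_realization)
qed

lemma realization_point_positive:
  assumes "x \<in> realization_points Y"
  obtains v where "0 < x v"
proof -
  obtain \<sigma> where x: "\<forall>v. 0 \<le> x v" "sum x \<sigma> = 1"
    using assms by (auto simp: realization_points_def closed_simplex_def)
  then have "\<exists>v\<in>\<sigma>. x v \<noteq> 0" by (metis sum.neutral zero_neq_one)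
  with x that show thesis by (metis order_le_less)
qed

lemma realization_point_support:
  assumes "x \<in> realization_points Y"
  obtains \<sigma> where "\<sigma> \<in> Y" "\<And>v. 0 < x v \<Longrightarrow> v \<in> \<sigma>"
proof -
  obtain \<sigma> where "\<sigma> \<in> Y" "\<forall>v. v \<notin> \<sigma> \<longrightarrow> x v = 0"
    using assms by (auto simp: realization_points_def closed_simplex_def)
  then show thesis using that by (metis less_irrefl)
qed

text \<open>Simplicial approximation by labelling each cell with a vertex whose open star contains its image.
  The number of cells is a multiple of \<open>M\<close>, so that the grid refines a given subdivision of the
  sides.\<close>

lemma grid_labels:
  fixes h :: "real \<times> real \<Rightarrow> 'v \<Rightarrow> real"
  assumes h: "continuous_map (top_of_set ({0..1} \<times> {0..1})) (realization Y) h" and M: "0 < M"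
  obtains m a where "0 < (m::nat)"
    "\<And>i j s t. i < M * m \<Longrightarrow> j < M * m \<Longrightarrow> real i \<le> real (M * m) * s \<Longrightarrow> real (M * m) * s \<le> real (Suc i) \<Longrightarrow>
       real j \<le> real (M * m) * t \<Longrightarrow> real (M * m) * t \<le> real (Suc j) \<Longrightarrow> 0 < h (s, t) (a i j :: 'v)"
proof -
  let ?S = "{0..1::real} \<times> {0..1::real}"
  define G where "G = {U. open U \<and> (\<exists>v. \<forall>p\<in>U \<inter> ?S. 0 < h p v)}"
  have sub: "?S \<subseteq> \<Union>G"
  proof
    fix p assume p: "p \<in> ?S"
    then have "h p \<in> realization_points Y"
      using h by (auto simp: continuous_map_def topspace_realization)
    then obtain v where v: "0 < h p v" by (rule realization_point_positive)
    have "openin (top_of_set ?S) {q \<in> ?S. h q \<in> {x \<in> realization_points Y. 0 < x v}}"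
      using openin_continuous_map_preimage[OF h openin_star[of Y v]] by simp
    then obtain U where U: "open U" "{q \<in> ?S. h q \<in> {x \<in> realization_points Y. 0 < x v}} = ?S \<inter> U"
      unfolding openin_open by blast
    have "p \<in> {q \<in> ?S. h q \<in> {x \<in> realization_points Y. 0 < x v}}"
      using p v \<open>h p \<in> realization_points Y\<close> by blast
    then have "p \<in> U" using U by blast
    moreover have "U \<in> G" using U unfolding G_def by blast
    ultimately show "p \<in> \<Union>G" by blast
  qed
  have cpt: "compact ?S" by (intro compact_Times compact_Icc)
  have opn: "open U" if "U \<in> G" for U using that by (simp add: G_def)
  obtain e where e: "e > 0" "\<And>p. p \<in> ?S \<Longrightarrow> \<exists>U\<in>G. ball p e \<subseteq> U"
    by (rule Heine_Borel_lemma[OF cpt sub opn], assumption, rule that)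
  \<comment> \<open>All points of a cell of side \<open>1 / N\<close> are within
    \<open>2 / N\<close> of its lower left corner, so for \<open>N\<close> at least \<open>m\<close>
    each cell lies in a ball of the Lebesgue radius \<open>e\<close>.\<close>
  obtain m where m: "m > 0" "2 / real m < e"
  proof -
    obtain m :: nat where m: "2 / e < real m" using reals_Archimedean2 by blast
    then have "0 < real m" using e by (smt (verit) divide_pos_pos)
    then show thesis using that[of m] m e by (simp add: field_simps)
  qed
  define N where "N = M * m"
  have N: "0 < N" "2 / real N < e"
  proof -
    show "0 < N" using M m by (simp add: N_def)
    have "m \<le> N" using M by (simp add: N_def)
    then have "real m \<le> real N" by simp
    then have "2 / real N \<le> 2 / real m" using m by (intro divide_left_mono) auto
    then show "2 / real N < e" using m by simp
  qed
  have "\<exists>v. \<forall>s t. real i \<le> real N * s \<and> real N * s \<le> real (Suc i) \<and>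
      real j \<le> real N * t \<and> real N * t \<le> real (Suc j) \<longrightarrow> 0 < h (s, t) v" if ij: "i < N" "j < N" for i j
  proof -
    let ?p = "(real i / real N, real j / real N)"
    have "?p \<in> ?S" using ij N by auto
    then obtain U where U: "U \<in> G" "ball ?p e \<subseteq> U" using e(2) by blast
    then obtain v where v: "\<forall>p\<in>U \<inter> ?S. 0 < h p v" unfolding G_def by blast
    have "0 < h (s, t) v" if st: "real i \<le> real N * s" "real N * s \<le> real (Suc i)"
      "real j \<le> real N * t" "real N * t \<le> real (Suc j)" for s t
    proof -
      have n: "0 < real N" using N by simp
      have s: "real i / real N \<le> s" "s \<le> real i / real N + 1 / real N"
        using st n by (simp_all add: field_simps)
      have t: "real j / real N \<le> t" "t \<le> real j / real N + 1 / real N"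
        using st n by (simp_all add: field_simps)
      have "real i / real N + 1 / real N \<le> 1" "real j / real N + 1 / real N \<le> 1"
        using ij n by (simp_all add: field_simps)
      then have "s \<le> 1" "t \<le> 1" using s t by linarith+
      moreover have "0 \<le> s" "0 \<le> t"
        using s t by (meson divide_nonneg_nonneg of_nat_0_le_iff order_trans)+
      ultimately have S: "(s, t) \<in> ?S" by simp
      have "dist ?p (s, t) = sqrt ((real i / real N - s)\<^sup>2 + (real j / real N - t)\<^sup>2)"
        by (simp add: dist_Pair_Pair dist_real_def)
      also have "\<dots> \<le> \<bar>real i / real N - s\<bar> + \<bar>real j / real N - t\<bar>"
        by (rule sqrt_sum_squares_le_sum_abs)
      also have "\<dots> \<le> 1 / real N + 1 / real N" using s t by linarith
      also have "\<dots> = 2 / real N" by simp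
      also have "\<dots> < e" by (rule N)
      finally have "(s, t) \<in> ball ?p e" by simp
      then show ?thesis using U v S by blast
    qed
    then show ?thesis by blast
  qed
  then obtain a where "\<And>i j s t. i < N \<Longrightarrow> j < N \<Longrightarrow> real i \<le> real N * s \<Longrightarrow> real N * s \<le> real (Suc i) \<Longrightarrow>
      real j \<le> real N * t \<Longrightarrow> real N * t \<le> real (Suc j) \<Longrightarrow> 0 < h (s, t) (a i j)"
    by metis
  then show thesis using that[of m a] m unfolding N_def by blast
qed

section \<open>Homotopies of loops and polygonal paths\<close>

lemma loops_homotopyE:
  assumes sc: "simply_connected_space X" and p: "pathin X p" "p 1 = p 0" and q: "pathin X q" "q 1 = q 0"
  obtains h where "continuous_map (top_of_set ({0..1} \<times> {0..1})) X h"
    "\<And>t. h (0, t) = p t" "\<And>t. h (1, t) = q t" "\<And>s. s \<in> {0..1::real} \<Longrightarrow> h (s, 1::real) = h (s, 0)"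
proof -
  have "homotopic_with (\<lambda>r. r 1 = r 0) (top_of_set {0..1}) X p q"
    using sc p q unfolding simply_connected_space_def by blast
  then obtain h where
    "continuous_map (prod_topology (top_of_set {0..1::real}) (top_of_set {0..1::real})) X h"
    "\<And>t. h (0, t) = p t" "\<And>t. h (1, t) = q t" "\<And>s. s \<in> {0..1::real} \<Longrightarrow> h (s, 1::real) = h (s, 0)"
    unfolding homotopic_with_def by auto
  then show thesis using that by (simp add: prod_topology_subtopology_eu)
qed

text \<open>The barycentric coordinates are hat functions centred at \<open>k / L\<close>, summed
  over \<open>k\<close> so that a vertex visited several times collects all of its weights.\<close>

definition polygon :: "nat \<Rightarrow> (nat \<Rightarrow> 'v) \<Rightarrow> real \<Rightarrow> 'v \<Rightarrow> real" where
  "polygon L p t v = (\<Sum>k\<le>L. max 0 (1 - \<bar>real L * t - real k\<bar>) * (if v = p k then 1 else 0))"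

lemma polygon_on_edge:
  assumes k: "k < L" and t: "real k \<le> real L * t" "real L * t \<le> real (Suc k)"
  shows "polygon L p t v = (1 - (real L * t - real k)) * (if v = p k then 1 else 0)
    + (real L * t - real k) * (if v = p (Suc k) then 1 else 0)"
proof -
  let ?f = "\<lambda>k. max 0 (1 - \<bar>real L * t - real k\<bar>) * (if v = p k then 1 else 0)"
  have "polygon L p t v = sum ?f {k, Suc k}"
    unfolding polygon_def
  proof (rule sum.mono_neutral_right)
    show "\<forall>i\<in>{..L} - {k, Suc k}. ?f i = 0"
    proof
      fix i assume "i \<in> {..L} - {k, Suc k}"
      then have "i \<noteq> k" "i \<noteq> Suc k" by auto
      then have "Suc i \<le> k \<or> Suc (Suc k) \<le> i" by linarith
      then have "real i + 1 \<le> real k \<or> real k + 2 \<le> real i" by linarith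
      then show "?f i = 0" using t by auto
    qed
  qed (use k in auto)
  then show ?thesis using t by (simp add: max_def)
qed

lemma polygon_edge_simplex:
  assumes "k < L" "real k \<le> real L * t" "real L * t \<le> real (Suc k)" "p k \<noteq> p (Suc k)"
  shows "polygon L p t \<in> closed_simplex {p k, p (Suc k)}"
  using assms by (auto simp: closed_simplex_def polygon_on_edge[OF assms(1-3)])

lemma polygon_vertex:
  assumes "k \<le> L" "0 < L" "real L * t = real k"
  shows "polygon L p t v = (if v = p k then 1 else 0)"
proof (cases "k < L")
  case True
  then show ?thesis using polygon_on_edge[of k L t p v] assms by simp
next
  case False
  then have "k = Suc (L - 1)" "L - 1 < L" using assms by auto
  then show ?thesis using polygon_on_edge[of "L - 1" L t p v] assms(3) by (simp add: of_nat_diff)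
qed

lemma unit_interval_cell:
  assumes "0 < (n::nat)" "0 \<le> t" "t \<le> (1::real)"
  obtains k where "k < n" "real k \<le> real n * t" "real n * t \<le> real (Suc k)"
proof (cases "t = 1")
  case True
  then show thesis using that[of "n - 1"] assms by simp
next
  case False
  then have t: "real n * t < real n" using assms by simp
  have nn: "0 \<le> real n * t" using assms by simp
  define k where "k = nat \<lfloor>real n * t\<rfloor>"
  have "real k \<le> real n * t" "real n * t < real k + 1" using nn by (simp_all add: k_def)
  with t show thesis using that[of k] by simp
qed

text \<open>The path runs in a finite subcomplex, where continuity can be checked coordinate by
  coordinate.\<close>

lemma pathin_polygon:
  assumes L: "0 < L" and e: "\<And>k. k < L \<Longrightarrow> p k \<noteq> p (Suc k) \<and> {p k, p (Suc k)} \<in> Y"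
  shows "pathin (realization Y) (polygon L p)"
proof -
  define K where "K = (\<lambda>k. {p k, p (Suc k)}) ` {..<L}"
  have K: "finite K" "K \<subseteq> Y" using e by (auto simp: K_def)
  have "continuous_on {0..1} (polygon L p)"
  proof (rule continuous_on_coordinatewise_then_product)
    show "continuous_on {0..1} (\<lambda>t. polygon L p t v)" for v
      unfolding polygon_def by (intro continuous_intros)
  qed
  moreover have "polygon L p t \<in> realization_points K" if t: "t \<in> {0..1}" for t
  proof -
    obtain k where k: "k < L" "real k \<le> real L * t" "real L * t \<le> real (Suc k)"
      using unit_interval_cell[OF L, of t] t by auto
    have "polygon L p t \<in> closed_simplex {p k, p (Suc k)}"
      using polygon_edge_simplex[OF k] e[OF k(1)] by blast
    then show ?thesis using k by (auto simp: realization_points_def K_def)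
  qed
  ultimately have "continuous_map (top_of_set {0..1}) (top_of_set (realization_points K)) (polygon L p)"
    by auto
  then show ?thesis unfolding pathin_def using K by (rule continuous_map_into_realization)
qed

section \<open>Edge paths in \<open>Y\<close> and their lifts\<close>

context systolic
begin

lemma simply_connected_Y: "simply_connected_space (realization Y)"
  using systolic by (simp add: systolic_2complex_def)

lemma vertex_simplex:
  assumes "x \<in> \<Union>Y"
  shows "{x} \<in> Y"
  using assms face[of _ "{x}"] by blast

definition vertex_point :: "'v \<Rightarrow> 'v \<Rightarrow> real" where
  "vertex_point x v = (if v = x then 1 else 0)"

lemma pathin_vertex_point:
  assumes "x \<in> \<Union>Y"
  shows "pathin (realization Y) (\<lambda>t. vertex_point x)"
proof -
  have "vertex_point x \<in> closed_simplex {x}" by (simp add: vertex_point_def closed_simplex_def)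
  then have "vertex_point x \<in> topspace (realization Y)"
    using vertex_simplex[OF assms] by (auto simp: topspace_realization realization_points_def)
  then show ?thesis by (simp add: pathin_const)
qed

lemma cells_simplex:
  assumes "continuous_map (top_of_set ({0..1} \<times> {0..1})) (realization Y) h"
    and "0 \<le> s" "s \<le> 1" "0 \<le> t" "t \<le> 1"
  obtains \<sigma> where "\<sigma> \<in> Y" "\<And>v. 0 < h (s, t) v \<Longrightarrow> v \<in> \<sigma>"
proof -
  have "h (s, t) \<in> realization_points Y"
    using assms by (auto simp: continuous_map_def topspace_realization)
  then show thesis using realization_point_support that by metis
qed

text \<open>Connectedness is hidden in the homotopy between two constant loops. The labels along one
  side of the grid form an edge path, because adjacent cells share a point and the vertices with
  positive weight there lie in one simplex.\<close>

lemma connected_A: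
  assumes "x \<in> \<Union>Y" "y \<in> \<Union>Y"
  shows "A\<^sup>*\<^sup>* x y"
proof -
  obtain h where h: "continuous_map (top_of_set ({0..1} \<times> {0..1})) (realization Y) h"
    and h0: "\<And>t. h (0, t) = vertex_point x" and h1: "\<And>t. h (1, t) = vertex_point y"
    and "\<And>s. s \<in> {0..1::real} \<Longrightarrow> h (s, 1::real) = h (s, 0)"
    by (rule loops_homotopyE[OF simply_connected_Y pathin_vertex_point[OF assms(1)] refl
        pathin_vertex_point[OF assms(2)] refl], rule that)
  obtain m a where m: "0 < (m::nat)" and a: "\<And>i j s t. i < 1 * m \<Longrightarrow> j < 1 * m \<Longrightarrow> real i \<le> real (1 * m) * s \<Longrightarrow>
       real (1 * m) * s \<le> real (Suc i) \<Longrightarrow>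
       real j \<le> real (1 * m) * t \<Longrightarrow> real (1 * m) * t \<le> real (Suc j) \<Longrightarrow> 0 < h (s, t) (a i j)"
    using grid_labels[OF h, of 1] by auto
  have ax: "a 0 0 = x"
  proof -
    have "0 < h (0, 0) (a 0 0)" using a[of 0 0 0 0] m by simp
    then show ?thesis by (simp add: h0 vertex_point_def split: if_splits)
  qed
  have ay: "a (m - 1) 0 = y"
  proof -
    have "0 < h (1, 0) (a (m - 1) 0)" using a[of "m - 1" 0 1 0] m by simp
    then show ?thesis by (simp add: h1 vertex_point_def split: if_splits)
  qed
  have "A\<^sup>*\<^sup>* x (a i 0)" if "i < m" for i
    using that
  proof (induction i)
    case 0
    then show ?case using ax by simp
  next
    case (Suc i)
    let ?s = "real (Suc i) / real m"
    have s: "0 \<le> ?s" "?s \<le> 1" "real m * ?s = real (Suc i)" using Suc.prems by simp_all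
    obtain \<sigma> where \<sigma>: "\<sigma> \<in> Y" "\<And>v. 0 < h (?s, 0) v \<Longrightarrow> v \<in> \<sigma>"
      using cells_simplex[OF h s(1,2), of 0] by auto
    have "a i 0 \<in> \<sigma>" "a (Suc i) 0 \<in> \<sigma>"
      using Suc.prems s(3) by (auto intro!: \<sigma>(2) a)
    then have "a i 0 = a (Suc i) 0 \<or> A (a i 0) (a (Suc i) 0)"
      using face[OF \<sigma>(1), of "{a i 0, a (Suc i) 0}"] by (auto simp: A_def)
    moreover have "A\<^sup>*\<^sup>* x (a i 0)" using Suc by simp
    ultimately show ?case by (metis rtranclp.rtrancl_into_rtrancl)
  qed
  from this[of "m - 1"] show ?thesis using m ay by simp
qed

text \<open>Transport of a state to a vertex in a common simplex. The stationary case is included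
  because adjacent grid cells may carry the same label.\<close>

definition tr :: "'v state \<Rightarrow> 'v \<Rightarrow> 'v state" where
  "tr s y = (if pt s = y then s else THE t. t \<in> states \<and> nb s t \<and> pt t = y)"

lemma tr_self [simp]: "tr s (pt s) = s"
  by (simp add: tr_def)

lemma tr_nb:
  assumes "s \<in> states" "t \<in> states" "nb s t"
  shows "tr s (pt t) = t"
proof -
  have "pt s \<noteq> pt t" using nb_A[OF assms] by (simp add: A_def)
  then show ?thesis
    unfolding tr_def using nb_unique[OF assms(1)] assms by (auto intro!: the_equality)
qed

lemma tr_cases:
  assumes "s \<in> states" "pt s \<in> \<sigma>" "y \<in> \<sigma>" "\<sigma> \<in> Y"
  shows "tr s y \<in> states" "pt (tr s y) = y" "tr s y = s \<and> y = pt s \<or> nb s (tr s y)"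
proof -
  have "tr s y \<in> states \<and> pt (tr s y) = y \<and> (tr s y = s \<and> y = pt s \<or> nb s (tr s y))"
  proof (cases "pt s = y")
    case True
    then show ?thesis using assms by (auto simp: tr_def)
  next
    case False
    then have "A (pt s) y"
      using face[OF assms(4), of "{pt s, y}"] assms by (auto simp: A_def)
    then obtain t where "t \<in> states" "nb s t" "pt t = y" using nb_exists assms(1) by metis
    then show ?thesis using tr_nb[OF assms(1)] by metis
  qed
  then show "tr s y \<in> states" "pt (tr s y) = y" "tr s y = s \<and> y = pt s \<or> nb s (tr s y)" by auto
qed

text \<open>Transport within one simplex is independent of the path. The essential case is that of a
  triangle, which lifts by \<open>nb_triangle\<close>.\<close>

lemma tr_tr:
  assumes s: "s \<in> states" and \<sigma>: "pt s \<in> \<sigma>" "y \<in> \<sigma>" "w \<in> \<sigma>" "\<sigma> \<in> Y"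
  shows "tr (tr s y) w = tr s w"
proof -
  note ty = tr_cases[OF s \<sigma>(1,2,4)] and tw = tr_cases[OF s \<sigma>(1,3,4)]
  consider "y = pt s" | "w = y" | "w = pt s" "y \<noteq> pt s" | "y \<noteq> pt s" "w \<noteq> y" "w \<noteq> pt s" by blast
  then show ?thesis
  proof cases
    case 1
    then show ?thesis by simp
  next
    case 2
    then show ?thesis using ty(2) tr_self by metis
  next
    case 3
    then have "nb s (tr s y)" using ty by blast
    then have "tr (tr s y) (pt s) = s" using tr_nb[OF ty(1) s nb_sym] by blast
    then show ?thesis using 3 by simp
  next
    case 4
    then have nb: "nb s (tr s y)" "nb s (tr s w)" using ty(3) tw(3) by blast+
    have "{pt s, y, w} \<in> Y" using face[OF \<sigma>(4), of "{pt s, y, w}"] \<sigma> by blast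
    then have "T (pt s) (pt (tr s y)) (pt (tr s w))" using 4 ty tw by (auto simp: T_def)
    then have "nb (tr s y) (tr s w)" using nb_triangle[OF s ty(1) tw(1) nb] by blast
    then have "tr (tr s y) (pt (tr s w)) = tr s w" using tr_nb[OF ty(1) tw(1)] by blast
    then show ?thesis using tw by simp
  qed
qed

primrec lift :: "(nat \<Rightarrow> 'v) \<Rightarrow> 'v state \<Rightarrow> nat \<Rightarrow> 'v state" where
  "lift c s 0 = s"
| "lift c s (Suc j) = tr (lift c s j) (c (Suc j))"

lemma lift_state:
  assumes "s \<in> states" "pt s = c 0" "\<And>j. j < n \<Longrightarrow> \<exists>\<sigma>\<in>Y. {c j, c (Suc j)} \<subseteq> \<sigma>" "j \<le> n"
  shows "lift c s j \<in> states \<and> pt (lift c s j) = c j"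
  using assms(4)
proof (induction j)
  case 0
  then show ?case using assms by simp
next
  case (Suc j)
  then obtain \<sigma> where "\<sigma> \<in> Y" "c j \<in> \<sigma>" "c (Suc j) \<in> \<sigma>" using assms(3)[of j] by auto
  then show ?case using Suc tr_cases(1,2)[of "lift c s j" \<sigma> "c (Suc j)"] by simp
qed

text \<open>The four labels around an inner grid point lie in one simplex, so by
  \<open>tr_tr\<close> the two lifts stay corresponding from column to column.\<close>

lemma lift_parallel:
  assumes s: "s \<in> states" "pt s = c 0"
    and sq: "\<And>j. j < n \<Longrightarrow> \<exists>\<sigma>\<in>Y. {c j, c (Suc j), c' j, c' (Suc j)} \<subseteq> \<sigma>" and "j \<le> n"
  shows "lift c' (tr s (c' 0)) j = tr (lift c s j) (c' j)"
  using assms(4)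
proof (induction j)
  case 0
  then show ?case by simp
next
  case (Suc j)
  have e: "\<exists>\<sigma>\<in>Y. {c j, c (Suc j)} \<subseteq> \<sigma>" if "j < n" for j using sq[OF that] by auto
  have l: "lift c s j \<in> states" "pt (lift c s j) = c j"
    using lift_state[OF s e, where n = n and j = j] Suc.prems by auto
  obtain \<sigma> where \<sigma>: "\<sigma> \<in> Y" "c j \<in> \<sigma>" "c (Suc j) \<in> \<sigma>" "c' j \<in> \<sigma>" "c' (Suc j) \<in> \<sigma>"
    using sq[of j] Suc.prems by auto
  have "lift c' (tr s (c' 0)) (Suc j) = tr (tr (lift c s j) (c' j)) (c' (Suc j))"
    using Suc by simp
  also have "\<dots> = tr (lift c s j) (c' (Suc j))" using tr_tr[OF l(1)] l(2) \<sigma> by metis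
  also have "\<dots> = tr (tr (lift c s j) (c (Suc j))) (c' (Suc j))" using tr_tr[OF l(1)] l(2) \<sigma> by metis
  finally show ?case by simp
qed

text \<open>The lift covers the steps from column \<open>0\<close> to column \<open>n\<close>; the
  additional \<open>tr\<close> is the step across the seam. Since corresponding lifts determine each
  other, closing up passes from the row \<open>c'\<close> to the row \<open>c\<close>.\<close>

lemma lift_closed_parallel:
  assumes s: "s \<in> states" "pt s = c 0"
    and sq: "\<And>j. j < n \<Longrightarrow> \<exists>\<sigma>\<in>Y. {c j, c (Suc j), c' j, c' (Suc j)} \<subseteq> \<sigma>"
    and wrap: "\<exists>\<sigma>\<in>Y. {c n, c 0, c' n, c' 0} \<subseteq> \<sigma>"
    and closed: "\<And>u. u \<in> states \<Longrightarrow> pt u = c' 0 \<Longrightarrow> tr (lift c' u n) (c' 0) = u"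
  shows "tr (lift c s n) (c 0) = s"
proof -
  obtain \<sigma> where \<sigma>: "\<sigma> \<in> Y" "c n \<in> \<sigma>" "c 0 \<in> \<sigma>" "c' n \<in> \<sigma>" "c' 0 \<in> \<sigma>" using wrap by auto
  have e: "\<exists>\<sigma>\<in>Y. {c j, c (Suc j)} \<subseteq> \<sigma>" if "j < n" for j using sq[OF that] by auto
  have l: "lift c s n \<in> states" "pt (lift c s n) = c n"
    using lift_state[OF s e, where n = n and j = n] by auto
  have l\<sigma>: "pt (lift c s n) \<in> \<sigma>" and s\<sigma>: "pt s \<in> \<sigma>" using l s \<sigma> by simp_all
  define u where "u = tr (lift c s n) (c 0)"
  have u: "u \<in> states" "pt u = c 0" unfolding u_def using tr_cases[OF l(1) l\<sigma> \<sigma>(3,1)] by auto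
  have s': "tr s (c' 0) \<in> states" "pt (tr s (c' 0)) = c' 0"
    using tr_cases[OF s(1) s\<sigma> \<sigma>(5,1)] by auto
  have "tr s (c' 0) = tr (lift c' (tr s (c' 0)) n) (c' 0)" using closed[OF s'] by simp
  also have "\<dots> = tr (tr (lift c s n) (c' n)) (c' 0)"
    using lift_parallel[OF s sq, of n n] by simp
  also have "\<dots> = tr (lift c s n) (c' 0)" using tr_tr[OF l(1) l\<sigma> \<sigma>(4,5,1)] .
  also have "\<dots> = tr u (c' 0)" unfolding u_def using tr_tr[OF l(1) l\<sigma> \<sigma>(3,5,1)] by simp
  finally have "tr (tr s (c' 0)) (c 0) = tr (tr u (c' 0)) (c 0)" by simp
  moreover have "tr (tr s (c' 0)) (c 0) = s"
    using tr_tr[OF s(1) s\<sigma> \<sigma>(5,3,1)] s(2) tr_self by metis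
  moreover have "tr (tr u (c' 0)) (c 0) = u"
    using tr_tr[OF u(1) _ \<sigma>(5,3,1)] u(2) \<sigma>(3) tr_self by metis
  ultimately show ?thesis unfolding u_def by simp
qed

text \<open>A homotopy from the image of the path to a constant loop is cut into a labelled grid.
  Lifts close up along the last row, which is constant, hence along every row, and along the first
  row the lift follows the given path.\<close>

lemma monodromy:
  assumes L: "0 < L" and z: "\<And>k. k \<le> L \<Longrightarrow> z k \<in> states"
    and nb: "\<And>k. k < L \<Longrightarrow> nb (z k) (z (Suc k))" and closed: "pt (z 0) = pt (z L)"
  shows "z 0 = z L"
proof -
  define p where "p k = pt (z k)" for k
  have A: "A (p k) (p (Suc k))" if "k < L" for k
    using nb_A[OF z z nb, of k] that by (simp add: p_def)
  then have e: "p k \<noteq> p (Suc k) \<and> {p k, p (Suc k)} \<in> Y" if "k < L" for k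
    using that by (simp add: A_def)
  have \<gamma>: "pathin (realization Y) (polygon L p)" using pathin_polygon[OF L, of p Y] e by blast
  have pl0: "polygon L p 0 = vertex_point (p 0)"
    by (rule ext) (use polygon_vertex[of 0 L 0 p] L in \<open>simp add: vertex_point_def\<close>)
  have pl1: "polygon L p 1 = vertex_point (p 0)"
    by (rule ext) (use polygon_vertex[of L L 1 p] L closed in \<open>simp add: vertex_point_def p_def\<close>)
  have p0: "p 0 \<in> \<Union>Y" using e[OF L] by auto
  obtain h where h: "continuous_map (top_of_set ({0..1} \<times> {0..1})) (realization Y) h"
    and h0: "\<And>t. h (0, t) = polygon L p t" and h1: "\<And>t. h (1, t) = vertex_point (p 0)"
    and hp: "\<And>s. s \<in> {0..1::real} \<Longrightarrow> h (s, 1::real) = h (s, 0)"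
    using loops_homotopyE[OF simply_connected_Y \<gamma> _ pathin_vertex_point[OF p0] refl] pl0 pl1 by metis
  obtain m a where m: "0 < (m::nat)" and a: "\<And>i j s t. i < L * m \<Longrightarrow> j < L * m \<Longrightarrow> real i \<le> real (L * m) * s \<Longrightarrow>
       real (L * m) * s \<le> real (Suc i) \<Longrightarrow>
       real j \<le> real (L * m) * t \<Longrightarrow> real (L * m) * t \<le> real (Suc j) \<Longrightarrow> 0 < h (s, t) (a i j)"
    using grid_labels[OF h L] by auto
  \<comment> \<open>Each row has \<open>L * m\<close> cells, numbered from \<open>0\<close> to
    \<open>n\<close>; the step from cell \<open>n\<close> back to cell \<open>0\<close> is treated
    apart.\<close>
  define n where "n = L * m - 1"
  have Lm: "L * m = Suc n" using L m by (simp add: n_def)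
  have a: "0 < h (s, t) (a i j)" if "i \<le> n" "j \<le> n" "real i \<le> real (Suc n) * s"
    "real (Suc n) * s \<le> real (Suc i)" "real j \<le> real (Suc n) * t" "real (Suc n) * t \<le> real (Suc j)" for i j s t
    using a[of i j s t] that unfolding Lm by simp
  have grid: "\<exists>\<sigma>\<in>Y. {a i j, a i (Suc j), a (Suc i) j, a (Suc i) (Suc j)} \<subseteq> \<sigma>" if "i < n" "j < n" for i j
  proof -
    let ?s = "real (Suc i) / real (Suc n)" and ?t = "real (Suc j) / real (Suc n)"
    have s: "0 \<le> ?s" "?s \<le> 1" "real (Suc n) * ?s = real (Suc i)" using that by simp_all
    have t: "0 \<le> ?t" "?t \<le> 1" "real (Suc n) * ?t = real (Suc j)" using that by simp_all
    obtain \<sigma> where \<sigma>: "\<sigma> \<in> Y" "\<And>v. 0 < h (?s, ?t) v \<Longrightarrow> v \<in> \<sigma>"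
      using cells_simplex[OF h s(1,2) t(1,2)] by metis
    have "{a i j, a i (Suc j), a (Suc i) j, a (Suc i) (Suc j)} \<subseteq> \<sigma>"
      using that by (auto intro!: \<sigma>(2) a simp only: s(3) t(3))
    then show ?thesis using \<sigma>(1) by blast
  qed
  \<comment> \<open>The last and the first cell of a row share a point of the loop only because
    \<open>h\<close> is a homotopy through closed paths.\<close>
  have wrap: "\<exists>\<sigma>\<in>Y. {a i n, a i 0, a (Suc i) n, a (Suc i) 0} \<subseteq> \<sigma>" if "i < n" for i
  proof -
    let ?s = "real (Suc i) / real (Suc n)"
    have s: "0 \<le> ?s" "?s \<le> 1" "real (Suc n) * ?s = real (Suc i)" using that by simp_all
    obtain \<sigma> where \<sigma>: "\<sigma> \<in> Y" "\<And>v. 0 < h (?s, 0) v \<Longrightarrow> v \<in> \<sigma>"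
      using cells_simplex[OF h s(1,2), of 0] by auto
    have "0 < h (?s, 1) (a i n)" "0 < h (?s, 1) (a (Suc i) n)"
      "0 < h (?s, 0) (a i 0)" "0 < h (?s, 0) (a (Suc i) 0)"
      using that by (auto intro!: a simp only: s(3)) auto
    moreover have "h (?s, 1) = h (?s, 0)" using hp s by simp
    ultimately show ?thesis using \<sigma> by auto
  qed
  have "\<forall>u. u \<in> states \<longrightarrow> pt u = a i 0 \<longrightarrow> tr (lift (a i) u n) (a i 0) = u" if "i \<le> n" for i
    using that
  proof (induction i rule: inc_induct)
    case base
    have const: "a n j = p 0" if "j \<le> n" for j
    proof -
      have "0 < h (1, real j / real (Suc n)) (a n j)"
        using that by (intro a) auto
      then show ?thesis by (simp add: h1 vertex_point_def split: if_splits)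
    qed
    have "lift (a n) u j = u" if "pt u = p 0" "j \<le> n" for u j
      using that(2)
    proof (induction j)
      case (Suc j)
      then show ?case using const[of "Suc j"] that(1) tr_self[of u] by simp
    qed simp
    then show ?case using const[of 0] tr_self by (metis le0 order_refl)
  next
    case (step i)
    then have closed: "\<And>u. u \<in> states \<Longrightarrow> pt u = a (Suc i) 0 \<Longrightarrow>
        tr (lift (a (Suc i)) u n) (a (Suc i) 0) = u" by simp
    have "tr (lift (a i) u n) (a i 0) = u" if "u \<in> states" "pt u = a i 0" for u
      by (rule lift_closed_parallel[where c' = "a (Suc i)"])
        (simp_all add: that closed grid[OF step(2)] wrap[OF step(2)] del: insert_subset)
    then show ?case by blast
  qed
  from this[of 0] have hol: "tr (lift (a 0) (z 0) n) (a 0 0) = z 0" if "a 0 0 = p 0"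
    using that z[of 0] by (simp add: p_def)
  have Lr: "real (Suc n) = real L * real m" using Lm by (metis of_nat_mult)
  have m': "0 < real m" using m by simp
  \<comment> \<open>The grid has \<open>m\<close> cells on every edge of the polygon, so cell
    \<open>j\<close> lies on edge \<open>j div m\<close> and its label is an end of this edge. If
    the cell touches an end, the label must be that end, which is the only vertex with positive
    weight there.\<close>
  have row: "a 0 j \<in> {p (j div m), p (Suc (j div m))}"
    "j mod m = 0 \<Longrightarrow> a 0 j = p (j div m)"
    "Suc j = Suc (j div m) * m \<Longrightarrow> a 0 j = p (Suc (j div m))"
    "j div m < L" if j: "j \<le> n" for j
  proof -
    define k where "k = j div m"
    have kL: "k < L" unfolding k_def using j Lm by (simp add: less_mult_imp_div_less)
    have jk: "k * m \<le> j" "Suc j \<le> Suc k * m"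
      unfolding k_def using m by (simp_all add: div_times_less_eq_dividend dividend_less_div_times Suc_leI)
    have jk': "real k * real m \<le> real j" "real j + 1 \<le> (real k + 1) * real m"
    proof -
      show "real k * real m \<le> real j" using jk(1) by (metis of_nat_le_iff of_nat_mult)
      have "real (Suc j) \<le> real (Suc k * m)" using jk(2) of_nat_le_iff by blast
      then show "real j + 1 \<le> (real k + 1) * real m" by (simp add: algebra_simps)
    qed
    have pos: "0 < polygon L p t (a 0 j)"
      if "real j \<le> real (Suc n) * t" "real (Suc n) * t \<le> real (Suc j)" for t
      using a[of 0 j 0 t] j that by (simp add: h0)
    let ?t = "real j / real (Suc n)" and ?t' = "real (Suc j) / real (Suc n)"
    have t: "real L * ?t = real j / real m" "real L * ?t' = real (Suc j) / real m"
      using L m unfolding Lr by simp_all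
    have "polygon L p ?t \<in> closed_simplex {p k, p (Suc k)}"
    proof (rule polygon_edge_simplex[OF kL])
      show "real k \<le> real L * ?t" unfolding t using jk' m' by (simp add: field_simps)
      show "real L * ?t \<le> real (Suc k)" unfolding t using jk' m' by (simp add: field_simps)
      show "p k \<noteq> p (Suc k)" using e[OF kL] by simp
    qed
    moreover have "0 < polygon L p ?t (a 0 j)" by (rule pos) auto
    ultimately have "a 0 j \<in> {p k, p (Suc k)}" by (auto simp: closed_simplex_def)
    then show "a 0 j \<in> {p (j div m), p (Suc (j div m))}" by (simp add: k_def)
    show "a 0 j = p (j div m)" if "j mod m = 0"
    proof -
      have "j = k * m" unfolding k_def using that by (metis add.right_neutral div_mult_mod_eq)
      then have "real L * ?t = real k" unfolding t using m' by simp
      then show ?thesis using polygon_vertex[of k L ?t p] kL L pos[of ?t]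
        by (auto simp: k_def split: if_splits)
    qed
    show "a 0 j = p (Suc (j div m))" if "Suc j = Suc (j div m) * m"
    proof -
      have "real L * ?t' = real (Suc k)"
        unfolding t k_def using that m' by (metis nonzero_mult_div_cancel_right of_nat_mult less_numeral_extra(3))
      then show ?thesis using polygon_vertex[of "Suc k" L ?t' p] kL L pos[of ?t']
        by (auto simp: k_def split: if_splits)
    qed
    show "j div m < L" using kL by (simp add: k_def)
  qed
  have a00: "a 0 0 = p 0" using row(2)[of 0] by simp
  have step: "tr (z k) (p (Suc k)) = z (Suc k)" if "k < L" for k
    using tr_nb[OF z z nb, of k] that by (simp add: p_def)
  \<comment> \<open>Hence the lift along the first row follows \<open>z\<close>, up to a transport
    within the current edge.\<close>
  have lift: "lift (a 0) (z 0) j = tr (z (j div m)) (a 0 j)" if "j \<le> n" for j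
    using that
  proof (induction j)
    case 0
    then show ?case using a00 by (simp add: p_def)
  next
    case (Suc j)
    define k where "k = j div m"
    have kL: "k < L" using row(4)[of j] Suc.prems by (simp add: k_def)
    have IH: "lift (a 0) (z 0) (Suc j) = tr (tr (z k) (a 0 j)) (a 0 (Suc j))"
      using Suc by (simp add: k_def)
    show ?case
    proof (cases "Suc j div m = k")
      case True
      have "a 0 j \<in> {p k, p (Suc k)}" "a 0 (Suc j) \<in> {p k, p (Suc k)}"
        using row(1)[of j] row(1)[of "Suc j"] Suc.prems True by (simp_all add: k_def)
      then show ?thesis
        using IH True tr_tr[of "z k" "{p k, p (Suc k)}" "a 0 j" "a 0 (Suc j)"] z[of k] e[OF kL] kL
        by (simp add: p_def)
    next
      case False
      then have "Suc j mod m = 0" "Suc j div m = Suc k"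
        by (simp_all add: k_def div_Suc mod_Suc split: if_splits)
      then have "Suc j = Suc k * m" by (metis add.right_neutral div_mult_mod_eq)
      then have "a 0 j = p (Suc k)" using row(3)[of j] Suc.prems by (simp add: k_def)
      then show ?thesis using IH step[OF kL] \<open>Suc j div m = Suc k\<close> by simp
    qed
  qed
  have "n div m = L - 1"
  proof -
    obtain l where l: "L = Suc l" using L gr0_implies_Suc by blast
    then have n: "n = (m - 1) + l * m" using Lm m by simp
    have "((m - 1) + l * m) div m = l + (m - 1) div m" using m by (intro div_mult_self1) simp
    also have "\<dots> = l" using m by simp
    finally show ?thesis unfolding n l by simp
  qed
  then have nL: "Suc (n div m) = L" "n div m < L" using L by simp_all
  have "a 0 n = p (Suc (n div m))" by (rule row(3)) (simp_all only: nL Lm order_refl)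
  then have "lift (a 0) (z 0) n = z (Suc (n div m))"
    using lift[OF order_refl] step[OF nL(2)] by (simp only:)
  then have "lift (a 0) (z 0) n = z L" by (simp only: nL)
  \<comment> \<open>The last cell touches the end of the polygon, so the lift has already arrived at
    \<open>z L\<close>, and the step across the seam is stationary.\<close>
  then have "tr (z L) (pt (z L)) = z 0"
    using hol[OF a00] unfolding a00 p_def closed by metis
  then show ?thesis unfolding tr_self by (rule sym)
qed

section \<open>Levels\<close>

lemma root_state: "State b {||} \<in> states"
  unfolding states_def using Z.simps(1) by blast

definition nb_on :: "'v state \<Rightarrow> 'v state \<Rightarrow> bool" where
  "nb_on s t \<longleftrightarrow> s \<in> states \<and> t \<in> states \<and> nb s t"

lemma nb_on_root: "s \<in> Z n \<Longrightarrow> nb_on\<^sup>*\<^sup>* (State b {||}) s"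
proof (induction n arbitrary: s)
  case 0
  then show ?case by simp
next
  case (Suc n)
  obtain d where d: "d |\<in>| preds s" "d \<in> Z n" using Suc.prems by (rule Z_Suc_pred)
  have "nb_on d s" using d Suc.prems unfolding nb_on_def nb_def states_def by blast
  then show ?case using Suc.IH[OF d(2)] by simp
qed

lemma nb_on_connected:
  assumes "s \<in> states" "t \<in> states"
  shows "nb_on\<^sup>*\<^sup>* s t"
proof -
  have "symp nb_on" by (auto simp: symp_def nb_on_def nb_sym)
  moreover have "nb_on\<^sup>*\<^sup>* (State b {||}) s" "nb_on\<^sup>*\<^sup>* (State b {||}) t"
    using assms nb_on_root by (auto simp: states_def)
  ultimately show ?thesis by (metis rtranclp_trans symp_rtranclp sympD)
qed

text \<open>A path of states between two states over the same vertex has a closed image, so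
  \<open>monodromy\<close> identifies its ends: the cover has only one sheet.\<close>

lemma pt_inj:
  assumes "s \<in> states" "t \<in> states" "pt s = pt t"
  shows "s = t"
proof -
  obtain L where "(nb_on ^^ L) s t" using nb_on_connected[OF assms(1,2)] by (metis rtranclp_power)
  then obtain z where z: "z 0 = s" "z L = t" "\<And>k. k < L \<Longrightarrow> nb_on (z k) (z (Suc k))"
    by (auto simp: relpowp_fun_conv)
  show ?thesis
  proof (cases "L = 0")
    case False
    have "z k \<in> states" if "k \<le> L" for k
    proof (cases "k = L")
      case False
      then show ?thesis using z(3)[of k] that by (simp add: nb_on_def)
    qed (use z assms in simp)
    then show ?thesis using monodromy[of L z] False z assms(3) by (simp add: nb_on_def)
  qed (use z in simp)
qed

lemma pt_surj:
  assumes "y \<in> \<Union>Y"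
  obtains s where "s \<in> states" "pt s = y"
proof -
  have "A\<^sup>*\<^sup>* b y" using connected_A base assms by blast
  then have "\<exists>s\<in>states. pt s = y"
  proof (induction rule: rtranclp_induct)
    case base
    then show ?case using root_state by force
  next
    case (step y z)
    then show ?case using nb_exists by metis
  qed
  then show thesis using that by blast
qed

lemma nb_iff_A:
  assumes "s \<in> states" "t \<in> states"
  shows "nb s t \<longleftrightarrow> A (pt s) (pt t)"
  using assms nb_A nb_exists[OF assms(1)] pt_inj by metis

text \<open>Well defined because \<open>pt\<close> is injective and levels are disjoint. That it is
  the distance from \<open>b\<close> is established in \<open>gdist_one_skeleton\<close>.\<close>

definition lvl :: "'v \<Rightarrow> nat" where
  "lvl y = (THE n. \<exists>s\<in>Z n. pt s = y)"

lemma lvl_eq: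
  assumes "s \<in> Z n"
  shows "lvl (pt s) = n"
  unfolding lvl_def
proof (rule the_equality)
  fix m assume "\<exists>t\<in>Z m. pt t = pt s"
  then obtain t where t: "t \<in> Z m" "pt t = pt s" by blast
  then have "t = s" using pt_inj assms by (auto simp: states_def)
  then show "m = n" using Z_level_unique t assms by blast
qed (use assms in blast)

lemma vertex_stateE:
  assumes "y \<in> \<Union>Y"
  obtains s where "s \<in> Z (lvl y)" "s \<in> states" "pt s = y"
proof -
  obtain s where s: "s \<in> states" "pt s = y" using pt_surj[OF assms] by metis
  then obtain n where "s \<in> Z n" by (auto simp: states_def)
  then show thesis using that[of s] s lvl_eq[of s n] by simp
qed

lemma A_vertex:
  assumes "A x y"
  shows "x \<in> \<Union>Y" "y \<in> \<Union>Y"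
  using assms by (auto simp: A_def)

lemma hadj_level:
  assumes "hadj s t" "s \<in> Z m" "t \<in> Z n"
  shows "m = n"
proof -
  obtain d where d: "d |\<in>| preds s" "d |\<in>| preds t" using assms(1) by (auto simp: hadj_def)
  obtain i where i: "m = Suc i" "d \<in> Z i" using Z_pred[OF assms(2) d(1)] by metis
  obtain j where j: "n = Suc j" "d \<in> Z j" using Z_pred[OF assms(3) d(2)] by metis
  show ?thesis using i j Z_level_unique by blast
qed

text \<open>This becomes the edge relation of the squaring, oriented away from
  \<open>b\<close>.\<close>

definition E :: "'v \<Rightarrow> 'v \<Rightarrow> bool" where
  "E x y \<longleftrightarrow> A x y \<and> lvl y = Suc (lvl x)"

lemma E_iff_pred:
  assumes "s \<in> states" "t \<in> states"
  shows "E (pt s) (pt t) \<longleftrightarrow> s |\<in>| preds t"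
proof -
  obtain m n where mn: "s \<in> Z m" "t \<in> Z n" using assms by (auto simp: states_def)
  show ?thesis
  proof
    assume "E (pt s) (pt t)"
    then have nb: "nb s t" and l: "n = Suc m"
      using nb_iff_A[OF assms] lvl_eq mn by (auto simp: E_def)
    moreover have "\<not> t |\<in>| preds s" using Z_pred[OF mn(1)] Z_level_unique[OF mn(2)] l
      by (metis Suc_n_not_le_n le_Suc_eq order_refl)
    moreover have "\<not> hadj s t" using hadj_level mn l by fastforce
    ultimately show "s |\<in>| preds t" by (auto simp: nb_def)
  next
    assume s: "s |\<in>| preds t"
    obtain i where i: "n = Suc i" "s \<in> Z i" "A (pt s) (pt t)" using Z_pred[OF mn(2) s] by metis
    then show "E (pt s) (pt t)" using lvl_eq mn by (auto simp: E_def)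
  qed
qed

lemma lvl_base [simp]: "lvl b = 0"
  using lvl_eq[of "State b {||}" 0] by simp

lemma lvl_0:
  assumes "y \<in> \<Union>Y" "lvl y = 0"
  shows "y = b"
proof -
  obtain s where "s \<in> Z (lvl y)" "pt s = y" using vertex_stateE assms(1) by metis
  then show ?thesis using assms(2) by simp
qed

lemma A_lvl:
  assumes "A x y"
  shows "lvl y \<le> Suc (lvl x)"
proof -
  obtain s where s: "s \<in> Z (lvl x)" "s \<in> states" "pt s = x" using vertex_stateE A_vertex assms by metis
  obtain t where t: "t \<in> Z (lvl y)" "t \<in> states" "pt t = y" using vertex_stateE A_vertex assms by metis
  have "nb s t" using nb_iff_A s t assms by metis
  then consider "t |\<in>| preds s" | "s |\<in>| preds t" | "hadj s t" by (auto simp: nb_def)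
  then show ?thesis
  proof cases
    case 1
    then show ?thesis using E_iff_pred[OF t(2) s(2)] s t by (simp add: E_def)
  next
    case 2
    then show ?thesis using E_iff_pred[OF s(2) t(2)] s t by (simp add: E_def)
  next
    case 3
    then show ?thesis using hadj_level s t by force
  qed
qed

lemma E_exists:
  assumes "y \<in> \<Union>Y" "y \<noteq> b"
  obtains x where "E x y"
proof -
  obtain t where t: "t \<in> Z (lvl y)" "t \<in> states" "pt t = y" using vertex_stateE assms by metis
  obtain n where n: "lvl y = Suc n" using lvl_0 assms by (meson not0_implies_Suc)
  then obtain d where d: "d |\<in>| preds t" "d \<in> Z n" using Z_Suc_pred t by metis
  then have "d \<in> states" by (auto simp: states_def)
  then have "E (pt d) y" using E_iff_pred t d by metis
  then show thesis using that by blast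
qed

lemma E_A: "E x y \<Longrightarrow> A x y" and E_lvl: "E x y \<Longrightarrow> lvl y = Suc (lvl x)"
  by (simp_all add: E_def)

lemma E_E_triangle:
  assumes "E x y" "E x' y" "x \<noteq> x'"
  shows "T x x' y"
proof -
  obtain s where s: "s \<in> states" "pt s = x" using vertex_stateE A_vertex E_A assms by metis
  obtain s' where s': "s' \<in> states" "pt s' = x'" using vertex_stateE A_vertex E_A assms by metis
  obtain t where t: "t \<in> Z (lvl y)" "t \<in> states" "pt t = y" using vertex_stateE A_vertex E_A assms by metis
  have "s |\<in>| preds t" "s' |\<in>| preds t" using E_iff_pred s s' t assms by metis+
  then show ?thesis using Z_preds(2)[OF t(1), of s' s] s s' t assms(3) by auto
qed

text \<open>An edge that joins no vertex to a predecessor comes from \<open>hadj\<close>, whose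
  witness is the apex.\<close>

lemma horizontal_triangle:
  assumes "A x y" "lvl x = lvl y"
  obtains u where "E u x" "E u y" "T u x y"
proof -
  obtain s where s: "s \<in> Z (lvl x)" "s \<in> states" "pt s = x" using vertex_stateE A_vertex assms by metis
  obtain t where t: "t \<in> Z (lvl y)" "t \<in> states" "pt t = y" using vertex_stateE A_vertex assms by metis
  have "nb s t" using nb_iff_A s t assms by metis
  moreover have "\<not> s |\<in>| preds t" "\<not> t |\<in>| preds s"
    using E_iff_pred[OF s(2) t(2)] E_iff_pred[OF t(2) s(2)] s t assms by (auto simp: E_def)
  ultimately have "hadj s t" by (auto simp: nb_def)
  then obtain d where d: "d |\<in>| preds s" "d |\<in>| preds t" "T (pt d) (pt s) (pt t)"
    by (auto simp: hadj_def)
  obtain k where "d \<in> Z k" using Z_pred[OF s(1) d(1)] by metis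
  then have "d \<in> states" by (auto simp: states_def)
  then have "E (pt d) x" "E (pt d) y" using E_iff_pred s t d by metis+
  then show thesis using that d s t by simp
qed

end

section \<open>Uniqueness of lower neighbours and apices\<close>

context systolic
begin

lemma E_at_most_two:
  assumes "E x y" "E x' y" "E x'' y" "x \<noteq> x'" "x \<noteq> x''"
  shows "x' = x''"
proof (rule ccontr)
  assume "x' \<noteq> x''"
  then have "T x x' y" "T x' x'' y" "T x'' x y"
    using assms E_E_triangle by metis+
  then show False using no_link_3cycle[of y x x' x''] T_perm(4) by blast
qed

text \<open>An apex \<open>u\<close> different from the apex \<open>w\<close> of
  \<open>horizontal_triangle\<close> would form a triangle with \<open>x\<close> and
  \<open>y\<close> in the link of \<open>w\<close>.\<close>

lemma horizontal_unique:
  assumes "A x y" "lvl x = lvl y" "E u x" "E u y" "E u' x" "E u' y"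
  shows "u = u'"
proof -
  obtain w where w: "E w x" "E w y" "T w x y" using horizontal_triangle assms(1,2) by metis
  have "u = w" if "E u x" "E u y" for u
  proof (rule ccontr)
    assume "u \<noteq> w"
    then have "T w u x" "T w u y" using E_E_triangle that w by metis+
    then show False using no_link_3cycle[OF _ w(3) T_perm(1)] by blast
  qed
  then show ?thesis using assms by metis
qed

lemma common_pred_triangle:
  assumes "A x y" "E u x" "E u y"
  shows "T u x y"
proof -
  have l: "lvl x = lvl y" using assms by (simp add: E_def)
  obtain w where w: "E w x" "E w y" "T w x y" using horizontal_triangle assms(1) l by metis
  then show ?thesis using horizontal_unique[OF assms(1) l assms(2,3) w(1,2)] by simp
qed

section \<open>Straight paths\<close>

text \<open>Straight paths are horizontal paths in which the triangles below consecutive edges have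
  different apices.\<close>

definition straight :: "nat \<Rightarrow> (nat \<Rightarrow> 'v) \<Rightarrow> nat \<Rightarrow> nat \<Rightarrow> bool" where
  "straight k f a c \<longleftrightarrow> (\<forall>i. a \<le> i \<and> i \<le> c \<longrightarrow> lvl (f i) = k) \<and>
     (\<forall>i. a \<le> i \<and> i < c \<longrightarrow> A (f i) (f (Suc i))) \<and>
     (\<forall>i u. a \<le> i \<and> Suc i < c \<longrightarrow> E u (f i) \<longrightarrow> E u (f (Suc i)) \<longrightarrow> \<not> E u (f (Suc (Suc i))))"

text \<open>Otherwise the link of \<open>h (Suc i)\<close> would contain a closed walk of length five.\<close>

lemma straight_below:
  assumes f: "\<And>i. a \<le> i \<Longrightarrow> Suc i < c \<Longrightarrow> A (f i) (f (Suc i))"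
    and h: "\<And>i. a \<le> i \<Longrightarrow> i < c \<Longrightarrow> E (h i) (f i) \<and> E (h (Suc i)) (f i) \<and> h i \<noteq> h (Suc i)"
    and l: "\<And>i. a \<le> i \<Longrightarrow> i \<le> c \<Longrightarrow> lvl (h i) = k"
  shows "straight k h a c"
proof -
  have T: "T (h i) (h (Suc i)) (f i)" if "a \<le> i" "i < c" for i
    using h[OF that] E_E_triangle by blast
  have "\<not> E u (h (Suc (Suc i)))" if i: "a \<le> i" "Suc i < c" and u: "E u (h i)" "E u (h (Suc i))" for i u
  proof
    assume u': "E u (h (Suc (Suc i)))"
    have T1: "T (h i) (h (Suc i)) (f i)" using T[of i] i by simp
    have T2: "T (h (Suc i)) (h (Suc (Suc i))) (f (Suc i))" using T[of "Suc i"] i by simp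
    have T3: "T (h (Suc i)) (f i) (f (Suc i))"
      using common_pred_triangle[OF f[OF i]] h[of i] h[of "Suc i"] i by simp
    have T4: "T u (h i) (h (Suc i))" using common_pred_triangle[OF T_A(1)[OF T1]] u by simp
    have T5: "T u (h (Suc i)) (h (Suc (Suc i)))"
      using common_pred_triangle[OF T_A(1)[OF T2]] u u' by simp
    show False
      by (rule no_link_5walk[OF T_perm(2)[OF T1] T3 T_perm(1)[OF T2] T_perm(3)[OF T5]
            T_perm(4)[OF T4]])
  qed
  then show ?thesis using T_A(1)[OF T] l unfolding straight_def by blast
qed

text \<open>\<open>h (Suc i)\<close> is the apex below the edge from \<open>f i\<close> to
  \<open>f (Suc i)\<close>. By this shift \<open>h i\<close> and \<open>h (Suc i)\<close> both lie
  below \<open>f i\<close>, as \<open>straight_below\<close> wants, and the positions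
  \<open>a\<close> and \<open>Suc c\<close> stay free for additional end points.\<close>

lemma straight_preds:
  assumes "straight (Suc k) f a c"
  obtains h where "\<And>i. a \<le> i \<Longrightarrow> i < c \<Longrightarrow> E (h (Suc i)) (f i) \<and> E (h (Suc i)) (f (Suc i))"
    "\<And>i. Suc a \<le> i \<Longrightarrow> i < c \<Longrightarrow> h i \<noteq> h (Suc i)" "\<And>x y. E x y \<Longrightarrow> lvl y = Suc k \<Longrightarrow> lvl x = k"
proof -
  have "\<exists>u. E u (f i) \<and> E u (f (Suc i))" if "a \<le> i" "i < c" for i
  proof -
    have "A (f i) (f (Suc i))" "lvl (f i) = lvl (f (Suc i))"
      using assms that by (auto simp: straight_def)
    then show ?thesis using horizontal_triangle by metis
  qed
  then obtain g where g: "\<And>i. a \<le> i \<Longrightarrow> i < c \<Longrightarrow> E (g i) (f i) \<and> E (g i) (f (Suc i))" by metis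
  have "g i \<noteq> g (Suc i)" if "a \<le> i" "Suc i < c" for i
  proof
    assume "g i = g (Suc i)"
    then have "E (g i) (f i)" "E (g i) (f (Suc i))" "E (g i) (f (Suc (Suc i)))"
      using g[of i] g[of "Suc i"] that by simp_all
    then show False using assms that unfolding straight_def by blast
  qed
  then have "g (i - 1) \<noteq> g i" if "Suc a \<le> i" "i < c" for i
    using that by (cases i) auto
  with g show thesis by (intro that[of "\<lambda>i. g (i - 1)"]) (auto dest: E_lvl)
qed

text \<open>The proof shows at the same time, by induction on the level, that straight paths are not closed:
  for \<open>c > a + 1\<close> the apices below the path, followed by \<open>u\<close>, would be a closed straight path.\<close>

lemma straight_wide:
  assumes "straight (Suc k) f a c" "a < c" "E u (f a)" "E u (f (Suc a))" "E u (f c)"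
  shows "c = Suc a"
proof -
  \<comment> \<open>That straight paths on level \<open>k\<close> are not closed is an assumption
    here, since the claim is used both inside the induction proving this and for the final
    conclusion.\<close>
  have wide: "c = Suc a"
    if IH: "\<And>f a c. straight k f a c \<Longrightarrow> a < c \<Longrightarrow> f a \<noteq> f c"
      and st: "straight (Suc k) f a c" and ac: "a < c" and u: "E u (f a)" "E u (f (Suc a))" "E u (f c)"
    for k f a c u
  proof (rule ccontr)
    assume "c \<noteq> Suc a"
    then have ac': "Suc a < c" using ac by simp
    obtain h where h: "\<And>i. a \<le> i \<Longrightarrow> i < c \<Longrightarrow> E (h (Suc i)) (f i) \<and> E (h (Suc i)) (f (Suc i))"
      "\<And>i. Suc a \<le> i \<Longrightarrow> i < c \<Longrightarrow> h i \<noteq> h (Suc i)" "\<And>x y. E x y \<Longrightarrow> lvl y = Suc k \<Longrightarrow> lvl x = k"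
      using straight_preds[OF st] by metis
    have fA: "A (f i) (f (Suc i))" if "a \<le> i" "i < c" for i using st that by (auto simp: straight_def)
    have fl: "lvl (f i) = Suc k" if "a \<le> i" "i \<le> c" for i using st that by (auto simp: straight_def)
    have hE: "E (h i) (f (i - 1)) \<and> E (h i) (f i)" if "Suc a \<le> i" "i \<le> c" for i
      using h(1)[of "i - 1"] that by (cases i) auto
    have hu: "h (Suc a) = u"
      using horizontal_unique[OF fA[of a]] hE[of "Suc a"] u fl[of a] fl[of "Suc a"] ac by simp
    have hl: "lvl (h i) = k" if "Suc a \<le> i" "i \<le> c" for i
      using h(3)[of "h i" "f i"] hE[OF that] fl[of i] that by simp
    have "straight k h (Suc a) c"
    proof (rule straight_below)
      show "A (f i) (f (Suc i))" if "Suc a \<le> i" "Suc i < c" for i using fA[of i] that by simp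
      show "E (h i) (f i) \<and> E (h (Suc i)) (f i) \<and> h i \<noteq> h (Suc i)" if "Suc a \<le> i" "i < c" for i
        using hE[of i] h(1)[of i] h(2)[of i] that by simp
    qed (rule hl)
    from IH[OF this ac'] have ne: "u \<noteq> h c" using hu by simp
    \<comment> \<open>The apices run from \<open>u = h (Suc a)\<close> to \<open>h c\<close>. As
      \<open>h c\<close> and \<open>u\<close> are distinct and both below \<open>f c\<close>, the
      vertex \<open>u\<close> can be appended, and the path returns to its start.\<close>
    define g where "g = h(Suc c := u)"
    have "straight k g (Suc a) (Suc c)"
    proof (rule straight_below)
      show "A (f i) (f (Suc i))" if "Suc a \<le> i" "Suc i < Suc c" for i using fA[of i] that by simp
      show "E (g i) (f i) \<and> E (g (Suc i)) (f i) \<and> g i \<noteq> g (Suc i)" if i: "Suc a \<le> i" "i < Suc c" for i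
      proof (cases "i = c")
        case True
        then show ?thesis using hE[of c] u ne i by (simp add: g_def)
      next
        case False
        then show ?thesis using hE[of i] h(1)[of i] h(2)[of i] i by (simp add: g_def)
      qed
      show "lvl (g i) = k" if "Suc a \<le> i" "i \<le> Suc c" for i
        using hl[of i] h(3)[OF u(3) fl[of c]] that ac by (auto simp: g_def)
    qed
    from IH[OF this] show False using ac ac' hu by (simp add: g_def)
  qed
  have closed: "straight k f a c \<Longrightarrow> a < c \<Longrightarrow> f a \<noteq> f c" for k f a c
  proof (induction k arbitrary: f a c)
    case 0
    then have "A (f a) (f (Suc a))" "lvl (f a) = 0" "lvl (f (Suc a)) = 0"
      unfolding straight_def by auto
    then show ?case using horizontal_triangle[of "f a" "f (Suc a)"] by (metis E_lvl nat.distinct(1))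
  next
    case (Suc k)
    show ?case
    proof
      assume eq: "f a = f c"
      obtain u where "E u (f a)" "E u (f (Suc a))"
        using straight_preds[OF Suc.prems(1)] Suc.prems(2) by (metis order_refl)
      then have "c = Suc a" using wide[OF Suc.IH Suc.prems] eq by simp
      moreover have "A (f a) (f (Suc a))" using Suc.prems by (simp add: straight_def)
      ultimately show False using eq by (simp add: A_def)
    qed
  qed
  show ?thesis using wide[OF closed assms] .
qed

lemma lvl_E_rtranclp: "E\<^sup>*\<^sup>* x y \<Longrightarrow> x = y \<or> lvl x < lvl y"
  by (induction rule: rtranclp_induct) (auto dest: E_lvl)

text \<open>Descent from \<open>v\<close>: vertices above \<open>x\<close> and \<open>y\<close>
  coincide or are joined by a straight path one level up. In the first case \<open>x\<close> and
  \<open>y\<close> are adjacent, in the second the apices below that path, with \<open>x\<close> and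
  \<open>y\<close> at the ends, form a straight path.\<close>

lemma interval_level_straight:
  assumes "E\<^sup>*\<^sup>* x v" "E\<^sup>*\<^sup>* y v" "lvl x = k" "lvl y = k" "x \<noteq> y"
  shows "\<exists>f a c. a < c \<and> straight k f a c \<and> f a = x \<and> f c = y"
  using assms
proof (induction "lvl v - k" arbitrary: k x y)
  case 0
  then show ?case using lvl_E_rtranclp[of x v] lvl_E_rtranclp[of y v] by auto
next
  case (Suc n)
  have "x \<noteq> v" "y \<noteq> v" using Suc.prems lvl_E_rtranclp[of x v] lvl_E_rtranclp[of y v] by auto
  then obtain x1 y1 where x1: "E x x1" "E\<^sup>*\<^sup>* x1 v" and y1: "E y y1" "E\<^sup>*\<^sup>* y1 v"
    using Suc.prems(1,2) by (metis converse_rtranclpE)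
  have l1: "lvl x1 = Suc k" "lvl y1 = Suc k" using E_lvl x1 y1 Suc.prems by auto
  show ?case
  proof (cases "x1 = y1")
    case True
    then have "A x y" using E_E_triangle[OF x1(1)] y1(1) Suc.prems(5) T_A by blast
    then have "straight k (\<lambda>i. if i = 0 then x else y) 0 1"
      using Suc.prems by (auto simp: straight_def)
    then show ?thesis
      by (intro exI[of _ "\<lambda>i. if i = 0 then x else y"] exI[of _ 0] exI[of _ 1]) simp
  next
    case False
    have "n = lvl v - Suc k" using Suc.hyps(2) by simp
    then obtain f a c where ac: "a < c" and st: "straight (Suc k) f a c" and f: "f a = x1" "f c = y1"
      using Suc.hyps(1)[OF _ x1(2) y1(2) l1 False] by blast
    obtain h where h: "\<And>i. a \<le> i \<Longrightarrow> i < c \<Longrightarrow> E (h (Suc i)) (f i) \<and> E (h (Suc i)) (f (Suc i))"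
      "\<And>i. Suc a \<le> i \<Longrightarrow> i < c \<Longrightarrow> h i \<noteq> h (Suc i)" "\<And>x y. E x y \<Longrightarrow> lvl y = Suc k \<Longrightarrow> lvl x = k"
      using straight_preds[OF st] by metis
    have fA: "A (f i) (f (Suc i))" if "a \<le> i" "i < c" for i using st that by (auto simp: straight_def)
    have fl: "lvl (f i) = Suc k" if "a \<le> i" "i \<le> c" for i using st that by (auto simp: straight_def)
    have hE: "E (h i) (f i)" if "Suc a \<le> i" "i \<le> c" for i
      using h(1)[of "i - 1"] that by (cases i) auto
    have hE': "E (h (Suc i)) (f i)" if "a \<le> i" "i < c" for i using h(1)[OF that] by simp
    \<comment> \<open>If \<open>x\<close> is itself the first apex, the path of apices already
      starts there; otherwise \<open>x\<close> is put in front at position \<open>a\<close>. The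
      same applies to \<open>y\<close> and the last apex \<open>h c\<close>.\<close>
    define a' where "a' = (if x = h (Suc a) then Suc a else a)"
    define c' where "c' = (if y = h c then c else Suc c)"
    define g where "g = h(a := x, Suc c := y)"
    have bounds: "a \<le> a'" "a' \<le> Suc a" "c \<le> c'" "c' \<le> Suc c"
      by (auto simp: a'_def c'_def)
    have gmid: "g i = h i" if "Suc a \<le> i" "i \<le> c" for i using that by (auto simp: g_def)
    have ga: "g a = x" and gc: "g (Suc c) = y" using ac by (auto simp: g_def)
    have ga': "g a' = x" unfolding a'_def using ga gmid[of "Suc a"] ac by simp
    have gc': "g c' = y" unfolding c'_def using gc gmid[of c] ac by simp
    have gE: "E (g i) (f i) \<and> E (g (Suc i)) (f i) \<and> g i \<noteq> g (Suc i)" if i: "a' \<le> i" "i < c'" for i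
    proof -
      consider "i = a" | "i = c" | "Suc a \<le> i" "i < c" using i bounds by linarith
      then show ?thesis
      proof cases
        case 1
        then have "x \<noteq> h (Suc a)" using i by (auto simp: a'_def)
        then show ?thesis using 1 ga gmid[of "Suc a"] ac hE'[of a] f x1 by simp
      next
        case 2
        then have "y \<noteq> h c" using i by (auto simp: c'_def)
        then show ?thesis using 2 gc gmid[of c] ac hE[of c] f y1 by auto
      next
        case 3
        then show ?thesis using gmid[of i] gmid[of "Suc i"] hE[of i] hE'[of i] h(2)[of i] by simp
      qed
    qed
    have lt: "a' < c'"
    proof (rule ccontr)
      assume "\<not> a' < c'"
      then have "a' = c'" using bounds ac by linarith
      then show False using ga' gc' Suc.prems(5) by simp
    qed
    have "straight k g a' c'"
    proof (rule straight_below)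
      show "A (f i) (f (Suc i))" if "a' \<le> i" "Suc i < c'" for i using fA[of i] that bounds by simp
      show "lvl (g i) = k" if "a' \<le> i" "i \<le> c'" for i
      proof (cases "i = c'")
        case True
        then show ?thesis using gc' Suc.prems by simp
      next
        case False
        then have "E (g i) (f i)" "lvl (f i) = Suc k" using gE[of i] that fl[of i] bounds by auto
        then show ?thesis using h(3) by blast
      qed
    qed (rule gE)
    then show ?thesis using ga' gc' lt by blast
  qed
qed

text \<open>On a straight path from \<open>x\<close> to \<open>y\<close>, the apex below the first
  edge is \<open>u\<close> or \<open>u'\<close>, as \<open>x\<close> has no other lower neighbours;
  hence it also lies below \<open>y\<close>. By \<open>straight_wide\<close> the path is a single
  edge, which has only one apex.\<close>

lemma interval_no_double:
  assumes v: "E\<^sup>*\<^sup>* x v" "E\<^sup>*\<^sup>* y v" and u: "E u x" "E u y" "E u' x" "E u' y" "u \<noteq> u'"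
  shows "x = y"
proof (rule ccontr)
  assume ne: "x \<noteq> y"
  obtain k where k: "lvl x = Suc k" "lvl y = Suc k" using u E_lvl by metis
  obtain f a c where ac: "a < c" and st: "straight (Suc k) f a c" and f: "f a = x" "f c = y"
    using interval_level_straight[OF v k ne] by blast
  obtain w where w: "E w (f a)" "E w (f (Suc a))"
    using straight_preds[OF st] ac by (metis order_refl)
  have "E w (f c)" using E_at_most_two[of u x u' w] u w f by metis
  then have "c = Suc a" using straight_wide[OF st ac w] by simp
  then have "A x y" using st f ac by (auto simp: straight_def)
  then show False using horizontal_unique[of x y u u'] u k by simp
qed

lemma E_base: "y \<in> \<Union>Y \<Longrightarrow> E\<^sup>*\<^sup>* b y"
proof (induction "lvl y" arbitrary: y)
  case 0
  then have "y = b" using lvl_0[of y] by simp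
  then show ?case by simp
next
  case (Suc n)
  then have "y \<noteq> b" by auto
  then obtain x where x: "E x y" using E_exists Suc.prems by metis
  then have "n = lvl x" "x \<in> \<Union>Y" using E_lvl[OF x] Suc.hyps(2) A_vertex[OF E_A[OF x]] by auto
  then have "E\<^sup>*\<^sup>* b x" using Suc.hyps(1) by blast
  then show ?case using x by simp
qed

lemma finite_below: "finite {w. E\<^sup>*\<^sup>* w v}"
proof (induction "lvl v" arbitrary: v rule: less_induct)
  case less
  have "finite {x. E x v}"
  proof (cases "\<exists>x x'. E x v \<and> E x' v \<and> x \<noteq> x'")
    case True
    then obtain x x' where x: "E x v" "E x' v" "x \<noteq> x'" by blast
    then have "{y. E y v} \<subseteq> {x, x'}" using E_at_most_two by blast
    then show ?thesis using finite_subset by blast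
  next
    case False
    then have "{x. E x v} = {} \<or> (\<exists>x. {x. E x v} \<subseteq> {x})" by blast
    then show ?thesis using finite_subset by auto
  qed
  moreover have "finite {w. E\<^sup>*\<^sup>* w x}" if "E x v" for x
    using less E_lvl[OF that] by simp
  moreover have "{w. E\<^sup>*\<^sup>* w v} \<subseteq> insert v (\<Union>x\<in>{x. E x v}. {w. E\<^sup>*\<^sup>* w x})"
    by (auto elim: rtranclp.cases)
  ultimately show ?case by (metis (no_types, lifting) finite_UN_I finite_insert finite_subset mem_Collect_eq)
qed

end

section \<open>Collapsing dominated vertices\<close>

lemma closed_simplex_mono:
  assumes "\<sigma> \<subseteq> \<tau>" "finite \<tau>"
  shows "closed_simplex \<sigma> \<subseteq> closed_simplex \<tau>"
proof
  fix f assume f: "f \<in> closed_simplex \<sigma>"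
  have "sum f \<tau> = sum f \<sigma>"
    using assms f by (intro sum.mono_neutral_right) (auto simp: closed_simplex_def)
  then show "f \<in> closed_simplex \<tau>" using f assms by (auto simp: closed_simplex_def)
qed

definition slide :: "'n \<Rightarrow> 'n \<Rightarrow> real \<Rightarrow> ('n \<Rightarrow> real) \<Rightarrow> 'n \<Rightarrow> real" where
  "slide x y s f v = f v + s * f x * ((if v = y then 1 else 0) - (if v = x then 1 else 0))"

lemma slide_closed_simplex:
  assumes "f \<in> closed_simplex \<tau>" "finite \<tau>" "x \<in> \<tau>" "y \<in> \<tau>" "x \<noteq> y" "0 \<le> s" "s \<le> 1"
  shows "slide x y s f \<in> closed_simplex \<tau>" "slide x y 1 f \<in> closed_simplex (\<tau> - {x})"
proof -
  have f: "\<And>v. 0 \<le> f v" "\<And>v. v \<notin> \<tau> \<Longrightarrow> f v = 0" "sum f \<tau> = 1"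
    using assms by (auto simp: closed_simplex_def)
  have s: "slide x y s f \<in> closed_simplex \<tau>" if s: "0 \<le> s" "s \<le> 1" for s
  proof -
    have "0 \<le> slide x y s f v" for v
    proof (cases "v = x")
      case True
      then have "slide x y s f v = (1 - s) * f x" using assms(5) by (simp add: slide_def algebra_simps)
      then show ?thesis using s f by simp
    next
      case False
      then show ?thesis using s f by (simp add: slide_def)
    qed
    moreover have "slide x y s f v = 0" if "v \<notin> \<tau>" for v
      using f(2)[OF that] that assms by (auto simp: slide_def)
    moreover have "sum (slide x y s f) \<tau> = 1"
    proof -
      have "(\<Sum>v\<in>\<tau>. s * f x * ((if v = y then 1 else 0) - (if v = x then 1 else 0))) =
          s * f x * ((\<Sum>v\<in>\<tau>. if v = y then 1 else 0) - (\<Sum>v\<in>\<tau>. if v = x then 1 else 0))"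
        by (simp only: sum_distrib_left[symmetric] sum_subtractf)
      also have "\<dots> = 0" using assms by simp
      finally show ?thesis using f(3) by (simp add: slide_def sum.distrib)
    qed
    ultimately show ?thesis by (simp add: closed_simplex_def)
  qed
  show "slide x y s f \<in> closed_simplex \<tau>" using s assms by simp
  have g: "slide x y 1 f \<in> closed_simplex \<tau>" using s by simp
  have "slide x y 1 f x = 0" using assms(5) by (simp add: slide_def)
  moreover from this have "sum (slide x y 1 f) (\<tau> - {x}) = sum (slide x y 1 f) \<tau>"
    using assms(2) by (intro sum.mono_neutral_left) auto
  ultimately show "slide x y 1 f \<in> closed_simplex (\<tau> - {x})"
    using g by (auto simp: closed_simplex_def)
qed

text \<open>Moving the weight of \<open>x\<close> to \<open>y\<close> deforms the complex onto the subcomplex without \<open>x\<close>.\<close>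

lemma simply_connected_dominated:
  assumes fin: "\<And>\<sigma>. \<sigma> \<in> K \<Longrightarrow> finite \<sigma>" and xy: "x \<noteq> y"
    and dom: "\<And>\<sigma>. \<sigma> \<in> K \<Longrightarrow> x \<in> \<sigma> \<Longrightarrow> insert y \<sigma> \<in> K \<and> insert y (\<sigma> - {x}) \<in> K"
    and sc: "simply_connected (realization_points {\<sigma> \<in> K. x \<notin> \<sigma>})"
  shows "simply_connected (realization_points K)"
proof -
  let ?S = "realization_points K" and ?S' = "realization_points {\<sigma> \<in> K. x \<notin> \<sigma>}"
  have sub: "?S' \<subseteq> ?S" by (auto simp: realization_points_def)
  have slide: "slide x y s f \<in> ?S \<and> slide x y 1 f \<in> ?S'" if f: "f \<in> ?S" and s: "0 \<le> s" "s \<le> 1" for f s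
  proof -
    obtain \<sigma> where \<sigma>: "\<sigma> \<in> K" "f \<in> closed_simplex \<sigma>" using f by (auto simp: realization_points_def)
    show ?thesis
    proof (cases "x \<in> \<sigma>")
      case True
      let ?\<tau> = "insert y \<sigma>"
      have \<tau>: "?\<tau> \<in> K" "?\<tau> - {x} \<in> K"
        using dom[OF \<sigma>(1) True] xy by (simp_all add: insert_Diff_if)
      have "f \<in> closed_simplex ?\<tau>" using closed_simplex_mono[of \<sigma> ?\<tau>] \<sigma> fin[OF \<tau>(1)] by auto
      then have "slide x y s f \<in> closed_simplex ?\<tau>" "slide x y 1 f \<in> closed_simplex (?\<tau> - {x})"
        using slide_closed_simplex[OF _ fin[OF \<tau>(1)] _ _ xy s] True by simp_all
      then show ?thesis using \<tau> by (auto simp: realization_points_def)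
    next
      case False
      then have "f x = 0" using \<sigma> by (simp add: closed_simplex_def)
      then have "slide x y s f = f" for s by (auto simp: slide_def)
      then show ?thesis using \<sigma> False by (auto simp: realization_points_def)
    qed
  qed
  \<comment> \<open>Homotopies of free loops suffice, so the deformation need not fix a base
    point.\<close>
  have hom: "homotopic_loops ?S p (slide x y 1 \<circ> p)"
    and loop: "path (slide x y 1 \<circ> p)" "path_image (slide x y 1 \<circ> p) \<subseteq> ?S'"
    if p: "path p" "pathfinish p = pathstart p" "path_image p \<subseteq> ?S" for p
  proof -
    have pc: "continuous_on {0..1} (\<lambda>t. p t v)" for v
      using p(1) unfolding path_def by (rule continuous_on_product_then_coordinatewise)
    have pS: "p t \<in> ?S" if "t \<in> {0..1}" for t using p(3) that by (auto simp: path_image_def)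
    show "homotopic_loops ?S p (slide x y 1 \<circ> p)"
      unfolding homotopic_loops
    proof (intro exI conjI ballI)
      let ?h = "\<lambda>z. slide x y (fst z) (p (snd z))"
      show "continuous_on ({0..1} \<times> {0..1}) ?h"
      proof (rule continuous_on_coordinatewise_then_product)
        fix v
        have c: "continuous_on ({0..1} \<times> {0..1}) (\<lambda>z. p (snd z) w)" for w
          by (rule continuous_on_compose2[OF pc[of w] continuous_on_snd[OF continuous_on_id]]) auto
        show "continuous_on ({0..1} \<times> {0..1}) (\<lambda>z. ?h z v)"
          unfolding slide_def by (intro continuous_intros c)
      qed
      show "?h \<in> {0..1} \<times> {0..1} \<rightarrow> ?S" using slide pS by auto
      show "?h (0, t) = p t" for t by (auto simp: slide_def)
      show "?h (1, t) = (slide x y 1 \<circ> p) t" for t by simp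
      show "pathfinish (?h \<circ> Pair t) = pathstart (?h \<circ> Pair t)" for t
        using p(2) by (simp add: pathfinish_def pathstart_def)
    qed
    show "path (slide x y 1 \<circ> p)"
      unfolding path_def
    proof (rule continuous_on_coordinatewise_then_product)
      show "continuous_on {0..1} (\<lambda>t. (slide x y 1 \<circ> p) t v)" for v
        unfolding slide_def o_def by (intro continuous_intros pc)
    qed
    show "path_image (slide x y 1 \<circ> p) \<subseteq> ?S'"
      using slide[OF pS, of _ 1] by (auto simp: path_image_def)
  qed
  show ?thesis
    unfolding simply_connected_def
  proof (intro allI impI; elim conjE)
    fix p q assume p: "path p" "pathfinish p = pathstart p" "path_image p \<subseteq> ?S"
      and q: "path q" "pathfinish q = pathstart q" "path_image q \<subseteq> ?S"
    have "homotopic_loops ?S' (slide x y 1 \<circ> p) (slide x y 1 \<circ> q)"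
      using sc loop[OF p] loop[OF q] p(2) q(2) unfolding simply_connected_def
      by (simp add: pathfinish_def pathstart_def)
    then have "homotopic_loops ?S (slide x y 1 \<circ> p) (slide x y 1 \<circ> q)"
      using sub by (rule homotopic_loops_subset)
    then show "homotopic_loops ?S p q"
      using hom[OF p] hom[OF q] by (meson homotopic_loops_sym homotopic_loops_trans)
  qed
qed

lemma simply_connected_vertex: "simply_connected (realization_points {{x}})"
proof -
  have pt: "f = (\<lambda>v. if v = x then 1 else 0)" if "f \<in> realization_points {{x}}" for f
    using that by (auto simp: realization_points_def closed_simplex_def)
  show ?thesis
    unfolding simply_connected_def
  proof (intro allI impI; elim conjE)
    fix p q :: "real \<Rightarrow> 'a \<Rightarrow> real"
    assume p: "path p" "pathfinish p = pathstart p" "path_image p \<subseteq> realization_points {{x}}"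
      and q: "path_image q \<subseteq> realization_points {{x}}"
    have "p t = q t" if "t \<in> {0..1}" for t
    proof -
      have "p t \<in> realization_points {{x}}" "q t \<in> realization_points {{x}}"
        using p(3) q that by (auto simp: path_image_def)
      then show ?thesis using pt[of "p t"] pt[of "q t"] by simp
    qed
    then show "homotopic_loops (realization_points {{x}}) p q"
      using p by (intro homotopic_loops_eq) auto
  qed
qed

section \<open>Subdivisions after adding a vertex or a square\<close>

lemma square_subdivision_eq:
  "square_subdivision X = (\<lambda>v. {Inl v}) ` verts X \<union> (\<lambda>e. Inl ` e) ` edges X \<union> (\<lambda>C. {Inr C}) ` squares X \<union>
     (\<Union>C\<in>squares X. (\<lambda>v. {Inr C, Inl v}) ` \<Union>C) \<union> (\<Union>C\<in>squares X. (\<lambda>e. insert (Inr C) (Inl ` e)) ` C)"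
proof -
  have h: "{{Inl v} | v. v \<in> verts X} = (\<lambda>v. {Inl v}) ` verts X"
    "{Inl ` e | e. e \<in> edges X} = (\<lambda>e. Inl ` e) ` edges X"
    "{{Inr C} | C. C \<in> squares X} = (\<lambda>C. {Inr C}) ` squares X"
    "{insert (Inr C) (Inl ` e) | C e. C \<in> squares X \<and> e \<in> C} =
      (\<Union>C\<in>squares X. (\<lambda>e. insert (Inr C) (Inl ` e)) ` C)"
    by blast+
  have h': "{{Inr C, Inl v} | C v. C \<in> squares X \<and> v \<in> \<Union>C} = (\<Union>C\<in>squares X. (\<lambda>v. {Inr C, Inl v}) ` \<Union>C)"
    by (simp only: image_def) blast
  show ?thesis unfolding square_subdivision_def h h' by (rule refl)
qed

lemma square_subdivision_insert_square:
  "square_subdivision \<lparr>verts = V, edges = Ed, squares = insert C Q\<rparr> =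
     square_subdivision \<lparr>verts = V, edges = Ed, squares = Q\<rparr> \<union>
     {{Inr C}} \<union> (\<lambda>v. {Inr C, Inl v}) ` \<Union>C \<union> (\<lambda>e. insert (Inr C) (Inl ` e)) ` C"
  by (simp add: square_subdivision_eq Un_ac)

lemma square_subdivision_insert_vertex:
  "square_subdivision \<lparr>verts = insert t V, edges = Ed \<union> Ed', squares = Q\<rparr> =
     square_subdivision \<lparr>verts = V, edges = Ed, squares = Q\<rparr> \<union> {{Inl t}} \<union> (\<lambda>e. Inl ` e) ` Ed'"
  by (simp add: square_subdivision_eq image_Un Un_ac)

lemma square_subdivision_no_vertex:
  assumes "\<sigma> \<in> square_subdivision X" "t \<notin> verts X" "t \<notin> \<Union>(edges X)" "t \<notin> \<Union>(\<Union>(squares X))"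
  shows "Inl t \<notin> \<sigma>"
  using assms by (auto simp: square_subdivision_def)

lemma square_subdivision_no_centre:
  assumes "\<sigma> \<in> square_subdivision X" "C \<notin> squares X"
  shows "Inr C \<notin> \<sigma>"
  using assms by (auto simp: square_subdivision_def)

context systolic
begin

section \<open>Squares of down-closed subcomplexes\<close>

text \<open>The arguments are the top, the two sides and the bottom of the square.\<close>

definition Sq :: "'v \<Rightarrow> 'v \<Rightarrow> 'v \<Rightarrow> 'v \<Rightarrow> 'v set set" where
  "Sq t x x' u = {{t, x}, {x, u}, {u, x'}, {x', t}}"

definition diamond :: "'v \<Rightarrow> 'v \<Rightarrow> 'v \<Rightarrow> 'v \<Rightarrow> bool" where
  "diamond t x x' u \<longleftrightarrow> x \<noteq> x' \<and> E x t \<and> E x' t \<and> E u x \<and> E u x'"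

text \<open>The last condition excludes squares with two maximal vertices.\<close>

definition down_closed :: "'v set \<Rightarrow> bool" where
  "down_closed J \<longleftrightarrow> J \<subseteq> \<Union>Y \<and> b \<in> J \<and> (\<forall>x y. E x y \<longrightarrow> y \<in> J \<longrightarrow> x \<in> J) \<and>
     (\<forall>x y u u'. x \<in> J \<longrightarrow> y \<in> J \<longrightarrow> E u x \<longrightarrow> E u y \<longrightarrow> E u' x \<longrightarrow> E u' y \<longrightarrow> u \<noteq> u' \<longrightarrow> x = y)"

definition Ed :: "'v set \<Rightarrow> 'v set set" where
  "Ed J = {{x, y} | x y. E x y \<and> y \<in> J}"

definition Qs :: "'v set \<Rightarrow> 'v set set set" where
  "Qs J = {Sq t x x' u | t x x' u. diamond t x x' u \<and> t \<in> J}"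

lemma Ed_insert: "Ed (insert t J) = Ed J \<union> (\<lambda>x. {x, t}) ` {x. E x t}"
  unfolding Ed_def by blast

lemma Sq_sym: "Sq t x x' u = Sq t x' x u"
  by (auto simp: Sq_def insert_commute)

lemma diamond_sym: "diamond t x x' u \<Longrightarrow> diamond t x' x u"
  by (auto simp: diamond_def)

lemma E_asym: "E x y \<Longrightarrow> \<not> E y x"
  using E_lvl[of x y] E_lvl[of y x] by auto

lemma E_iff_lvl:
  assumes "E x y \<or> E y x"
  shows "E x y \<longleftrightarrow> lvl y = Suc (lvl x)" "E y x \<longleftrightarrow> lvl x = Suc (lvl y)"
proof -
  have "\<not> (lvl y = Suc (lvl x) \<and> lvl x = Suc (lvl y))" by linarith
  then show "E x y \<longleftrightarrow> lvl y = Suc (lvl x)" "E y x \<longleftrightarrow> lvl x = Suc (lvl y)"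
    using assms E_lvl by blast+
qed

lemma E_neq: "E x y \<Longrightarrow> x \<noteq> y"
  by (auto dest: E_lvl)

lemma diamond_distinct:
  assumes "diamond t x x' u"
  shows "distinct [t, x, u, x']"
proof -
  have "lvl t = Suc (lvl x)" "lvl t = Suc (lvl x')" "lvl x = Suc (lvl u)" "lvl x' = Suc (lvl u)"
    using assms E_lvl by (auto simp: diamond_def)
  then show ?thesis using assms by (auto simp: diamond_def)
qed

lemma diamond_unique_bottom:
  assumes "diamond t x x' u" "diamond t x x' u'"
  shows "u = u'"
proof -
  have "A x x'" using E_E_triangle[of x t x'] T_A(1) assms by (auto simp: diamond_def)
  moreover have "lvl x = lvl x'" using assms by (auto simp: diamond_def dest!: E_lvl)
  ultimately show ?thesis using horizontal_unique assms by (auto simp: diamond_def)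
qed

lemma diamond_exists:
  assumes "E x t" "E x' t" "x \<noteq> x'"
  obtains u where "diamond t x x' u"
proof -
  have "A x x'" using E_E_triangle[OF assms] T_A(1) by blast
  moreover have "lvl x = lvl x'" using assms E_lvl by (metis nat.inject)
  ultimately show thesis using horizontal_triangle that assms by (metis diamond_def)
qed

text \<open>The sides are the only lower neighbours of the top, and the bottom is the apex below the
  edge joining them. Hence the removal of a top vertex destroys only one square.\<close>

lemma diamond_top_unique:
  assumes "diamond t x x' u" "diamond t y y' w"
  shows "Sq t x x' u = Sq t y y' w"
proof -
  have "y = x \<and> y' = x' \<or> y = x' \<and> y' = x"
    using assms E_at_most_two unfolding diamond_def by metis
  then show ?thesis using assms diamond_unique_bottom diamond_sym Sq_sym by metis
qed

lemma edge_squaring_graph: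
  assumes lvl: "\<And>y. y \<in> \<Union>Y \<Longrightarrow> gdist (one_skeleton Y) b y = enat (lvl y)"
  shows "edges (squaring_graph Y b) = {{x, y} | x y. E x y}"
proof -
  have "A x y \<and> gdist (one_skeleton Y) b x \<noteq> gdist (one_skeleton Y) b y \<longleftrightarrow> E x y \<or> E y x" for x y
  proof (cases "A x y")
    case True
    have "gdist (one_skeleton Y) b x \<noteq> gdist (one_skeleton Y) b y \<longleftrightarrow> lvl x \<noteq> lvl y"
      by (simp only: lvl[OF A_vertex(1)[OF True]] lvl[OF A_vertex(2)[OF True]] enat.inject)
    moreover have "lvl y = Suc (lvl x) \<or> lvl x = Suc (lvl y) \<longleftrightarrow> lvl x \<noteq> lvl y"
      using A_lvl[OF True] A_lvl[OF A_sym[OF True]] by linarith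
    ultimately show ?thesis using True A_sym[OF True] by (simp only: E_def) blast
  next
    case False
    then show ?thesis using A_sym by (auto simp: E_def)
  qed
  then show ?thesis
    unfolding squaring_graph_def by (auto simp: edge_one_skeleton)
qed

section \<open>Four-cycles of the squaring\<close>

lemma cycle_edges_4: "cycle_edges [p, q, r, s] = {{p, q}, {q, r}, {r, s}, {s, p}}"
proof -
  have "cycle_edges [p, q, r, s] = (\<lambda>i. {[p, q, r, s] ! i, [p, q, r, s] ! (Suc i mod 4)}) ` {..<4}"
    by (auto simp: cycle_edges_def)
  also have "{..<4} = {0, 1, 2, 3 :: nat}" by auto
  finally show ?thesis by simp
qed

lemma four_cyclesE:
  assumes "C \<in> four_cycles G"
  obtains p q r s where "distinct [p, q, r, s]" "{p, q, r, s} \<subseteq> verts G"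
    "C = {{p, q}, {q, r}, {r, s}, {s, p}}" "C \<subseteq> edges G"
proof -
  obtain c where c: "C = cycle_edges c" "embedded_cycle G c" "length c = 4"
    using assms by (auto simp: four_cycles_def)
  obtain p q r s where "c = [p, q, r, s]"
    using c(3) by (auto simp: length_Suc_conv numeral_eq_Suc)
  with c show thesis by (intro that) (simp_all add: embedded_cycle_def cycle_edges_4)
qed

lemma four_cyclesI:
  assumes "distinct [p, q, r, s]" "{p, q, r, s} \<subseteq> verts G" "{{p, q}, {q, r}, {r, s}, {s, p}} \<subseteq> edges G"
  shows "{{p, q}, {q, r}, {r, s}, {s, p}} \<in> four_cycles G"
proof -
  have "embedded_cycle G [p, q, r, s]" using assms by (simp add: embedded_cycle_def cycle_edges_4)
  then show ?thesis unfolding four_cycles_def cycle_edges_4[symmetric] by force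
qed

lemma edge_E_iff: "{x, y} \<in> {{x, y} | x y. E x y} \<longleftrightarrow> E x y \<or> E y x"
  by (auto simp: doubleton_eq_iff)

text \<open>If \<open>p\<close> and \<open>r\<close> are two levels apart, \<open>q\<close> and
  \<open>s\<close> both lie between them. If they are on the same level, one of \<open>q\<close> and
  \<open>s\<close> is above and the other below, since otherwise two vertices of \<open>J\<close>
  would have the same two lower neighbours. Either way there is a single top.\<close>

lemma four_cycle_diamond:
  assumes J: "down_closed J" and sub: "{p, q, r, s} \<subseteq> J" and d: "distinct [p, q, r, s]"
    and e: "E p q \<or> E q p" "E q r \<or> E r q" "E r s \<or> E s r" "E s p \<or> E p s"
  shows "{{p, q}, {q, r}, {r, s}, {s, p}} \<in> Qs J"
proof -
  have thin: "x = y" if "x \<in> J" "y \<in> J" "E u x" "E u y" "E u' x" "E u' y" "u \<noteq> u'" for x y u u'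
    using J that unfolding down_closed_def by blast
  have Q: "Sq t x x' u \<in> Qs J" if "diamond t x x' u" "t \<in> J" for t x x' u
    using that by (auto simp: Qs_def)
  have top: "E q p \<and> E r q \<and> E r s \<and> E s p \<Longrightarrow> Sq p q s r \<in> Qs J"
    "E r q \<and> E s r \<and> E s p \<and> E p q \<Longrightarrow> Sq q r p s \<in> Qs J"
    "E s r \<and> E p s \<and> E p q \<and> E q r \<Longrightarrow> Sq r s q p \<in> Qs J"
    "E p s \<and> E q p \<and> E q r \<and> E r s \<Longrightarrow> Sq s p r q \<in> Qs J"
    using sub d by (auto intro!: Q simp: diamond_def)
  have rot: "Sq p q s r = {{p, q}, {q, r}, {r, s}, {s, p}}" "Sq q r p s = {{p, q}, {q, r}, {r, s}, {s, p}}"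
    "Sq r s q p = {{p, q}, {q, r}, {r, s}, {s, p}}" "Sq s p r q = {{p, q}, {q, r}, {r, s}, {s, p}}"
    unfolding Sq_def by auto
  have no: "\<not> (E p q \<and> E r q \<and> E r s \<and> E p s)" "\<not> (E q p \<and> E q r \<and> E s r \<and> E s p)"
    using thin[of q s p r] thin[of p r q s] sub d by auto
  have "E q p \<and> E r q \<and> E r s \<and> E s p \<or> E r q \<and> E s r \<and> E s p \<and> E p q \<or>
      E s r \<and> E p s \<and> E p q \<and> E q r \<or> E p s \<and> E q p \<and> E q r \<and> E r s"
  proof -
    have between: "E x y \<and> E y z" if "E x w" "E w z" "E z y \<or> E y z" "E y x \<or> E x y" for x y z w
    proof -
      have "lvl z = Suc (Suc (lvl x))" using that(1,2) E_lvl by simp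
      moreover have "lvl y = Suc (lvl z) \<or> lvl z = Suc (lvl y)" "lvl x = Suc (lvl y) \<or> lvl y = Suc (lvl x)"
        using that(3,4) E_lvl by blast+
      ultimately show ?thesis
        using E_iff_lvl[OF that(3)] E_iff_lvl[OF that(4)] by linarith
    qed
    have same: "(E w x \<longrightarrow> E w y) \<and> (E x w \<longrightarrow> E y w)"
      if "lvl x = lvl y" "E x w \<or> E w x" "E y w \<or> E w y" for x y w
      using E_iff_lvl[OF that(2)] E_iff_lvl[OF that(3)] that(1) by simp
    consider "E p q" "E q r" | "E q p" "E r q" | "E p q" "E r q" | "E q p" "E q r" using e by blast
    then show ?thesis
    proof cases
      case 1
      then show ?thesis using between[of p q r s] e by blast
    next
      case 2
      then show ?thesis using between[of r q p s] e by blast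
    next
      case 3
      then have "lvl p = lvl r" using E_lvl by (metis nat.inject)
      then show ?thesis using 3 same[of p r s] e no by blast
    next
      case 4
      then have "lvl p = lvl r" using E_lvl by metis
      then show ?thesis using 4 same[of p r s] e no by blast
    qed
  qed
  then show ?thesis using top unfolding rot by blast
qed

lemma diamond_Sq_four_cycle:
  assumes "diamond t x x' u" "{t, x, x', u} \<subseteq> verts G" "Sq t x x' u \<subseteq> edges G"
  shows "Sq t x x' u \<in> four_cycles G"
  using assms diamond_distinct[OF assms(1)] unfolding Sq_def by (intro four_cyclesI) simp_all

lemma down_closedD:
  assumes "down_closed J"
  shows "J \<subseteq> \<Union>Y" "b \<in> J" "\<And>x y. E x y \<Longrightarrow> y \<in> J \<Longrightarrow> x \<in> J"
    "\<And>x y u u'. x \<in> J \<Longrightarrow> y \<in> J \<Longrightarrow> E u x \<Longrightarrow> E u y \<Longrightarrow> E u' x \<Longrightarrow> E u' y \<Longrightarrow> u \<noteq> u' \<Longrightarrow> x = y"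
proof -
  show "J \<subseteq> \<Union>Y" "b \<in> J" using assms unfolding down_closed_def by simp_all
  show "\<And>x y. E x y \<Longrightarrow> y \<in> J \<Longrightarrow> x \<in> J" using assms unfolding down_closed_def by meson
  show "\<And>x y u u'. x \<in> J \<Longrightarrow> y \<in> J \<Longrightarrow> E u x \<Longrightarrow> E u y \<Longrightarrow> E u' x \<Longrightarrow> E u' y \<Longrightarrow> u \<noteq> u' \<Longrightarrow> x = y"
    using assms unfolding down_closed_def by simp
qed

lemma diamond_subset:
  assumes "down_closed J" "diamond t x x' u" "t \<in> J"
  shows "{t, x, x', u} \<subseteq> J"
  using assms down_closedD(3)[OF assms(1)] by (auto simp: diamond_def)

text \<open>All 4-cycles inside \<open>J\<close> are diamonds by \<open>four_cycle_diamond\<close>;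
  conversely a diamond with its top in \<open>J\<close> lies in \<open>J\<close> entirely, because
  \<open>J\<close> is closed downwards.\<close>

lemma full_subcomplex_squaring:
  assumes lvl: "\<And>y. y \<in> \<Union>Y \<Longrightarrow> gdist (one_skeleton Y) b y = enat (lvl y)" and J: "down_closed J"
  shows "full_subcomplex (squaring Y b) J = \<lparr>verts = J, edges = Ed J, squares = Qs J\<rparr>"
proof -
  have e: "edges (squaring_graph Y b) = {{x, y} | x y. E x y}" using lvl by (rule edge_squaring_graph)
  have v: "verts (squaring_graph Y b) = \<Union>Y" by (simp add: squaring_graph_def one_skeleton_def)
  have "{e \<in> edges (squaring_graph Y b). e \<subseteq> J} = Ed J"
  proof (intro equalityI subsetI)
    fix d assume "d \<in> {e \<in> edges (squaring_graph Y b). e \<subseteq> J}"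
    then obtain x y where "d = {x, y}" "E x y" "d \<subseteq> J" unfolding e by blast
    then show "d \<in> Ed J" unfolding Ed_def by blast
  next
    fix d assume "d \<in> Ed J"
    then obtain x y where "d = {x, y}" "E x y" "y \<in> J" unfolding Ed_def by blast
    moreover from this have "x \<in> J" using down_closedD(3)[OF J] by simp
    ultimately show "d \<in> {e \<in> edges (squaring_graph Y b). e \<subseteq> J}" unfolding e by blast
  qed
  moreover have "{C \<in> four_cycles (squaring_graph Y b). \<Union>C \<subseteq> J} = Qs J"
  proof (intro equalityI subsetI)
    fix C assume "C \<in> {C \<in> four_cycles (squaring_graph Y b). \<Union>C \<subseteq> J}"
    then have C: "C \<in> four_cycles (squaring_graph Y b)" "\<Union>C \<subseteq> J" by auto
    obtain p q r s where c: "distinct [p, q, r, s]" "C = {{p, q}, {q, r}, {r, s}, {s, p}}"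
      "C \<subseteq> edges (squaring_graph Y b)" using C(1) by (rule four_cyclesE)
    have "C \<subseteq> {{x, y} | x y. E x y}" using c(3) unfolding e .
    with c(2) have "{p, q} \<in> {{x, y} | x y. E x y}" "{q, r} \<in> {{x, y} | x y. E x y}"
      "{r, s} \<in> {{x, y} | x y. E x y}" "{s, p} \<in> {{x, y} | x y. E x y}" by auto
    then have "E p q \<or> E q p" "E q r \<or> E r q" "E r s \<or> E s r" "E s p \<or> E p s"
      unfolding edge_E_iff by auto
    moreover have "{p, q, r, s} \<subseteq> J" using C(2) c(2) by auto
    ultimately show "C \<in> Qs J" using four_cycle_diamond[OF J _ c(1)] c(2) by simp
  next
    fix C assume "C \<in> Qs J"
    then obtain t x x' u where d: "diamond t x x' u" "t \<in> J" and C: "C = Sq t x x' u"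
      by (auto simp: Qs_def)
    have sub: "{t, x, x', u} \<subseteq> J" using diamond_subset[OF J d] .
    moreover have "Sq t x x' u \<subseteq> {{x, y} | x y. E x y}"
      using d(1) edge_E_iff by (auto simp: diamond_def Sq_def)
    ultimately have "C \<in> four_cycles (squaring_graph Y b)"
      unfolding C using down_closedD(1)[OF J] v e by (intro diamond_Sq_four_cycle d(1)) auto
    moreover have "\<Union>C \<subseteq> J" using sub by (auto simp: C Sq_def)
    ultimately show "C \<in> {C \<in> four_cycles (squaring_graph Y b). \<Union>C \<subseteq> J}" by simp
  qed
  ultimately show ?thesis
    using down_closedD(1)[OF J] by (auto simp: full_subcomplex_def squaring_def v)
qed

lemma square_complex_diamonds:
  assumes J: "down_closed J"
  shows "square_complex \<lparr>verts = J, edges = Ed J, squares = Qs J\<rparr>"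
proof -
  have "simplicial_graph \<lparr>verts = J, edges = Ed J, squares = Qs J\<rparr>"
    using down_closedD(3)[OF J] E_neq by (fastforce simp: simplicial_graph_def Ed_def card_2_iff)
  moreover have "C \<in> four_cycles \<lparr>verts = J, edges = Ed J, squares = Qs J\<rparr>" if C: "C \<in> Qs J" for C
  proof -
    obtain t x x' u where d: "diamond t x x' u" "t \<in> J" and C: "C = Sq t x x' u"
      using C by (auto simp: Qs_def)
    have sub: "{t, x, x', u} \<subseteq> J" using diamond_subset[OF J d] .
    have Ed: "{p, q} \<in> Ed J" "{q, p} \<in> Ed J" if "E p q" "q \<in> J" for p q
      using that by (auto simp: Ed_def doubleton_eq_iff)
    have "Sq t x x' u \<subseteq> Ed J"
      using d sub Ed by (auto simp: Sq_def diamond_def)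
    then show ?thesis
      unfolding C using sub by (intro diamond_Sq_four_cycle d(1)) auto
  qed
  ultimately show ?thesis by (auto simp: square_complex_def)
qed

section \<open>Collapse to the base vertex\<close>

abbreviation K :: "'v set \<Rightarrow> ('v + 'v set set) set set" where
  "K J \<equiv> square_subdivision \<lparr>verts = J, edges = Ed J, squares = Qs J\<rparr>"

lemma K_no_vertex:
  assumes "down_closed J" "t \<notin> J" "\<sigma> \<in> K J"
  shows "Inl t \<notin> \<sigma>"
proof (rule square_subdivision_no_vertex[OF assms(3)])
  show "t \<notin> \<Union>(edges \<lparr>verts = J, edges = Ed J, squares = Qs J\<rparr>)"
    using assms(2) down_closedD(3)[OF assms(1)] by (auto simp: Ed_def)
  have "t \<notin> \<Union>C" if "C \<in> Qs J" for C
    using that assms(2) diamond_subset[OF assms(1)] by (fastforce simp: Qs_def Sq_def)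
  then show "t \<notin> \<Union>(\<Union>(squares \<lparr>verts = J, edges = Ed J, squares = Qs J\<rparr>))" by auto
qed (use assms in simp)

text \<open>A vertex of maximal level either hangs on a single edge or is the top of exactly one
  square, so the complex deforms onto the one without it. The finiteness claims are carried along
  for \<open>simply_connected_dominated\<close> and \<open>realization_finite\<close>.\<close>

lemma K_simply_connected:
  assumes "finite J" "down_closed J"
  shows "finite (K J) \<and> (\<forall>\<sigma>\<in>K J. finite \<sigma>) \<and> simply_connected (realization_points (K J))"
  using assms
proof (induction J rule: finite_psubset_induct)
  case (psubset J)
  note J = psubset.prems
  show ?case
  proof (cases "J = {b}")
    case True
    have nE: "\<not> E x b" for x using E_lvl[of x b] by auto
    have "K J = {{Inl b}}"
      unfolding True square_subdivision_def Ed_def Qs_def diamond_def using nE by simp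
    then show ?thesis using simply_connected_vertex by simp
  next
    case False
    \<comment> \<open>No vertex of \<open>J\<close> lies above one of maximal level, so removing it
      leaves a down-closed set.\<close>
    define n where "n = Max (lvl ` J)"
    have "n \<in> lvl ` J" unfolding n_def
      using psubset.hyps down_closedD(2)[OF J] by (intro Max_in) auto
    then obtain t where t: "t \<in> J" "lvl t = n" by blast
    have max: "lvl y \<le> lvl t" if "y \<in> J" for y
      unfolding t(2) n_def using psubset.hyps that by simp
    have tb: "t \<noteq> b"
    proof
      assume "t = b"
      then have "y = b" if "y \<in> J" for y
        using max[OF that] lvl_0[of y] down_closedD(1)[OF J] that by auto
      then show False using False down_closedD(2)[OF J] by blast
    qed
    define J' where "J' = J - {t}"
    have JJ': "J = insert t J'" "t \<notin> J'" using t by (auto simp: J'_def)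
    have nE: "\<not> E t y" if "y \<in> J" for y using max[OF that] E_lvl[of t y] by auto
    have J': "down_closed J'"
      unfolding down_closed_def
    proof (intro conjI allI impI)
      show "J' \<subseteq> \<Union>Y" "b \<in> J'" using down_closedD(1,2)[OF J] tb by (auto simp: J'_def)
      show "x \<in> J'" if "E x y" "y \<in> J'" for x y
        using that nE down_closedD(3)[OF J] by (auto simp: J'_def)
      show "x = y" if "x \<in> J'" "y \<in> J'" "E u x" "E u y" "E u' x" "E u' y" "u \<noteq> u'" for x y u u'
        using down_closedD(4)[OF J] that by (auto simp: J'_def)
    qed
    have "J' \<subset> J" using t by (auto simp: J'_def)
    from psubset.IH[OF this J'] have fin: "finite (K J')" "\<And>\<sigma>. \<sigma> \<in> K J' \<Longrightarrow> finite \<sigma>"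
      and sc: "simply_connected (realization_points (K J'))" by auto
    have not: "Inl t \<notin> \<sigma>" if "\<sigma> \<in> K J'" for \<sigma>
      using K_no_vertex[OF J' JJ'(2) that] .
    have tY: "t \<in> \<Union>Y" using down_closedD(1)[OF J] t by blast
    then obtain x where x: "E x t" using E_exists tb by metis
    have xJ: "x \<in> J'" using down_closedD(3)[OF J x t(1)] E_neq[OF x] by (simp add: J'_def)
    have vert: "{Inl w} \<in> K J'" if "w \<in> J'" for w
      using that by (auto simp: square_subdivision_def)
    show ?thesis
    proof (cases "\<exists>x'. E x' t \<and> x' \<noteq> x")
      case False
      have "{x. E x t} = {x}" using False x by blast
      then have "Ed J = Ed J' \<union> {{x, t}}" unfolding JJ'(1) Ed_insert by simp
      moreover have "\<not> diamond t y y' w" for y y' w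
        using False by (metis diamond_def)
      then have "Qs J = Qs J'" unfolding Qs_def JJ'(1) by blast
      ultimately have KJ: "K J = K J' \<union> {{Inl t}, {Inl x, Inl t}}"
        using square_subdivision_insert_vertex[of t J' "Ed J'" "{{x, t}}" "Qs J'"] JJ'(1) by auto
      have K1: "{\<sigma> \<in> K J. Inl t \<notin> \<sigma>} = K J'" unfolding KJ using not by auto
      have dom: "insert (Inl x) \<sigma> \<in> K J \<and> insert (Inl x) (\<sigma> - {Inl t}) \<in> K J"
        if "\<sigma> \<in> K J" "Inl t \<in> \<sigma>" for \<sigma>
        using that not vert[OF xJ] E_neq[OF x] unfolding KJ by (auto simp: insert_Diff_if)
      have finJ: "finite (K J)" "\<And>\<sigma>. \<sigma> \<in> K J \<Longrightarrow> finite \<sigma>" using fin unfolding KJ by auto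
      have "simply_connected (realization_points (K J))"
      proof (rule simply_connected_dominated[OF finJ(2) _ dom])
        show "Inl t \<noteq> Inl x" using E_neq[OF x] by simp
        show "simply_connected (realization_points {\<sigma> \<in> K J. Inl t \<notin> \<sigma>})" unfolding K1 by (rule sc)
      qed
      then show ?thesis using finJ by blast
    next
      case True
      then obtain x' where x': "E x' t" "x \<noteq> x'" by blast
      have x'J: "x' \<in> J'" using down_closedD(3)[OF J x'(1) t(1)] E_neq[OF x'(1)] by (simp add: J'_def)
      obtain u where d: "diamond t x x' u" using diamond_exists[OF x x'] by blast
      have u: "E u x" "E u x'" "u \<in> J'" using d down_closedD(3)[OF J' _ xJ] by (auto simp: diamond_def)
      have dist: "distinct [t, x, u, x']" using diamond_distinct[OF d] .
      define C where "C = Sq t x x' u"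
      have C_edges: "C = {{t, x}, {x, u}, {u, x'}, {x', t}}" by (simp add: C_def Sq_def)
      then have C_verts: "\<Union>C = {t, x, u, x'}" by auto
      have "{x. E x t} = {x, x'}" using E_at_most_two[OF x x'(1) _ x'(2)] x x' by blast
      then have "Ed J = Ed J' \<union> {{x, t}, {x', t}}" unfolding JJ'(1) Ed_insert by simp
      moreover have "Qs J = insert C (Qs J')"
      proof -
        have "Qs J = {Sq t x x' u | x x' u. diamond t x x' u} \<union> Qs J'"
          unfolding Qs_def JJ'(1) by blast
        also have "{Sq t x x' u | x x' u. diamond t x x' u} = {C}"
          unfolding C_def using d diamond_top_unique[OF _ d] by blast
        finally show ?thesis by simp
      qed
      ultimately have KJ: "K J = K J' \<union> {{Inr C}, {Inr C, Inl x}, {Inr C, Inl x'}, {Inr C, Inl u},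
          {Inr C, Inl x, Inl u}, {Inr C, Inl u, Inl x'}, {Inl t}, {Inl x, Inl t}, {Inl x', Inl t},
          {Inr C, Inl t}, {Inr C, Inl t, Inl x}, {Inr C, Inl x', Inl t}}"
        using square_subdivision_insert_vertex[of t J' "Ed J'" "{{x, t}, {x', t}}" "insert C (Qs J')"]
          square_subdivision_insert_square[of J' "Ed J'" C "Qs J'"] JJ'(1)
        by (simp add: C_verts) (simp add: C_edges insert_commute Un_commute Un_left_commute)
      have "C \<notin> Qs J'"
      proof
        assume "C \<in> Qs J'"
        then obtain y z z' w where "diamond y z z' w" "y \<in> J'" "C = Sq y z z' w"
          by (auto simp: Qs_def)
        moreover from this have "\<Union>C \<subseteq> J'" using diamond_subset[OF J'] by (fastforce simp: Sq_def)
        ultimately show False using C_verts JJ'(2) by simp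
      qed
      then have notC: "Inr C \<notin> \<sigma>" if "\<sigma> \<in> K J'" for \<sigma>
        using square_subdivision_no_centre[OF that] by simp
      define N1 :: "('v + 'v set set) set set" where "N1 = {{Inr C}, {Inr C, Inl x}, {Inr C, Inl x'},
          {Inr C, Inl u}, {Inr C, Inl x, Inl u}, {Inr C, Inl u, Inl x'}}"
      define N2 :: "('v + 'v set set) set set" where "N2 = {{Inl t}, {Inl x, Inl t}, {Inl x', Inl t},
          {Inr C, Inl t}, {Inr C, Inl t, Inl x}, {Inr C, Inl x', Inl t}}"
      have KJ12: "K J = K J' \<union> N1 \<union> N2" unfolding KJ N1_def N2_def
        by (simp only: Un_assoc Un_insert_left Un_empty_left)
      have N1: "\<forall>\<sigma>\<in>N1. Inl t \<notin> \<sigma> \<and> Inr C \<in> \<sigma>" using dist by (simp add: N1_def)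
      have N2: "\<forall>\<sigma>\<in>N2. Inl t \<in> \<sigma>" by (simp add: N2_def)
      have K1: "{\<sigma> \<in> K J. Inl t \<notin> \<sigma>} = K J' \<union> N1"
        unfolding KJ12 using not N1 N2 by blast
      have K2: "{\<sigma> \<in> {\<sigma> \<in> K J. Inl t \<notin> \<sigma>}. Inr C \<notin> \<sigma>} = K J'"
        unfolding K1 using notC N1 by blast
      have edge: "{Inl x, Inl u} \<in> K J'" "{Inl u, Inl x} \<in> K J'" "{Inl u, Inl x'} \<in> K J'"
      proof -
        have "Inl ` e \<in> K J'" if "e \<in> Ed J'" for e using that by (simp add: square_subdivision_eq)
        moreover have "{u, x} \<in> Ed J'" "{u, x'} \<in> Ed J'" using u xJ x'J unfolding Ed_def by blast+
        ultimately have "Inl ` {u, x} \<in> K J'" "Inl ` {u, x'} \<in> K J'" by blast+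
        then show "{Inl x, Inl u} \<in> K J'" "{Inl u, Inl x} \<in> K J'" "{Inl u, Inl x'} \<in> K J'"
          by (simp_all add: insert_commute)
      qed
      have finJ: "finite (K J)" "\<And>\<sigma>. \<sigma> \<in> K J \<Longrightarrow> finite \<sigma>"
        using fin unfolding KJ by auto
      \<comment> \<open>Once \<open>t\<close> is gone, the centre of the square lies only in the
        triangles over the edges \<open>x u\<close> and \<open>u x'\<close> and in their faces. Both
        triangles contain \<open>u\<close>, to which the centre can be pushed.\<close>
      have "simply_connected (realization_points {\<sigma> \<in> K J. Inl t \<notin> \<sigma>})"
      proof (rule simply_connected_dominated[of _ "Inr C" "Inl u"])
        show "simply_connected (realization_points {\<sigma> \<in> {\<sigma> \<in> K J. Inl t \<notin> \<sigma>}. Inr C \<notin> \<sigma>})"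
          unfolding K2 by (rule sc)
        show "insert (Inl u) \<sigma> \<in> {\<sigma> \<in> K J. Inl t \<notin> \<sigma>} \<and>
            insert (Inl u) (\<sigma> - {Inr C}) \<in> {\<sigma> \<in> K J. Inl t \<notin> \<sigma>}"
          if "\<sigma> \<in> {\<sigma> \<in> K J. Inl t \<notin> \<sigma>}" "Inr C \<in> \<sigma>" for \<sigma>
        proof -
          have "\<sigma> \<in> N1" using that notC unfolding K1 by blast
          then have "insert (Inl u) \<sigma> \<in> N1 \<and> insert (Inl u) (\<sigma> - {Inr C}) \<in> K J'"
            unfolding N1_def using edge vert[OF u(3)]
            by (elim insertE) (simp_all add: insert_commute insert_Diff_if)
          then show ?thesis unfolding K1 by blast
        qed
      qed (use finJ in auto)
      \<comment> \<open>The triangles at \<open>t\<close> are spanned by the centre and the edges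
        \<open>t x\<close> and \<open>x' t\<close>; both contain the centre, to which
        \<open>t\<close> is pushed.\<close>
      then have "simply_connected (realization_points (K J))"
      proof (intro simply_connected_dominated[of "K J" "Inl t" "Inr C"])
        show "insert (Inr C) \<sigma> \<in> K J \<and> insert (Inr C) (\<sigma> - {Inl t}) \<in> K J"
          if "\<sigma> \<in> K J" "Inl t \<in> \<sigma>" for \<sigma>
        proof -
          have "\<sigma> \<in> N2" using that not N1 unfolding KJ12 by blast
          then have "insert (Inr C) \<sigma> \<in> N2 \<and> insert (Inr C) (\<sigma> - {Inl t}) \<in> N1"
            unfolding N2_def N1_def using dist
            by (elim insertE) (simp_all add: insert_commute insert_Diff_if)
          then show ?thesis unfolding KJ12 by blast
        qed
      qed (use finJ in auto)
      then show ?thesis using finJ by blast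
    qed
  qed
qed

end

section \<open>Distances and intervals\<close>

text \<open>The value of \<open>f\<close> is bounded from both ends of the walk. On a walk with as
  many steps as \<open>f\<close> increases, the two bounds meet and fix \<open>f\<close> at every
  vertex.\<close>

lemma walk_level:
  assumes f: "\<And>x y. {x, y} \<in> edges G \<Longrightarrow> f y \<le> Suc (f x)" and p: "walk G u p v" and i: "i < length p"
  shows "f (p ! i) \<le> f u + i" "f v \<le> f (p ! i) + (length p - Suc i)"
proof -
  have e: "{p ! j, p ! Suc j} \<in> edges G" if "Suc j < length p" for j using p that by (simp add: walk_def)
  have ends: "p ! 0 = u" "p ! (length p - 1) = v"
    using p by (auto simp: walk_def hd_conv_nth last_conv_nth)
  show "f (p ! i) \<le> f u + i"
    using i
  proof (induction i)
    case 0
    then show ?case using ends by simp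
  next
    case (Suc i)
    then show ?case using f[OF e[of i]] by simp
  qed
  have "i \<le> length p - 1" using i by simp
  then show "f v \<le> f (p ! i) + (length p - Suc i)"
  proof (induction i rule: inc_induct)
    case base
    then show ?case using ends by simp
  next
    case (step j)
    then have "f (p ! Suc j) \<le> Suc (f (p ! j))" using f[OF e[of j]] by simp
    then show ?case using step by simp
  qed
qed

text \<open>The inclusion of \<open>set p\<close> in \<open>set q\<close> is kept so that a walk
  through a vertex of the interval can be prolonged to one that still passes through it.\<close>

lemma walk_extend:
  assumes R: "\<And>x y. R x y \<Longrightarrow> {x, y} \<in> edges G \<and> y \<in> verts G \<and> f y = Suc (f x)"
    and xy: "R\<^sup>*\<^sup>* x y" and p: "walk G u p x"
  shows "\<exists>q. walk G u q y \<and> set p \<subseteq> set q \<and> length q + f x = length p + f y"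
  using xy
proof (induction rule: rtranclp_induct)
  case base
  then show ?case using p by blast
next
  case (step y z)
  then obtain q where q: "walk G u q y" "set p \<subseteq> set q" "length q + f x = length p + f y" by blast
  have yz: "{y, z} \<in> edges G" "z \<in> verts G" "f z = Suc (f y)" using R step by blast+
  have "{(q @ [z]) ! i, (q @ [z]) ! Suc i} \<in> edges G" if i: "Suc i < length (q @ [z])" for i
  proof (cases "Suc i < length q")
    case True
    then show ?thesis using q(1) by (simp add: walk_def nth_append)
  next
    case False
    then have "Suc i = length q" "q \<noteq> []" using i q(1) by (auto simp: walk_def)
    moreover from this have "q ! i = y" using q(1) by (metis diff_Suc_1 last_conv_nth walk_def)
    ultimately show ?thesis using yz by (simp add: nth_append)
  qed
  then have "walk G u (q @ [z]) z" using q(1) yz(2) by (auto simp: walk_def)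
  then show ?case using q yz by (intro exI[of _ "q @ [z]"]) auto
qed

text \<open>Applied with \<open>f = lvl\<close> both to the 1-skeleton of \<open>Y\<close> and to
  the squaring: deleting the horizontal edges does not change distances from
  \<open>b\<close>.\<close>

lemma gdist_graded:
  assumes f: "\<And>x y. {x, y} \<in> edges G \<Longrightarrow> f y \<le> Suc (f x)"
    and R: "\<And>x y. R x y \<Longrightarrow> {x, y} \<in> edges G \<and> y \<in> verts G \<and> f y = Suc (f x)"
    and u: "u \<in> verts G" "f u = 0" and v: "R\<^sup>*\<^sup>* u v"
  shows "gdist G u v = enat (f v)"
proof (rule antisym)
  have "walk G u [u] u" using u by (simp add: walk_def)
  from walk_extend[where f = f, OF R v this] obtain q where "walk G u q v" "length q = Suc (f v)"
    using u by auto
  then have "enat (f v) \<in> {enat (length p - 1) | p. walk G u p v}" by force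
  then show "gdist G u v \<le> enat (f v)" unfolding gdist_def by (rule Inf_lower)
  show "enat (f v) \<le> gdist G u v"
    unfolding gdist_def
  proof (rule Inf_greatest)
    fix n assume "n \<in> {enat (length p - 1) | p. walk G u p v}"
    then obtain p where p: "n = enat (length p - 1)" "walk G u p v" by blast
    then have "0 < length p" by (simp add: walk_def)
    then show "enat (f v) \<le> n"
      using walk_level(2)[where f = f, OF f p(2), of 0] walk_level(1)[where f = f, OF f p(2), of 0] u p(1) by simp
  qed
qed

context systolic
begin

lemma gdist_one_skeleton:
  assumes "y \<in> \<Union>Y"
  shows "gdist (one_skeleton Y) b y = enat (lvl y)"
proof (rule gdist_graded[where R = E])
  show "lvl y \<le> Suc (lvl x)" if "{x, y} \<in> edges (one_skeleton Y)" for x y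
    using that A_lvl by (simp add: edge_one_skeleton)
  show "{x, y} \<in> edges (one_skeleton Y) \<and> y \<in> verts (one_skeleton Y) \<and> lvl y = Suc (lvl x)"
    if "E x y" for x y
    using that E_A[OF that] E_lvl[OF that] A_vertex[OF E_A[OF that]]
    by (simp add: edge_one_skeleton) (simp add: one_skeleton_def)
  show "b \<in> verts (one_skeleton Y)" using base by (simp add: one_skeleton_def)
qed (use E_base assms in simp_all)

lemma edge_squaring: "{x, y} \<in> edges (squaring Y b) \<longleftrightarrow> E x y \<or> E y x"
proof -
  have "edges (squaring Y b) = {{x, y} | x y. E x y}"
    using edge_squaring_graph[OF gdist_one_skeleton] by (simp add: squaring_def)
  then show ?thesis using edge_E_iff by simp
qed

lemma verts_squaring: "verts (squaring Y b) = \<Union>Y"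
  by (simp add: squaring_def squaring_graph_def one_skeleton_def)

lemma edge_squaring_lvl: "{x, y} \<in> edges (squaring Y b) \<Longrightarrow> lvl y \<le> Suc (lvl x)"
  using E_lvl[of x y] E_lvl[of y x] by (auto simp: edge_squaring)

lemma E_squaring:
  assumes "E x y"
  shows "{x, y} \<in> edges (squaring Y b) \<and> y \<in> verts (squaring Y b) \<and> lvl y = Suc (lvl x)"
  using assms A_vertex[OF E_A[OF assms]] E_lvl[OF assms] by (simp add: edge_squaring verts_squaring)

lemma gdist_squaring:
  assumes "y \<in> \<Union>Y"
  shows "gdist (squaring Y b) b y = enat (lvl y)"
proof -
  have "b \<in> verts (squaring Y b)" unfolding verts_squaring by (rule base)
  with edge_squaring_lvl E_squaring show ?thesis
    using lvl_base E_base[OF assms] by (rule gdist_graded[where R = E])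
qed

text \<open>Geodesics from \<open>b\<close> are the paths ascending at every step, because the level
  gains at most one per step and has to gain the length of the path.\<close>

lemma interval_vertices:
  assumes v: "v \<in> \<Union>Y"
  shows "{w. \<exists>p. geodesic (squaring Y b) b p v \<and> w \<in> set p} = {w. E\<^sup>*\<^sup>* w v}"
proof (intro set_eqI iffI)
  fix w assume "w \<in> {w. \<exists>p. geodesic (squaring Y b) b p v \<and> w \<in> set p}"
  then obtain p where p: "walk (squaring Y b) b p v" "length p - 1 = lvl v" "w \<in> set p"
    using gdist_squaring[OF v] by (auto simp: geodesic_def)
  then have len: "length p = Suc (lvl v)" by (cases p) (auto simp: walk_def)
  have l: "lvl (p ! i) = i" if "i < length p" for i
    using walk_level[where f = lvl, OF edge_squaring_lvl p(1) that] len that by simp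
  have step: "E (p ! i) (p ! Suc i)" if "Suc i < length p" for i
  proof -
    have "E (p ! i) (p ! Suc i) \<or> E (p ! Suc i) (p ! i)"
      using p(1) that edge_squaring by (simp add: walk_def)
    then show ?thesis using l[of i] l[of "Suc i"] that E_lvl[of "p ! Suc i" "p ! i"] by auto
  qed
  have "p \<noteq> []" "last p = v" using p(1) by (simp_all add: walk_def)
  then have "p ! lvl v = v" using p(2) by (simp add: last_conv_nth)
  have "E\<^sup>*\<^sup>* (p ! i) v" if "i \<le> lvl v" for i
    using that
  proof (induction i rule: inc_induct)
    case base
    then show ?case using \<open>p ! lvl v = v\<close> by simp
  next
    case (step j)
    then show ?case using \<open>\<And>i. Suc i < length p \<Longrightarrow> E (p ! i) (p ! Suc i)\<close>[of j] len
      by (simp add: converse_rtranclp_into_rtranclp)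
  qed
  moreover obtain i where "i < length p" "w = p ! i" using p(3) by (auto simp: in_set_conv_nth)
  ultimately show "w \<in> {w. E\<^sup>*\<^sup>* w v}" using len by simp
next
  fix w assume "w \<in> {w. E\<^sup>*\<^sup>* w v}"
  then have w: "E\<^sup>*\<^sup>* w v" by simp
  then have "w \<in> \<Union>Y" using v by (induction rule: converse_rtranclp_induct) (auto dest: E_A A_vertex)
  then have bw: "E\<^sup>*\<^sup>* b w" by (rule E_base)
  have "b \<in> verts (squaring Y b)" unfolding verts_squaring by (rule base)
  then have "walk (squaring Y b) b [b] b" by (simp add: walk_def)
  from walk_extend[where f = lvl, OF E_squaring bw this]
  obtain p where p: "walk (squaring Y b) b p w" "length p = Suc (lvl w)" by auto
  obtain q where q: "walk (squaring Y b) b q v" "set p \<subseteq> set q" "length q + lvl w = length p + lvl v"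
    using walk_extend[where f = lvl, OF E_squaring w p(1)] by blast
  have "w \<in> set p" using p(1) by (auto simp: walk_def)
  moreover have "geodesic (squaring Y b) b q v"
    using q p(2) gdist_squaring[OF v] by (simp add: geodesic_def)
  ultimately show "w \<in> {w. \<exists>p. geodesic (squaring Y b) b p v \<and> w \<in> set p}" using q(2) by blast
qed

text \<open>The last condition of \<open>down_closed\<close> rests on
  \<open>interval_no_double\<close>, and so on the common upper vertex \<open>v\<close>.\<close>

lemma interval_down_closed:
  assumes v: "v \<in> \<Union>Y"
  shows "down_closed {w. E\<^sup>*\<^sup>* w v}"
  unfolding down_closed_def
proof (intro conjI allI impI)
  show "{w. E\<^sup>*\<^sup>* w v} \<subseteq> \<Union>Y"
  proof
    fix w assume "w \<in> {w. E\<^sup>*\<^sup>* w v}"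
    then have "E\<^sup>*\<^sup>* w v" by simp
    then show "w \<in> \<Union>Y" using v by (induction rule: converse_rtranclp_induct) (auto dest: E_A A_vertex)
  qed
  show "b \<in> {w. E\<^sup>*\<^sup>* w v}" using E_base[OF v] by simp
  show "x \<in> {w. E\<^sup>*\<^sup>* w v}" if "E x y" "y \<in> {w. E\<^sup>*\<^sup>* w v}" for x y
    using that by (simp add: converse_rtranclp_into_rtranclp)
  show "x = y" if "x \<in> {w. E\<^sup>*\<^sup>* w v}" "y \<in> {w. E\<^sup>*\<^sup>* w v}" "E u x" "E u y" "E u' x" "E u' y" "u \<noteq> u'"
    for x y u u'
    using interval_no_double[of x v y u u'] that by simp
qed

section \<open>Links of intervals\<close>

text \<open>The disjuncts are sorted by the role of \<open>u\<close> in \<open>C\<close>: top, side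
  with \<open>p\<close> above, side with \<open>q\<close> above, bottom. In the last case the top is
  none of \<open>u\<close>, \<open>p\<close>, \<open>q\<close>, and its membership in
  \<open>J\<close> is recorded for the sake of uniqueness.\<close>

definition corner :: "'v set \<Rightarrow> 'v \<Rightarrow> 'v set set \<Rightarrow> 'v \<Rightarrow> 'v \<Rightarrow> bool" where
  "corner J u C p q \<longleftrightarrow> (\<exists>w. diamond u p q w \<and> C = Sq u p q w) \<or>
     (\<exists>y. diamond p u y q \<and> C = Sq p u y q) \<or> (\<exists>y. diamond q u y p \<and> C = Sq q u y p) \<or>
     (\<exists>t\<in>J. diamond t p q u \<and> C = Sq t p q u)"

lemma corner_sym:
  assumes "corner J u C p q"
  shows "corner J u C q p"
  using assms diamond_sym Sq_sym unfolding corner_def by metis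

lemma corner_neq:
  assumes "corner J u C p q"
  shows "p \<noteq> q"
  using assms diamond_distinct unfolding corner_def by fastforce

lemma corner_cases:
  assumes "corner J u C p q"
  obtains (top) w where "E p u" "E q u" "diamond u p q w" "C = Sq u p q w"
    | (up_down) y where "E u p" "E q u" "diamond p u y q" "C = Sq p u y q"
    | (down_up) y where "E p u" "E u q" "diamond q u y p" "C = Sq q u y p"
    | (bottom) t where "E u p" "E u q" "t \<in> J" "diamond t p q u" "C = Sq t p q u"
  using assms unfolding corner_def diamond_def by blast

lemma square_corner:
  assumes C: "C \<in> Qs J" and uC: "{e \<in> C. u \<in> e} = {{u, p}, {u, q}}"
  shows "corner J u C p q"
proof -
  obtain t x x' w where d: "diamond t x x' w" "t \<in> J" and Cd: "C = Sq t x x' w"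
    using C by (auto simp: Qs_def)
  have dist: "distinct [t, x, w, x']" using diamond_distinct[OF d(1)] .
  have nbr: "p = y \<and> q = y' \<or> p = y' \<and> q = y" if "{u, y} \<in> C" "{u, y'} \<in> C" "y \<noteq> y'" for y y'
  proof -
    have cancel: "a = c" if "{u, a} = {u, c}" for a c
      using that by (auto simp: doubleton_eq_iff)
    have "{u, y} \<in> {{u, p}, {u, q}}" "{u, y'} \<in> {{u, p}, {u, q}}" using that(1,2) unfolding uC[symmetric] by simp_all
    then have "y = p \<or> y = q" "y' = p \<or> y' = q"
      using cancel[of y p] cancel[of y q] cancel[of y' p] cancel[of y' q] by (simp_all only: insert_iff empty_iff) blast+
    then show ?thesis using that(3) by (elim disjE) simp_all
  qed
  have edges: "{t, x} \<in> C" "{t, x'} \<in> C" "{x, t} \<in> C" "{x, w} \<in> C" "{w, x} \<in> C" "{w, x'} \<in> C"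
    "{x', w} \<in> C" "{x', t} \<in> C"
    unfolding Cd Sq_def by auto
  have "{u, p} \<in> C" using uC by blast
  then have "u = t \<or> u = x \<or> u = w \<or> u = x'" unfolding Cd Sq_def by auto
  then have "corner J u C p q \<or> corner J u C q p"
  proof (elim disjE)
    assume u: "u = t"
    have "corner J u C x x'" unfolding corner_def u using d Cd by blast
    then show ?thesis using nbr[of x x'] u edges dist by auto
  next
    assume u: "u = x"
    have "corner J u C t w" unfolding corner_def u using d Cd by blast
    then show ?thesis using nbr[of t w] u edges dist by auto
  next
    assume u: "u = w"
    have "corner J u C x x'" unfolding corner_def u using d Cd by blast
    then show ?thesis using nbr[of x x'] u edges dist by auto
  next
    assume u: "u = x'"
    have "corner J u C t w" unfolding corner_def u using diamond_sym[OF d(1)] Cd Sq_sym by metis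
    then show ?thesis using nbr[of t w] u edges dist by auto
  qed
  then show ?thesis using corner_sym by blast
qed

text \<open>This excludes cycles of length two in links. At a top the bottom is unique, at a side
  the opposite side is the other lower neighbour of the top, and at a bottom the tops agree by the
  last condition of \<open>down_closed\<close>.\<close>

lemma corner_unique:
  assumes J: "down_closed J" and c: "corner J u C p q" and c': "corner J u C' p q"
  shows "C = C'"
  using c
proof (cases rule: corner_cases)
  case (top w)
  from c' show ?thesis
    by (cases rule: corner_cases) (use top E_asym diamond_unique_bottom in blast)+
next
  case (up_down y)
  from c' show ?thesis
  proof (cases rule: corner_cases)
    case (up_down y')
    have "y = y'"
      using E_at_most_two[of u p y y'] up_down \<open>diamond p u y q\<close> unfolding diamond_def by blast
    then show ?thesis using up_down \<open>C = Sq p u y q\<close> by simp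
  qed (use up_down E_asym in blast)+
next
  case (down_up y)
  from c' show ?thesis
  proof (cases rule: corner_cases)
    case (down_up y')
    have "y = y'"
      using E_at_most_two[of u q y y'] down_up \<open>diamond q u y p\<close> unfolding diamond_def by blast
    then show ?thesis using down_up \<open>C = Sq q u y p\<close> by simp
  qed (use down_up E_asym in blast)+
next
  case (bottom t)
  from c' show ?thesis
  proof (cases rule: corner_cases)
    case (bottom t')
    have "t = t'"
      using down_closedD(4)[OF J \<open>t \<in> J\<close> \<open>t' \<in> J\<close>, of p q] bottom \<open>diamond t p q u\<close>
      unfolding diamond_def by blast
    then show ?thesis using bottom \<open>C = Sq t p q u\<close> by simp
  qed (use bottom E_asym in blast)+
qed

lemma corner_up_up:
  assumes "corner J u C p q" "E u p" "E u q"
  shows "T u p q"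
  using assms(1)
proof (cases rule: corner_cases)
  case (bottom t)
  then have "A p q" using E_E_triangle[of p t q] T_A(1) by (auto simp: diamond_def)
  then show ?thesis using common_pred_triangle assms by blast
qed (use assms E_asym in blast)+

lemma corner_up_down:
  assumes "corner J u C p q" "E u p" "E q u"
  obtains y where "diamond p u y q"
  using assms(1)
proof (cases rule: corner_cases)
  case (up_down y)
  then show ?thesis using that by blast
qed (use assms E_asym in blast)+

lemma corner_direction:
  assumes "corner J u C p q"
  shows "E u p \<or> E p u"
  using assms by (cases rule: corner_cases) auto

text \<open>Both squares have top \<open>p\<close>, and their second side is the other lower
  neighbour of \<open>p\<close>. Hence \<open>q\<close> and \<open>r\<close> are bottoms of the same
  diamond.\<close>

lemma no_corner_triangle_one_up:
  assumes c: "corner J u C p q" "corner J u C' p r" and E: "E u p" "E q u" "E r u"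
  shows "q = r"
proof -
  obtain y where y: "diamond p u y q" using corner_up_down[OF c(1) E(1,2)] by metis
  obtain y' where y': "diamond p u y' r" using corner_up_down[OF c(2) E(1,3)] by metis
  have "y = y'" using E_at_most_two[of u p y y'] y y' unfolding diamond_def by blast
  then show ?thesis using diamond_unique_bottom y y' by blast
qed

text \<open>With \<open>y\<close> and \<open>z\<close> the remaining vertices of the two squares
  that contain \<open>r\<close>, the link of \<open>u\<close> in \<open>Y\<close> contains the
  closed walk \<open>p\<close>, \<open>q\<close>, \<open>z\<close>, \<open>r\<close>,
  \<open>y\<close> of length five.\<close>

lemma no_corner_triangle_two_up:
  assumes c: "corner J u C p q" "corner J u C' q r" "corner J u C'' p r"
    and E: "E u p" "E u q" "E r u"
  shows False
proof -
  have pq: "T u p q" using corner_up_up[OF c(1) E(1,2)] .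
  obtain y where y: "diamond p u y r" using corner_up_down[OF c(3) E(1,3)] by metis
  obtain z where z: "diamond q u z r" using corner_up_down[OF c(2) E(2,3)] by metis
  have y1: "T u y p" and z1: "T u z q" using y z E_E_triangle by (auto simp: diamond_def)
  have y2: "T r u y" and z2: "T r u z"
    using y z common_pred_triangle[OF T_A(1)[OF y1]] common_pred_triangle[OF T_A(1)[OF z1]]
    by (auto simp: diamond_def)
  show False
    by (rule no_link_5walk[OF pq T_perm(1)[OF z1] T_perm(3)[OF z2]
          T_perm(2)[OF y2] y1])
qed

text \<open>The cases are sorted by the number of neighbours above \<open>u\<close>. With three
  there would be a triangle in the link of \<open>u\<close> in \<open>Y\<close>, and with none
  \<open>u\<close> would have three lower neighbours.\<close>

lemma no_corner_triangle:
  assumes c: "corner J u C p q" "corner J u C' q r" "corner J u C'' r p"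
  shows False
proof -
  note s = corner_sym[OF c(1)] corner_sym[OF c(2)] corner_sym[OF c(3)]
  note n = corner_neq[OF c(1)] corner_neq[OF c(2)] corner_neq[OF c(3)]
  note d = corner_direction[OF c(1)] corner_direction[OF c(2)] corner_direction[OF c(3)]
  consider "E u p" "E u q" "E u r" | "E u p" "E u q" "E r u" | "E u p" "E q u" "E u r"
    | "E p u" "E u q" "E u r" | "E u p" "E q u" "E r u" | "E p u" "E u q" "E r u"
    | "E p u" "E q u" "E u r" | "E p u" "E q u" "E r u" using d by blast
  then show False
  proof cases
    case 1
    then show ?thesis using no_link_3cycle corner_up_up c by blast
  next
    case 2
    then show ?thesis using no_corner_triangle_two_up[OF c(1,2) s(3)] by simp
  next
    case 3
    then show ?thesis using no_corner_triangle_two_up[OF c(3,1) s(2)] by simp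
  next
    case 4
    then show ?thesis using no_corner_triangle_two_up[OF c(2,3) s(1)] by simp
  next
    case 5
    then show ?thesis using no_corner_triangle_one_up[OF c(1) s(3)] n by simp
  next
    case 6
    then show ?thesis using no_corner_triangle_one_up[OF s(1) c(2)] n by simp
  next
    case 7
    then show ?thesis using no_corner_triangle_one_up[OF s(2) c(3)] n by simp
  next
    case 8
    then show ?thesis using E_at_most_two[of p u q r] n by simp
  qed
qed

text \<open>Length one contradicts \<open>corner_neq\<close>, length two contradicts
  \<open>corner_unique\<close> because the squares of the cycle are distinct, and length three is
  \<open>no_corner_triangle\<close>.\<close>

lemma link_cycle_ge_4:
  assumes J: "down_closed J"
    and cyc: "square_link_cycle \<lparr>verts = J, edges = Ed J, squares = Qs J\<rparr> u es Cs"
  shows "4 \<le> length es"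
proof (rule ccontr)
  assume "\<not> 4 \<le> length es"
  define n where "n = length es"
  have c: "es \<noteq> []" "length Cs = n" "distinct Cs" "set es \<subseteq> {e \<in> Ed J. u \<in> e}" "set Cs \<subseteq> Qs J"
    "\<And>i. i < n \<Longrightarrow> {e \<in> Cs ! i. u \<in> e} = {es ! i, es ! (Suc i mod n)}"
    using cyc by (auto simp: square_link_cycle_def multigraph_cycle_def n_def)
  have n: "0 < n" "n < 4" using c(1) \<open>\<not> 4 \<le> length es\<close> by (auto simp: n_def)
  have "\<exists>a. es ! i = {u, a}" if "i < n" for i
  proof -
    have "es ! i \<in> set es" using that by (simp add: n_def)
    then have "es ! i \<in> Ed J" and u: "u \<in> es ! i" using c(4) by blast+
    then obtain x y where "es ! i = {x, y}" unfolding Ed_def by blast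
    moreover from this u have "u = x \<or> u = y" by simp
    ultimately show ?thesis by (metis insert_commute)
  qed
  then obtain a where a: "\<And>i. i < n \<Longrightarrow> es ! i = {u, a i}" by metis
  have cor: "corner J u (Cs ! i) (a i) (a (Suc i mod n))" if "i < n" for i
  proof (rule square_corner)
    show "Cs ! i \<in> Qs J" using c(2,5) that by auto
    show "{e \<in> Cs ! i. u \<in> e} = {{u, a i}, {u, a (Suc i mod n)}}"
      using c(6)[OF that] a[OF that] a[of "Suc i mod n"] n by simp
  qed
  consider "n = 1" | "n = 2" | "n = 3" using n by linarith
  then show False
  proof cases
    case 1
    then show False using corner_neq[OF cor[of 0]] by simp
  next
    case 2
    then have "corner J u (Cs ! 0) (a 0) (a 1)" "corner J u (Cs ! 1) (a 1) (a 0)"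
      using cor[of 0] cor[of 1] by simp_all
    then have "Cs ! 0 = Cs ! 1" using corner_unique[OF J] corner_sym by blast
    then show False using c(2,3) 2 by (simp add: nth_eq_iff_index_eq)
  next
    case 3
    then have "corner J u (Cs ! 0) (a 0) (a 1)" "corner J u (Cs ! 1) (a 1) (a 2)"
      "corner J u (Cs ! 2) (a 2) (a 0)"
      using cor[of 0] cor[of 1] cor[of 2] by (simp_all add: numeral_2_eq_2)
    then show False by (rule no_corner_triangle)
  qed
qed

lemma CAT0_interval:
  assumes "v \<in> \<Union>Y"
  shows "CAT0_square_complex (interval_complex (squaring Y b) b v)"
proof -
  let ?J = "{w. E\<^sup>*\<^sup>* w v}"
  note J = interval_down_closed[OF assms]
  have I: "interval_complex (squaring Y b) b v = \<lparr>verts = ?J, edges = Ed ?J, squares = Qs ?J\<rparr>"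
    unfolding interval_complex_def interval_vertices[OF assms]
    using gdist_one_skeleton J by (rule full_subcomplex_squaring)
  have K: "finite (K ?J)" "simply_connected (realization_points (K ?J))"
    using K_simply_connected[OF finite_below J] by auto
  have "simply_connected_space (realization (K ?J))"
    unfolding realization_finite[OF K(1)] simply_connected_space_top_of_set by (rule K(2))
  then show ?thesis
    unfolding I CAT0_square_complex_def
    using square_complex_diamonds[OF J] link_cycle_ge_4[OF J] by blast
qed

end

theorem theorem3p3:
  fixes Y :: "'v set set" and b :: 'v
  assumes "systolic_2complex Y"
    and "b \<in> verts (one_skeleton Y)"
  shows "flat_intervals (squaring Y b) b"
proof -
  interpret systolic Y b
    using assms by unfold_locales (simp_all add: one_skeleton_def)
  show ?thesis
    unfolding flat_intervals_def using CAT0_interval by (simp add: verts_squaring)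
qed

end
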